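(* Let $\mu_\kappa:\triangle\to\triangle'$ be a flip along an interior edge $\kappa$ of an ideal triangulation of a marked surface, and let $\mathbf p=\mathbf p^\triangle$, $\mathbf p'=\mathbf p^{\triangle'}$ be the components of a fixed global coefficient, with exchange ratios $\mathbf y,\mathbf y'$. The quantum cluster Poisson transformation $\mu_\kappa^\ast$ descends to an isomorphism $\mu_\kappa^\ast:\mathcal X^{\triangle'}_{\mathbf y'}\xrightarrow{\sim}\mathcal X^{\triangle}_{\mathbf y}$. For any sign $\epsilon\in\{+,-\}$ it is decomposed as $\mu_\kappa^\ast=\mu^\#_{\kappa,\epsilon}\circ\mu'_{\kappa,\epsilon}$, where $$\mu^\#_{\kappa,\epsilon}:=\left(\mathrm{Ad}_{\Psi_{\mathbf p_\kappa^{\epsilon}}(\overline X_\kappa^{\,\epsilon})}\right)^{\epsilon}$$ is an automorphism of $\mathcal X^\triangle_{\mathbf y}$.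
   Context: $N$ is a positive odd integer, $q^2$ a primitive $N$-th root of unity, $q=(q^2)^{(N+1)/2}$, so $q^N=1$. $\mathcal F_N=\{(p^+,p^-)\in(\mathbb C^\ast)^2:(p^+)^N+(p^-)^N=1\}$, $\overline{\mathcal F}_N=\mathcal F_N\cup\{(0,1)\}$; for $\mathbf p=(p^+,p^-)\in\mathcal F_N$, $\mathbf p^{+}:=\mathbf p$ and $\mathbf p^{-}:=\mathbf p^{-1}:=(p^-,p^+)$. Dilogarithm. $\Psi_{\mathbf p}(X)=\prod_{j=0}^{N-1}(p^-+q^{2j+1}p^+X)^{j/N}$, defined by a convergent power series on $|yX|<1$ ($y=p^+/p^-$) and continued analytically to $\mathbb C\setminus\bigcup_k\{|yX|>1,\arg(yX)=\pi(2k+1)/N\}$, with branches obtained by continuation from $\mathbf p=(0,1)$, so that $\Psi_{\mathbf p}(q^{2k})=\Psi_{\mathbf p}(1)\prod_{j=1}^k(p^-+q^{2j-1}p^+)$; parameters generic so that all $q^{2k}$ lie in the domain. For $x$ with $x^N=1$, $\Psi_{\mathbf p}(x)$ is defined by functional calculus (acting as $\Psi_{\mathbf p}(q^{2k})$ on the $q^{2k}$-eigencomponent of $x$), and is a polynomial in $x$. $\mathrm{Ad}_g(x)=gxg^{-1}$. Surface data. A marked surface is a compact oriented surface with a finite nonempty set $\mathbb M$ of marked points, each boundary component containing one, with $-2\chi(\Sigma\setminus\mathbb M)+|\mathbb M\cap\partial\Sigma|>0$. For an ideal triangulation $\triangle$ (vertex set $\mathbb M$), $e(\triangle)$, $e_{\rm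 int}(\triangle)$ are the edges and interior edges; $\pi_\triangle(\alpha)$ is the encircling edge if $\alpha$ is the interior edge of a self-folded triangle, else $\alpha$; $\varepsilon_{\alpha\beta}=\sum_T\varepsilon_{\alpha\beta}(T)$ over non-self-folded $T$, with $\varepsilon_{\alpha\beta}(T)=1$ (resp. $-1$) if $\pi_\triangle(\beta)$ is obtained from $\pi_\triangle(\alpha)$ by rotating clockwise (resp. counterclockwise) about their common corner in $T$, else $0$. Under a flip at $\kappa$, $\varepsilon'_{\alpha\beta}=-\varepsilon_{\alpha\beta}$ if $\kappa\in\{\alpha,\beta\}$, and otherwise $\varepsilon'_{\alpha\beta}=\varepsilon_{\alpha\beta}+[\varepsilon_{\alpha\kappa}]_+[\varepsilon_{\kappa\beta}]_+-[-\varepsilon_{\alpha\kappa}]_+[-\varepsilon_{\kappa\beta}]_+$, $[a]_+=\max(a,0)$; the new edge is again denoted $\kappa$ (or $\kappa'$). Coefficients. A global coefficient assigns to each $\triangle$ a tuple $\mathbf p^\triangle=(\mathbf p_\alpha)_{\alpha\in e(\triangle)}$, $\mathbf p_\alpha\in\mathcal F_N$ for interior $\alpha$ and $\overline{\mathcal F}_N$ for boundary $\alpha$, such that for each flip at $\kappa$: $p'^\pm_\kappa=p^\mp_\kappa$ and for $\alpha\ne\kappa$ $p'^+_\alpha/p'^-_\alpha=(p^+_\alpha/p^-_\alpha)(p_\kappa^+)^{\varepsilon_{\alpha\kappa}}$ if $\varepsilon_{\alpha\kappa}\ge0$, $(p^+_\alpha/p^-_\alpha)(p_\kappa^-)^{\varepsilon_{\alpha\kappa}}$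 if $\varepsilon_{\alpha\kappa}<0$. Exchange ratios: $y_\alpha=p^+_\alpha/p^-_\alpha$. Algebras. $\mathcal X^\triangle$ is the quantum torus over $\mathbb C$ generated by $X_\alpha^{\pm1}$, $\alpha\in e(\triangle)$, with $X_\alpha X_\beta=q^{2\varepsilon_{\alpha\beta}}X_\beta X_\alpha$; $\mathcal X^\triangle_{\mathbf y}$ is its quotient by $X_\alpha^N=y_\alpha^N$; $\overline X_\alpha=y_\alpha^{-1}X_\alpha$, so $\overline X_\alpha^N=1$ in the quotient. The quantum cluster Poisson transformation is the isomorphism of skew-fields $\mu_\kappa^\ast:\mathrm{Frac}\,\mathcal X^{\triangle'}\to\mathrm{Frac}\,\mathcal X^\triangle$ with $X'_{\kappa}\mapsto X_\kappa^{-1}$ and $X'_\alpha\mapsto X_\alpha\prod_{j=1}^{|\varepsilon_{\alpha\kappa}|}(1+q^{2j-1}X_\kappa^{-\mathrm{sgn}(\varepsilon_{\alpha\kappa})})^{-\mathrm{sgn}(\varepsilon_{\alpha\kappa})}$ for $\alpha\ne\kappa$; in terms of rescaled variables, for $\alpha\neq\kappa$, $\overline X'_\alpha\mapsto\overline X_\alpha\prod_{j=1}^{|\varepsilon_{\alpha\kappa}|}(p_\kappa^-+q^{2j-1}p_\kappa^+\overline X_\kappa)$ if $\varepsilon_{\alpha\kappa}<0$ and $\overline X_\alpha\prod_{j=1}^{|\varepsilon_{\alpha\kappa}|}(p_\kappa^++q^{2j-1}p_\kappa^-\overline X_\kappa^{-1})^{-1}$ if $\varepsilon_{\alpha\kappa}\ge0$.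 "Descends" means that these formulas define an isomorphism of the quotients. The monomial isomorphism $\mu'_{\kappa,\epsilon}:\mathcal X^{\triangle'}_{\mathbf y'}\to\mathcal X^\triangle_{\mathbf y}$ is $\overline X'_\kappa\mapsto\overline X_\kappa^{-1}$, $\overline X'_\alpha\mapsto[\overline X_\alpha\overline X_\kappa^{[\epsilon\varepsilon_{\alpha\kappa}]_+}]$ for $\alpha\ne\kappa$, where $[XY]=q^{-a}XY$ if $XY=q^{2a}YX$.
   Formalization: For a boundary edge with coefficient (0,1), where y=0 makes y^{-1}X undefined and X^N=y^N would kill the algebra, the generator itself is taken as the rescaled variable (relation X^N=1) and only the rescaled transformation formula is imposed. *)

theory Defs
  imports
    "HOL-Complex_Analysis.Winding_Numbers"
    "HOL-Homology.Homology_Groups"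
    "HOL-Algebra.QuotRing"
    "HOL-Algebra.Module"
    "HOL-Library.Poly_Mapping"
begin

section \<open>Oriented surfaces\<close>

text \<open>A surface is a topology \<open>S\<close> together with an oriented atlas \<open>A\<close> of pairs
  \<open>(U, \<phi>)\<close>, where \<open>\<phi>\<close> maps \<open>U\<close> homeomorphically to an open subset of the closed
  upper half plane.  Only continuity is required; orientation is expressed by winding numbers:
  an injective continuous map from a planar region preserves the orientation iff
  small positively oriented circles are sent to curves of winding number \<open>1\<close>.\<close>

type_synonym 'a atlas = "('a set \<times> ('a \<Rightarrow> complex)) set"

definition half_plane :: "complex set" where
  "half_plane = {z. Im z \<ge> 0}"

definition chart :: "'a topology \<Rightarrow> 'a set \<Rightarrow> ('a \<Rightarrow> complex) \<Rightarrow> bool" where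
  "chart S U \<phi> \<longleftrightarrow> openin S U \<and> openin (top_of_set half_plane) (\<phi> ` U) \<and>
     homeomorphic_map (subtopology S U) (top_of_set (\<phi> ` U)) \<phi>"

definition preserves_orientation :: "'a atlas \<Rightarrow> complex set \<Rightarrow> (complex \<Rightarrow> 'a) \<Rightarrow> bool" where
  "preserves_orientation A W f \<longleftrightarrow>
     (\<forall>(U, \<phi>) \<in> A. \<forall>z r. 0 < r \<and> cball z r \<subseteq> W \<and> f ` cball z r \<subseteq> U \<longrightarrow>
        winding_number (\<phi> \<circ> f \<circ> circlepath z r) (\<phi> (f z)) = 1)"

text \<open>Second countability is automatic for compact spaces covered by charts.\<close>

definition compact_oriented_surface :: "'a topology \<Rightarrow> 'a atlas \<Rightarrow> bool" where
  "compact_oriented_surface S A \<longleftrightarrow>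
     compact_space S \<and> Hausdorff_space S \<and>
     (\<forall>(U, \<phi>) \<in> A. chart S U \<phi>) \<and> topspace S = \<Union> (fst ` A) \<and>
     (\<forall>(U, \<phi>) \<in> A. preserves_orientation A {z \<in> \<phi> ` U. Im z > 0} (inv_into U \<phi>))"

text \<open>By invariance of domain this does not depend on the chart around the point.\<close>

definition surface_boundary :: "'a atlas \<Rightarrow> 'a set" where
  "surface_boundary A = {x. \<exists>(U, \<phi>) \<in> A. x \<in> U \<and> Im (\<phi> x) = 0}"

text \<open>Rank of a (multiplicatively written) abelian group: the maximal size of a
  \<open>\<int>\<close>-linearly independent subset.\<close>

definition abelian_rank :: "('g, 'm) monoid_scheme \<Rightarrow> nat" where
  "abelian_rank G = Sup {card B | B. finite B \<and> B \<subseteq> carrier G \<and>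
     (\<forall>n :: 'g \<Rightarrow> int. finprod G (\<lambda>x. x [^]\<^bsub>G\<^esub> n x) B = \<one>\<^bsub>G\<^esub> \<longrightarrow> (\<forall>x\<in>B. n x = 0))}"

definition euler_char :: "'a topology \<Rightarrow> int" where
  "euler_char X = (\<Sum>p\<le>2. (-1) ^ p * int (abelian_rank (homology_group (int p) X)))"

definition marked_surface :: "'a topology \<Rightarrow> 'a atlas \<Rightarrow> 'a set \<Rightarrow> bool" where
  "marked_surface S A M \<longleftrightarrow>
     compact_oriented_surface S A \<and> finite M \<and> M \<noteq> {} \<and> M \<subseteq> topspace S \<and>
     (\<forall>C \<in> connected_components_of (subtopology S (surface_boundary A)). C \<inter> M \<noteq> {}) \<and>
     - 2 * euler_char (subtopology S (topspace S - M)) + int (card (M \<inter> surface_boundary A)) > 0"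


section \<open>Ideal triangulations and flips\<close>

definition ideal_arc :: "'a topology \<Rightarrow> 'a atlas \<Rightarrow> 'a set \<Rightarrow> 'a set \<Rightarrow> bool" where
  "ideal_arc S A M e \<longleftrightarrow>
     (\<exists>g. pathin S g \<and> g ` {0..1} = e \<and> g 0 \<in> M \<and> g 1 \<in> M \<and>
        inj_on g {0<..<1} \<and> g ` {0<..<1} \<inter> M = {} \<and>
        (g ` {0<..<1} \<subseteq> surface_boundary A \<or> g ` {0<..<1} \<inter> surface_boundary A = {}))"

text \<open>\<open>side D T i\<close>, for \<open>i < 3\<close>, are the three sides of the triangle \<open>T\<close> (an open subset
  of the surface) in counterclockwise order; only the cyclic order is meaningful.\<close>

record 'a triangulation =
  edges :: "'a set set"
  faces :: "'a set set"
  side :: "'a set \<Rightarrow> nat \<Rightarrow> 'a set"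

definition std_triangle :: "complex set" where
  "std_triangle = {z. Re z \<ge> 0 \<and> Im z \<ge> 0 \<and> Re z + Im z \<le> 1}"

definition open_std_triangle :: "complex set" where
  "open_std_triangle = {z. Re z > 0 \<and> Im z > 0 \<and> Re z + Im z < 1}"

definition std_vertex :: "nat \<Rightarrow> complex" where
  "std_vertex i = (if i = 0 then 0 else if i = 1 then 1 else \<i>)"

text \<open>\<open>f\<close> parametrizes the face \<open>T\<close> by the standard triangle; it may identify points of the
  boundary of the standard triangle only (as happens for self-folded triangles).\<close>

definition triangle_map ::
  "'a topology \<Rightarrow> 'a atlas \<Rightarrow> 'a set \<Rightarrow> 'a set \<Rightarrow> (nat \<Rightarrow> 'a set) \<Rightarrow> (complex \<Rightarrow> 'a) \<Rightarrow> bool" where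
  "triangle_map S A M T s f \<longleftrightarrow>
     continuous_map (top_of_set std_triangle) S f \<and>
     inj_on f open_std_triangle \<and> f ` open_std_triangle = T \<and>
     preserves_orientation A open_std_triangle f \<and>
     (\<forall>i<3. let v = std_vertex i; w = std_vertex ((i + 1) mod 3) in
        f v \<in> M \<and> f ` closed_segment v w = s i \<and>
        inj_on f (open_segment v w) \<and> f ` open_segment v w \<inter> M = {})"

definition interior_edges :: "'a atlas \<Rightarrow> 'a triangulation \<Rightarrow> 'a set set" where
  "interior_edges A D = {e \<in> edges D. \<not> e \<subseteq> surface_boundary A}"

definition ideal_triangulation ::
  "'a topology \<Rightarrow> 'a atlas \<Rightarrow> 'a set \<Rightarrow> 'a triangulation \<Rightarrow> bool" where
  "ideal_triangulation S A M D \<longleftrightarrow>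
     finite (edges D) \<and> (\<forall>e \<in> edges D. ideal_arc S A M e) \<and>
     (\<forall>e \<in> edges D. \<forall>e' \<in> edges D. e \<noteq> e' \<longrightarrow> e \<inter> e' \<subseteq> M) \<and>
     surface_boundary A \<union> M \<subseteq> \<Union> (edges D) \<and>
     finite (faces D) \<and>
     faces D = connected_components_of (subtopology S (topspace S - \<Union> (edges D))) \<and>
     (\<forall>T \<in> faces D. (\<forall>i<3. side D T i \<in> edges D) \<and>
        (\<exists>f. triangle_map S A M T (side D T) f)) \<and>
     (\<forall>e \<in> edges D. card {(T, i). T \<in> faces D \<and> i < 3 \<and> side D T i = e} =
        (if e \<in> interior_edges A D then 2 else 1))"

definition face_sides :: "'a triangulation \<Rightarrow> 'a set \<Rightarrow> 'a set \<Rightarrow> 'a set \<Rightarrow> 'a set \<Rightarrow> bool" where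
  "face_sides D T a b c \<longleftrightarrow>
     (\<exists>i<3. side D T i = a \<and> side D T ((i + 1) mod 3) = b \<and> side D T ((i + 2) mod 3) = c)"

text \<open>\<open>T\<close> is self-folded with interior edge \<open>\<alpha>\<close> and encircling edge \<open>\<beta>\<close>.\<close>

definition self_folded :: "'a triangulation \<Rightarrow> 'a set \<Rightarrow> 'a set \<Rightarrow> 'a set \<Rightarrow> bool" where
  "self_folded D T \<alpha> \<beta> \<longleftrightarrow> T \<in> faces D \<and> face_sides D T \<beta> \<alpha> \<alpha>"

definition encircling :: "'a triangulation \<Rightarrow> 'a set \<Rightarrow> 'a set" where
  "encircling D \<alpha> =
     (if \<exists>T \<beta>. self_folded D T \<alpha> \<beta> then (THE \<beta>. \<exists>T. self_folded D T \<alpha> \<beta>) else \<alpha>)"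

text \<open>In a triangle whose sides are listed counterclockwise, rotating a side clockwise about the
  corner it shares with the next side of the list produces that next side.\<close>

definition exchange_in :: "'a triangulation \<Rightarrow> 'a set \<Rightarrow> 'a set \<Rightarrow> 'a set \<Rightarrow> int" where
  "exchange_in D T \<alpha> \<beta> =
     (if \<exists>c. face_sides D T (encircling D \<alpha>) (encircling D \<beta>) c then 1
      else if \<exists>c. face_sides D T (encircling D \<beta>) (encircling D \<alpha>) c then - 1
      else 0)"

definition exchange :: "'a triangulation \<Rightarrow> 'a set \<Rightarrow> 'a set \<Rightarrow> int" where
  "exchange D \<alpha> \<beta> =
     (\<Sum>T \<in> {T \<in> faces D. \<nexists>\<gamma> \<delta>. self_folded D T \<gamma> \<delta>}. exchange_in D T \<alpha> \<beta>)"

definition unit_square :: "complex set" where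
  "unit_square = {z. 0 \<le> Re z \<and> Re z \<le> 1 \<and> 0 \<le> Im z \<and> Im z \<le> 1}"

definition open_unit_square :: "complex set" where
  "open_unit_square = {z. 0 < Re z \<and> Re z < 1 \<and> 0 < Im z \<and> Im z < 1}"

text \<open>The flip replaces the diagonal \<open>\<kappa>\<close> of a quadrilateral \<open>Q\<close> (whose sides may be
  identified with each other in the surface) by the other diagonal \<open>\<kappa>'\<close>.  Triangulations are
  given by actual arcs here; a flip of isotopy classes is a flip of suitable representatives.\<close>

definition flip ::
  "'a topology \<Rightarrow> 'a atlas \<Rightarrow> 'a set \<Rightarrow> 'a triangulation \<Rightarrow> 'a set \<Rightarrow> 'a set \<Rightarrow>
   'a triangulation \<Rightarrow> bool" where
  "flip S A M D \<kappa> \<kappa>' D' \<longleftrightarrow>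
     ideal_triangulation S A M D \<and> ideal_triangulation S A M D' \<and>
     \<kappa> \<in> interior_edges A D \<and> \<kappa>' \<notin> edges D \<and> edges D' = insert \<kappa>' (edges D - {\<kappa>}) \<and>
     (\<exists>Q. let
        e0 = Q ` closed_segment 0 1; e1 = Q ` closed_segment 1 (1 + \<i>);
        e2 = Q ` closed_segment (1 + \<i>) \<i>; e3 = Q ` closed_segment \<i> 0;
        T1 = Q ` {z \<in> open_unit_square. Im z < Re z};
        T2 = Q ` {z \<in> open_unit_square. Re z < Im z};
        T1' = Q ` {z \<in> open_unit_square. Re z + Im z < 1};
        T2' = Q ` {z \<in> open_unit_square. Re z + Im z > 1}
      in
        continuous_map (top_of_set unit_square) S Q \<and> inj_on Q open_unit_square \<and>
        preserves_orientation A open_unit_square Q \<and> Q ` {0, 1, 1 + \<i>, \<i>} \<subseteq> M \<and>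
        Q ` closed_segment 0 (1 + \<i>) = \<kappa> \<and> Q ` closed_segment 1 \<i> = \<kappa>' \<and>
        T1 \<in> faces D \<and> face_sides D T1 e0 e1 \<kappa> \<and>
        T2 \<in> faces D \<and> face_sides D T2 \<kappa> e2 e3 \<and>
        T1' \<in> faces D' \<and> face_sides D' T1' e0 \<kappa>' e3 \<and>
        T2' \<in> faces D' \<and> face_sides D' T2' e1 e2 \<kappa>' \<and>
        faces D - {T1, T2} = faces D' - {T1', T2'} \<and>
        (\<forall>T \<in> faces D - {T1, T2}. \<forall>a b c. face_sides D T a b c \<longleftrightarrow> face_sides D' T a b c))"


section \<open>Global coefficients\<close>

definition fermat :: "nat \<Rightarrow> (complex \<times> complex) set" where
  "fermat N = {(a, b). a \<noteq> 0 \<and> b \<noteq> 0 \<and> a ^ N + b ^ N = 1}"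

definition fermat_bar :: "nat \<Rightarrow> (complex \<times> complex) set" where
  "fermat_bar N = insert (0, 1) (fermat N)"

definition exchange_ratio :: "complex \<times> complex \<Rightarrow> complex" where
  "exchange_ratio p = fst p / snd p"

text \<open>For a sign \<open>s = 1\<close> or \<open>s = - 1\<close>.\<close>

definition coeff_power :: "complex \<times> complex \<Rightarrow> int \<Rightarrow> complex \<times> complex" where
  "coeff_power p s = (if s = 1 then p else (snd p, fst p))"

definition ambient_isotopy_end ::
  "'a topology \<Rightarrow> 'a set \<Rightarrow> ('a \<Rightarrow> 'a) \<Rightarrow> bool" where
  "ambient_isotopy_end S M h \<longleftrightarrow>
     (\<exists>H. continuous_map (prod_topology (top_of_set {0..1::real}) S) S H \<and>
        (\<forall>t \<in> {0..1}. homeomorphic_map S S (\<lambda>x. H (t, x)) \<and> (\<forall>m \<in> M. H (t, m) = m)) \<and>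
        (\<forall>x \<in> topspace S. H (0, x) = x \<and> H (1, x) = h x))"

text \<open>The invariance condition says that the coefficients belong to isotopy classes of ideal
  triangulations; with \<open>h = id\<close> it also gives independence of the numbering of the sides.\<close>

definition global_coefficient ::
  "nat \<Rightarrow> 'a topology \<Rightarrow> 'a atlas \<Rightarrow> 'a set \<Rightarrow>
   ('a triangulation \<Rightarrow> 'a set \<Rightarrow> complex \<times> complex) \<Rightarrow> bool" where
  "global_coefficient N S A M P \<longleftrightarrow>
     (\<forall>D. ideal_triangulation S A M D \<longrightarrow>
        (\<forall>\<alpha> \<in> edges D. P D \<alpha> \<in> (if \<alpha> \<in> interior_edges A D then fermat N else fermat_bar N))) \<and>
     (\<forall>D D' h. ideal_triangulation S A M D \<and> ideal_triangulation S A M D' \<and>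
        ambient_isotopy_end S M h \<and> edges D' = (`) h ` edges D \<longrightarrow>
        (\<forall>\<alpha> \<in> edges D. P D' (h ` \<alpha>) = P D \<alpha>)) \<and>
     (\<forall>D \<kappa> \<kappa>' D'. flip S A M D \<kappa> \<kappa>' D' \<longrightarrow>
        fst (P D' \<kappa>') = snd (P D \<kappa>) \<and> snd (P D' \<kappa>') = fst (P D \<kappa>) \<and>
        (\<forall>\<alpha> \<in> edges D - {\<kappa>}.
           exchange_ratio (P D' \<alpha>) = exchange_ratio (P D \<alpha>) *
             (if exchange D \<alpha> \<kappa> \<ge> 0 then fst (P D \<kappa>) powi exchange D \<alpha> \<kappa>
              else snd (P D \<kappa>) powi exchange D \<alpha> \<kappa>)))"


section \<open>Quantum tori\<close>

text \<open>Words, written additively so that \<open>'g word \<Rightarrow>\<^sub>0 complex\<close> is the free associative algebra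
  with generators \<open>'g\<close>.\<close>

datatype 'g word = Word (letters: "'g list")

instantiation word :: (type) monoid_add
begin

definition zero_word :: "'a word" where "0 = Word []"

definition plus_word :: "'a word \<Rightarrow> 'a word \<Rightarrow> 'a word" where
  "u + v = Word (letters u @ letters v)"

instance
  by standard (simp_all add: zero_word_def plus_word_def)

end

text \<open>The letter \<open>(\<alpha>, True)\<close> is the generator \<open>X\<^sub>\<alpha>\<close>, the letter \<open>(\<alpha>, False)\<close>
  its inverse.\<close>

type_synonym 'e free_elt = "('e \<times> bool) word \<Rightarrow>\<^sub>0 complex"

definition free_algebra :: "'e set \<Rightarrow> 'e free_elt ring" where
  "free_algebra E =
     \<lparr>carrier = {f. \<forall>w \<in> Poly_Mapping.keys f. set (letters w) \<subseteq> E \<times> UNIV},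
      mult = (*), one = 1, zero = 0, add = (+)\<rparr>"

definition free_gen :: "'e \<Rightarrow> bool \<Rightarrow> 'e free_elt" where
  "free_gen \<alpha> b = Poly_Mapping.single (Word [(\<alpha>, b)]) 1"

definition free_scalar :: "complex \<Rightarrow> 'e free_elt" where
  "free_scalar c = Poly_Mapping.single 0 c"

definition torus_relators ::
  "complex \<Rightarrow> ('e \<Rightarrow> 'e \<Rightarrow> int) \<Rightarrow> 'e set \<Rightarrow> 'e free_elt set" where
  "torus_relators q \<epsilon> E =
     {free_gen \<alpha> b * free_gen \<alpha> (\<not> b) - 1 | \<alpha> b. \<alpha> \<in> E} \<union>
     {free_gen \<alpha> True * free_gen \<beta> True -
        free_scalar (q powi (2 * \<epsilon> \<alpha> \<beta>)) * (free_gen \<beta> True * free_gen \<alpha> True) | \<alpha> \<beta>.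
        \<alpha> \<in> E \<and> \<beta> \<in> E}"

definition torus_ideal ::
  "complex \<Rightarrow> ('e \<Rightarrow> 'e \<Rightarrow> int) \<Rightarrow> 'e set \<Rightarrow> 'e free_elt set" where
  "torus_ideal q \<epsilon> E = Idl\<^bsub>free_algebra E\<^esub> (torus_relators q \<epsilon> E)"

definition quantum_torus ::
  "complex \<Rightarrow> ('e \<Rightarrow> 'e \<Rightarrow> int) \<Rightarrow> 'e set \<Rightarrow> 'e free_elt set ring" where
  "quantum_torus q \<epsilon> E = free_algebra E Quot torus_ideal q \<epsilon> E"

definition torus_class ::
  "complex \<Rightarrow> ('e \<Rightarrow> 'e \<Rightarrow> int) \<Rightarrow> 'e set \<Rightarrow> 'e free_elt \<Rightarrow> 'e free_elt set" where
  "torus_class q \<epsilon> E f = torus_ideal q \<epsilon> E +>\<^bsub>free_algebra E\<^esub> f"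

text \<open>The quotient of the quantum torus by the relations \<open>X\<^sub>\<alpha>\<^sup>N = u\<^sub>\<alpha>\<^sup>N\<close>.\<close>

definition cyclic_ideal ::
  "nat \<Rightarrow> complex \<Rightarrow> ('e \<Rightarrow> 'e \<Rightarrow> int) \<Rightarrow> 'e set \<Rightarrow> ('e \<Rightarrow> complex) \<Rightarrow> 'e free_elt set set" where
  "cyclic_ideal N q \<epsilon> E u =
     (let T = quantum_torus q \<epsilon> E in
      Idl\<^bsub>T\<^esub> {torus_class q \<epsilon> E (free_gen \<alpha> True) [^]\<^bsub>T\<^esub> N \<ominus>\<^bsub>T\<^esub>
               torus_class q \<epsilon> E (free_scalar (u \<alpha> ^ N)) | \<alpha>. \<alpha> \<in> E})"

definition cyclic_class ::
  "nat \<Rightarrow> complex \<Rightarrow> ('e \<Rightarrow> 'e \<Rightarrow> int) \<Rightarrow> 'e set \<Rightarrow> ('e \<Rightarrow> complex) \<Rightarrow>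
   'e free_elt \<Rightarrow> 'e free_elt set set" where
  "cyclic_class N q \<epsilon> E u f =
     cyclic_ideal N q \<epsilon> E u +>\<^bsub>quantum_torus q \<epsilon> E\<^esub> torus_class q \<epsilon> E f"

definition cyclic_torus ::
  "nat \<Rightarrow> complex \<Rightarrow> ('e \<Rightarrow> 'e \<Rightarrow> int) \<Rightarrow> 'e set \<Rightarrow> ('e \<Rightarrow> complex) \<Rightarrow>
   (complex, 'e free_elt set set) module" where
  "cyclic_torus N q \<epsilon> E u =
     (let R = quantum_torus q \<epsilon> E Quot cyclic_ideal N q \<epsilon> E u in
      \<lparr>carrier = carrier R, mult = mult R, one = one R, zero = zero R, add = add R,
       smult = (\<lambda>c x. cyclic_class N q \<epsilon> E u (free_scalar c) \<otimes>\<^bsub>R\<^esub> x)\<rparr>)"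

text \<open>A boundary edge may carry the coefficient \<open>(0, 1)\<close>, with exchange ratio \<open>0\<close>.  Then the
  rescaled variable, which is to satisfy \<open>x\<^sup>N = 1\<close>, cannot be obtained by dividing by the ratio;
  in this case, and only then, the generator itself serves as the rescaled variable.\<close>

definition rescaling :: "complex \<times> complex \<Rightarrow> complex" where
  "rescaling p = (if fst p = 0 then 1 else exchange_ratio p)"

definition X_algebra ::
  "nat \<Rightarrow> complex \<Rightarrow> 'a triangulation \<Rightarrow> ('a set \<Rightarrow> complex \<times> complex) \<Rightarrow>
   (complex, 'a set free_elt set set) module" where
  "X_algebra N q D p = cyclic_torus N q (exchange D) (edges D) (\<lambda>\<alpha>. rescaling (p \<alpha>))"

definition X_var ::
  "nat \<Rightarrow> complex \<Rightarrow> 'a triangulation \<Rightarrow> ('a set \<Rightarrow> complex \<times> complex) \<Rightarrow> 'a set \<Rightarrow>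
   'a set free_elt set set" where
  "X_var N q D p \<alpha> =
     cyclic_class N q (exchange D) (edges D) (\<lambda>\<alpha>. rescaling (p \<alpha>)) (free_gen \<alpha> True)"

definition X_bar ::
  "nat \<Rightarrow> complex \<Rightarrow> 'a triangulation \<Rightarrow> ('a set \<Rightarrow> complex \<times> complex) \<Rightarrow> 'a set \<Rightarrow>
   'a set free_elt set set" where
  "X_bar N q D p \<alpha> = inverse (rescaling (p \<alpha>)) \<odot>\<^bsub>X_algebra N q D p\<^esub> X_var N q D p \<alpha>"


section \<open>Algebra maps\<close>

definition alg_hom :: "(complex, 'x) module \<Rightarrow> (complex, 'y) module \<Rightarrow> ('x \<Rightarrow> 'y) set" where
  "alg_hom R R' =
     {\<phi> \<in> ring_hom R R'. \<forall>c. \<forall>x \<in> carrier R. \<phi> (c \<odot>\<^bsub>R\<^esub> x) = c \<odot>\<^bsub>R'\<^esub> \<phi> x}"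

definition alg_iso :: "(complex, 'x) module \<Rightarrow> (complex, 'y) module \<Rightarrow> ('x \<Rightarrow> 'y) set" where
  "alg_iso R R' = {\<phi> \<in> alg_hom R R'. bij_betw \<phi> (carrier R) (carrier R')}"

definition ordered_prod :: "('x, 'm) monoid_scheme \<Rightarrow> (nat \<Rightarrow> 'x) \<Rightarrow> nat \<Rightarrow> 'x" where
  "ordered_prod R f n = foldr (\<lambda>j a. f j \<otimes>\<^bsub>R\<^esub> a) [1..<Suc n] \<one>\<^bsub>R\<^esub>"

definition cluster_factor :: "(complex, 'x) module \<Rightarrow> complex \<Rightarrow> complex \<Rightarrow> complex \<Rightarrow> 'x \<Rightarrow> nat \<Rightarrow> 'x" where
  "cluster_factor R q a b x j = a \<odot>\<^bsub>R\<^esub> \<one>\<^bsub>R\<^esub> \<oplus>\<^bsub>R\<^esub> (q powi (2 * int j - 1) * b) \<odot>\<^bsub>R\<^esub> x"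

text \<open>\<open>\<phi>\<close> satisfies the formulas of the quantum cluster Poisson transformation, read in the
  quotients, where the factors to be inverted have to be units: the first two clauses in the
  variables \<open>X\<close>, the last two in the rescaled ones.  The formula for \<open>X\<^sub>\<alpha>\<close> is omitted where
  the exchange ratio vanishes (see \<open>rescaling\<close>); the rescaled one still applies there.\<close>

definition cluster_poisson ::
  "nat \<Rightarrow> complex \<Rightarrow> 'a triangulation \<Rightarrow> ('a set \<Rightarrow> complex \<times> complex) \<Rightarrow> 'a set \<Rightarrow>
   'a triangulation \<Rightarrow> ('a set \<Rightarrow> complex \<times> complex) \<Rightarrow> 'a set \<Rightarrow>
   ('a set free_elt set set \<Rightarrow> 'a set free_elt set set) \<Rightarrow> bool" where
  "cluster_poisson N q D p \<kappa> D' p' \<kappa>' \<phi> \<longleftrightarrow>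
     (let R = X_algebra N q D p; X = X_var N q D p; Xb = X_bar N q D p;
          X' = X_var N q D' p'; Xb' = X_bar N q D' p';
          a = fst (p \<kappa>); b = snd (p \<kappa>)
      in
        \<phi> (X' \<kappa>') = inv\<^bsub>R\<^esub> (X \<kappa>) \<and>
        (\<forall>\<alpha> \<in> edges D - {\<kappa>}. exchange_ratio (p \<alpha>) \<noteq> 0 \<longrightarrow>
           (let n = exchange D \<alpha> \<kappa>;
                F = cluster_factor R q 1 1 (X \<kappa> [^]\<^bsub>R\<^esub> (- sgn n))
            in (\<forall>j \<in> {1..nat \<bar>n\<bar>}. F j \<in> Units R) \<and>
               \<phi> (X' \<alpha>) =
                 X \<alpha> \<otimes>\<^bsub>R\<^esub> ordered_prod R (\<lambda>j. F j [^]\<^bsub>R\<^esub> (- sgn n)) (nat \<bar>n\<bar>))) \<and>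
        \<phi> (Xb' \<kappa>') = inv\<^bsub>R\<^esub> (Xb \<kappa>) \<and>
        (\<forall>\<alpha> \<in> edges D - {\<kappa>}.
           (let n = exchange D \<alpha> \<kappa>;
                F = cluster_factor R q b a (Xb \<kappa>);
                G = cluster_factor R q a b (inv\<^bsub>R\<^esub> (Xb \<kappa>))
            in if n < 0
               then \<phi> (Xb' \<alpha>) = Xb \<alpha> \<otimes>\<^bsub>R\<^esub> ordered_prod R F (nat \<bar>n\<bar>)
               else (\<forall>j \<in> {1..nat n}. G j \<in> Units R) \<and>
                    \<phi> (Xb' \<alpha>) = Xb \<alpha> \<otimes>\<^bsub>R\<^esub> ordered_prod R (\<lambda>j. inv\<^bsub>R\<^esub> (G j)) (nat n))))"

text \<open>The bracket \<open>[x y] = q\<^sup>-\<^sup>a x y\<close> where \<open>x y = q\<^sup>2\<^sup>a y x\<close>.\<close>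

definition weyl_bracket :: "(complex, 'x) module \<Rightarrow> complex \<Rightarrow> 'x \<Rightarrow> 'x \<Rightarrow> 'x" where
  "weyl_bracket R q x y =
     (THE z. \<exists>a :: int. x \<otimes>\<^bsub>R\<^esub> y = (q powi (2 * a)) \<odot>\<^bsub>R\<^esub> (y \<otimes>\<^bsub>R\<^esub> x) \<and>
        z = (q powi (- a)) \<odot>\<^bsub>R\<^esub> (x \<otimes>\<^bsub>R\<^esub> y))"

definition monomial_transformation ::
  "nat \<Rightarrow> complex \<Rightarrow> 'a triangulation \<Rightarrow> ('a set \<Rightarrow> complex \<times> complex) \<Rightarrow> 'a set \<Rightarrow>
   'a triangulation \<Rightarrow> ('a set \<Rightarrow> complex \<times> complex) \<Rightarrow> 'a set \<Rightarrow> int \<Rightarrow>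
   ('a set free_elt set set \<Rightarrow> 'a set free_elt set set) \<Rightarrow> bool" where
  "monomial_transformation N q D p \<kappa> D' p' \<kappa>' s \<nu> \<longleftrightarrow>
     (let R = X_algebra N q D p; Xb = X_bar N q D p; Xb' = X_bar N q D' p'
      in
        \<nu> (Xb' \<kappa>') = inv\<^bsub>R\<^esub> (Xb \<kappa>) \<and>
        (\<forall>\<alpha> \<in> edges D - {\<kappa>}.
           \<nu> (Xb' \<alpha>) =
             weyl_bracket R q (Xb \<alpha>) (Xb \<kappa> [^]\<^bsub>R\<^esub> (max (s * exchange D \<alpha> \<kappa>) 0))))"


section \<open>The cyclic dilogarithm\<close>

text \<open>The plane slit along the rays \<open>\<bar>y X\<bar> > 1\<close>, \<open>arg (y X) = \<pi> (2 k + 1) / N\<close>.\<close>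

definition dilog_domain :: "nat \<Rightarrow> complex \<times> complex \<Rightarrow> complex set" where
  "dilog_domain N p =
     {X. \<nexists>(k :: int) r. r > 1 \<and>
        exchange_ratio p * X = of_real r * cis (pi * (2 * of_int k + 1) / of_int (int N))}"

text \<open>The function on the slit plane given by the power series at \<open>X = 0\<close>: the \<open>j\<close>-th factor is
  \<open>(p\<^sup>-)\<^sup>j\<^sup>/\<^sup>N (1 + q\<^sup>2\<^sup>j\<^sup>+\<^sup>1 y X)\<^sup>j\<^sup>/\<^sup>N\<close>.  The cut of the principal power is contained in the
  slits, and the exponents \<open>j / N\<close> of \<open>p\<^sup>-\<close> add up to the integer \<open>(N - 1) / 2\<close>.\<close>

definition dilog_series :: "nat \<Rightarrow> complex \<Rightarrow> complex \<times> complex \<Rightarrow> complex \<Rightarrow> complex" where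
  "dilog_series N q p X =
     snd p ^ ((N - 1) div 2) *
     (\<Prod>j<N. (1 + q ^ (2 * j + 1) * exchange_ratio p * X) powr of_real (real j / real N))"

text \<open>\<open>v\<close> is the value at \<open>X\<close> of the branch of
  \<open>\<Prod>j<N. (p\<^sup>- + q\<^sup>2\<^sup>j\<^sup>+\<^sup>1 p\<^sup>+ X)\<^sup>j\<^sup>/\<^sup>N\<close> obtained from \<open>dilog_series\<close> near \<open>(0, 1)\<close> by continuation
  in \<open>p\<close> along the path \<open>\<gamma>\<close>.\<close>

definition dilog_continuation ::
  "nat \<Rightarrow> complex \<Rightarrow> (real \<Rightarrow> complex \<times> complex) \<Rightarrow> complex \<Rightarrow> complex \<Rightarrow> bool" where
  "dilog_continuation N q \<gamma> X v \<longleftrightarrow>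
     (\<forall>t \<in> {0..1}. \<forall>j<N. snd (\<gamma> t) + q ^ (2 * j + 1) * fst (\<gamma> t) * X \<noteq> 0) \<and>
     (\<exists>h. continuous_on {0..1} h \<and>
        (\<forall>t \<in> {0..1}. h t ^ N = (\<Prod>j<N. (snd (\<gamma> t) + q ^ (2 * j + 1) * fst (\<gamma> t) * X) ^ j)) \<and>
        (\<forall>\<^sub>F t in at_right 0. h t = dilog_series N q (\<gamma> t) X) \<and>
        h 1 = v)"

text \<open>\<open>\<Psi>\<close> is a branch of the dilogarithm with parameter \<open>p\<close>, recorded at the points
  \<open>q\<^sup>2\<^sup>k\<close>.  The same path is used for all of them, which is what makes
  \<open>\<Psi> (q\<^sup>2\<^sup>k) = \<Psi> 1 * (\<Prod>j=1..k. p\<^sup>- + q\<^sup>2\<^sup>j\<^sup>-\<^sup>1 p\<^sup>+)\<close> hold.  On the slit plane for a fixed \<open>p\<close> this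
  relation holds for \<open>dilog_series\<close> only if \<open>p\<^sup>-\<close> is the principal root of
  \<open>(1 + y\<^sup>N)\<^sup>-\<^sup>1\<close>, hence the continuation in \<open>p\<close>.\<close>

definition dilog_branch ::
  "nat \<Rightarrow> complex \<Rightarrow> complex \<times> complex \<Rightarrow> (complex \<Rightarrow> complex) \<Rightarrow> bool" where
  "dilog_branch N q p \<Psi> \<longleftrightarrow>
     (\<exists>\<gamma>. path \<gamma> \<and> path_image \<gamma> \<subseteq> fermat_bar N \<and> pathstart \<gamma> = (0, 1) \<and> pathfinish \<gamma> = p \<and>
        (\<forall>k<N. dilog_continuation N q \<gamma> (q ^ (2 * k)) (\<Psi> (q ^ (2 * k)))))"

text \<open>For \<open>x\<^sup>N = 1\<close>: the projector to the \<open>q\<^sup>2\<^sup>k\<close>-eigencomponent of \<open>x\<close>.\<close>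

definition eigenprojector :: "(complex, 'x) module \<Rightarrow> nat \<Rightarrow> complex \<Rightarrow> 'x \<Rightarrow> nat \<Rightarrow> 'x" where
  "eigenprojector R N q x k =
     (\<Oplus>\<^bsub>R\<^esub>j \<in> {..<N}. (q powi (- 2 * int k * int j) / of_nat N) \<odot>\<^bsub>R\<^esub> (x [^]\<^bsub>R\<^esub> j))"

definition functional_calculus ::
  "(complex, 'x) module \<Rightarrow> nat \<Rightarrow> complex \<Rightarrow> (complex \<Rightarrow> complex) \<Rightarrow> 'x \<Rightarrow> 'x" where
  "functional_calculus R N q f x =
     (\<Oplus>\<^bsub>R\<^esub>k \<in> {..<N}. f (q ^ (2 * k)) \<odot>\<^bsub>R\<^esub> eigenprojector R N q x k)"

definition Ad :: "('x, 'm) monoid_scheme \<Rightarrow> 'x \<Rightarrow> 'x \<Rightarrow> 'x" where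
  "Ad R g x = g \<otimes>\<^bsub>R\<^esub> x \<otimes>\<^bsub>R\<^esub> inv\<^bsub>R\<^esub> g"

definition Ad_sign :: "('x, 'm) monoid_scheme \<Rightarrow> 'x \<Rightarrow> int \<Rightarrow> 'x \<Rightarrow> 'x" where
  "Ad_sign R g s = (if s = 1 then Ad R g else inv_into (carrier R) (Ad R g))"

end

theory Submission
  imports Defs
begin

text \<open>Let \<open>x\<close> be the rescaled variable of \<open>\<kappa>\<close>.  As \<open>x\<^sup>N = 1\<close>, the functions on the \<open>N\<close>-th roots of unity
  act on the algebra through \<open>x\<close>, and if \<open>y x = q\<^sup>2\<^sup>n x y\<close>, then conjugation by \<open>f(x)\<close> multiplies \<open>y\<close>
  on the right by \<open>f(q\<^sup>-\<^sup>2\<^sup>n x) / f(x)\<close>.  The branches of the dilogarithm satisfy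
  \<open>\<Psi>(q\<^sup>2 z) = (p\<^sup>- + q p\<^sup>+ z) \<Psi>(z)\<close>, because the quotient of the two sides is a continuous root of
  unity along the path of continuation; for an abstract solution of this equation one only needs that
  the product of \<open>p\<^sup>- + q\<^sup>2\<^sup>j\<^sup>+\<^sup>1 p\<^sup>+\<close> over \<open>j < N\<close> is \<open>(p\<^sup>+)\<^sup>N + (p\<^sup>-)\<^sup>N = 1\<close>.  Hence conjugation turns the
  monomial map into the mutation rule, which is therefore an isomorphism as soon as the monomial map
  is one.  The latter follows from the universal property of the quotients of quantum tori, applied to
  a flip and to the opposite flip, once it is known that the exchange matrix mutates under a flip.\<close>

section \<open>Adjacency of the sides of a triangulation under a flip\<close>

text \<open>Of the topology only incidence data survives: an edge occurs at most twice among the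
  sides of the faces, and a flip exchanges two faces for two others with prescribed sides. The
  obstacle is that sides of the quadrilateral may coincide; then the flip creates or destroys a
  self-folded triangle, and the encircling map changes with it. Writing the exchange matrix as an
  alternating form on all edges, pulled back along that map, reduces the degenerate cases to
  counting occurrences. The algebra is done for arbitrary skew-symmetric integer matrices. In the
  rescaled variables every generator has N-th power 1, so the exchange ratios leave the relations
  and come back only when the formulas for the unscaled variables are recovered. Both signs lead to
  one map because \<open>max n 0 - max (- n) 0 = n\<close>: the two monomial maps differ by a power
  of \<open>x\<close> up to a scalar. Correspondingly, \<open>f z\<close> and
  \<open>1 / g (1 / z)\<close>, with \<open>f\<close> and \<open>g\<close> solving the recursions
  for \<open>(a, b)\<close> and \<open>(b, a)\<close>, have recursions that differ by the factor
  \<open>q * z\<close>, and these factors telescope to the same power.\<close>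

definition wedge :: "'b \<Rightarrow> 'b \<Rightarrow> 'b \<Rightarrow> 'b \<Rightarrow> int" where
  "wedge x y a b = of_bool (x = a) * of_bool (y = b) - of_bool (x = b) * of_bool (y = a)"

text \<open>With \<open>wedge x y\<close> as the exterior product of two indicator functions, this
  is the exterior product of \<open>x - z\<close> and \<open>y - z\<close>: it is invariant under
  rotation of the sides and vanishes as soon as two of them coincide.\<close>

definition cyclic_wedge :: "'b \<Rightarrow> 'b \<Rightarrow> 'b \<Rightarrow> 'b \<Rightarrow> 'b \<Rightarrow> int" where
  "cyclic_wedge x y z a b = wedge x y a b + wedge y z a b + wedge z x a b"

definition face_wedge :: "'a triangulation \<Rightarrow> 'a set \<Rightarrow> 'a set \<Rightarrow> 'a set \<Rightarrow> int" where
  "face_wedge D T = cyclic_wedge (side D T 0) (side D T 1) (side D T 2)"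

text \<open>The count is by positions, so the inner edge of a self-folded triangle is met
  twice.\<close>

definition side_count :: "'a triangulation \<Rightarrow> 'a set \<Rightarrow> 'a set \<Rightarrow> nat" where
  "side_count D T e = card {i. i < 3 \<and> side D T i = e}"

lemma wedge_skew: "wedge x y b a = - wedge x y a b"
  by (simp add: wedge_def)

lemma cyclic_wedge_skew: "cyclic_wedge x y z b a = - cyclic_wedge x y z a b"
  by (simp add: cyclic_wedge_def wedge_skew[of _ _ b a])

lemma face_wedge_skew: "face_wedge D T b a = - face_wedge D T a b"
  by (simp add: face_wedge_def cyclic_wedge_skew[of _ _ _ b a])

lemma less_3_iff: "i < 3 \<longleftrightarrow> i = 0 \<or> i = 1 \<or> i = (2::nat)"
  by auto

lemma face_sides_iff:
  "face_sides D T a b c \<longleftrightarrow>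
     (a, b, c) \<in> {(side D T 0, side D T 1, side D T 2), (side D T 1, side D T 2, side D T 0),
                  (side D T 2, side D T 0, side D T 1)}"
proof -
  have "(0 + 1) mod 3 = (1::nat)" "(0 + 2) mod 3 = (2::nat)" "(1 + 1) mod 3 = (2::nat)"
    "(1 + 2) mod 3 = (0::nat)" "(2 + 1) mod 3 = (0::nat)" "(2 + 2) mod 3 = (1::nat)"
    by simp_all
  note mods = this
  show ?thesis
    unfolding face_sides_def less_3_iff conj_disj_distribR ex_disj_distrib simp_thms mods
      insert_iff prod.inject empty_iff
    by blast
qed

lemma face_wedge_eq: "face_sides D T x y z \<Longrightarrow> face_wedge D T a b = cyclic_wedge x y z a b"
  by (auto simp: face_sides_iff face_wedge_def cyclic_wedge_def)

lemma side_count_sides: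
  "side_count D T e =
     of_bool (side D T 0 = e) + of_bool (side D T 1 = e) + of_bool (side D T 2 = e)"
proof -
  have "{i. i < 3 \<and> side D T i = e} = {..<3} \<inter> {i. side D T i = e}"
    by auto
  then have "side_count D T e = (\<Sum>i<3. of_bool (side D T i = e))"
    unfolding side_count_def by simp
  also have "\<dots> = of_bool (side D T 0 = e) + of_bool (side D T 1 = e) + of_bool (side D T 2 = e)"
    unfolding numeral_3_eq_3 sum.lessThan_Suc by (simp add: numeral_2_eq_2 del: sum_of_bool_eq)
  finally show ?thesis .
qed

lemma side_count_eq:
  "face_sides D T x y z \<Longrightarrow>
     side_count D T e = of_bool (x = e) + of_bool (y = e) + of_bool (z = e)"
  by (auto simp: face_sides_iff side_count_sides)

text \<open>For distinct sides the two orientations exclude each other, so the alternating sum takes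
  the values of the nested conditional in \<open>exchange_in\<close>.\<close>

lemma cyclic_wedge_distinct:
  assumes "x \<noteq> y" "y \<noteq> z" "z \<noteq> x"
  shows "cyclic_wedge x y z a b =
    (if (a = x \<and> b = y) \<or> (a = y \<and> b = z) \<or> (a = z \<and> b = x) then 1
     else if (b = x \<and> a = y) \<or> (b = y \<and> a = z) \<or> (b = z \<and> a = x) then - 1 else 0)"
proof -
  consider "a = x" | "a = y" | "a = z" | "a \<noteq> x" "a \<noteq> y" "a \<noteq> z"
    by blast
  then show ?thesis
    using assms assms[symmetric]
    by cases (simp_all add: cyclic_wedge_def wedge_def of_bool_def)
qed

text \<open>Two equal sides of a triangle are cyclically adjacent, hence make it self-folded; every
  other face has three distinct sides.\<close>

lemma exchange_in_eq_face_wedge: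
  assumes "T \<in> faces D" and "\<nexists>d \<delta>. self_folded D T d \<delta>"
  shows "exchange_in D T \<alpha> \<beta> = face_wedge D T (encircling D \<alpha>) (encircling D \<beta>)"
proof -
  have distinct: "side D T 0 \<noteq> side D T 1" "side D T 1 \<noteq> side D T 2" "side D T 2 \<noteq> side D T 0"
    using assms unfolding self_folded_def face_sides_iff by auto
  have "(\<exists>c. face_sides D T a b c) \<longleftrightarrow> (a = side D T 0 \<and> b = side D T 1) \<or>
      (a = side D T 1 \<and> b = side D T 2) \<or> (a = side D T 2 \<and> b = side D T 0)" for a b
    unfolding face_sides_iff by blast
  then show ?thesis
    unfolding exchange_in_def face_wedge_def cyclic_wedge_distinct[OF distinct] by presburger
qed

text \<open>Hence the sum defining \<^const>\<open>exchange\<close> may be extended to all faces.\<close>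

lemma face_wedge_self_folded: "self_folded D T d \<delta> \<Longrightarrow> face_wedge D T a b = 0"
  by (auto simp: self_folded_def face_wedge_eq cyclic_wedge_def wedge_def)

section \<open>The exchange matrix as an alternating form pulled back along
  \<open>encircling\<close>\<close>

definition adjacency :: "'a triangulation \<Rightarrow> 'a set \<Rightarrow> 'a set \<Rightarrow> int" where
  "adjacency D a b = (\<Sum>T \<in> faces D. face_wedge D T a b)"

lemma adjacency_skew: "adjacency D b a = - adjacency D a b"
  unfolding adjacency_def sum_negf[symmetric] by (intro sum.cong refl face_wedge_skew)

lemma exchange_eq_adjacency:
  assumes "finite (faces D)"
  shows "exchange D \<alpha> \<beta> = adjacency D (encircling D \<alpha>) (encircling D \<beta>)"
  unfolding exchange_def adjacency_def
  using assms
  by (intro sum.mono_neutral_cong_left)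
     (auto simp: exchange_in_eq_face_wedge face_wedge_self_folded)

lemma exchange_skew: "finite (faces D) \<Longrightarrow> exchange D \<beta> \<alpha> = - exchange D \<alpha> \<beta>"
  using adjacency_skew[of D "encircling D \<beta>" "encircling D \<alpha>"]
  by (simp add: exchange_eq_adjacency)

lemma finite_faces: "ideal_triangulation S A M D \<Longrightarrow> finite (faces D)"
  unfolding ideal_triangulation_def by blast

text \<open>Grouping the incidences by face. The bound 2 covers interior and boundary edges alike,
  and the later exclusions of coincident edges rest on it.\<close>

lemma sum_side_count:
  assumes "ideal_triangulation S A M D" and "e \<in> edges D"
  shows "(\<Sum>T \<in> faces D. side_count D T e) \<le> 2"
proof -
  have "{(T, i). T \<in> faces D \<and> i < 3 \<and> side D T i = e} =
      Sigma (faces D) (\<lambda>T. {i. i < 3 \<and> side D T i = e})"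
    by auto
  moreover have "finite (faces D)" "card {(T, i). T \<in> faces D \<and> i < 3 \<and> side D T i = e} \<le> 2"
    using assms unfolding ideal_triangulation_def by auto
  ultimately show ?thesis
    by (simp add: side_count_def)
qed

lemma side_in_edges:
  assumes "ideal_triangulation S A M D" "T \<in> faces D" "face_sides D T x y z"
  shows "x \<in> edges D \<and> y \<in> edges D \<and> z \<in> edges D"
  using assms unfolding ideal_triangulation_def face_sides_iff by (auto simp: less_3_iff)

text \<open>A self-folded triangle uses up both occurrences of its inner edge, so no second one has
  that inner edge, and its remaining side is a different edge. This makes the definite description
  in \<open>encircling\<close> meaningful.\<close>

lemma encircling_self_folded:
  assumes D: "ideal_triangulation S A M D" and T: "self_folded D T \<alpha> \<beta>"
  shows "encircling D \<alpha> = \<beta>"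
proof -
  have fin: "finite (faces D)"
    using D by (rule finite_faces)
  have unique: "\<beta>' = \<beta>" if T': "self_folded D T' \<alpha> \<beta>'" for T' \<beta>'
  proof -
    have sides: "T \<in> faces D" "face_sides D T \<beta> \<alpha> \<alpha>" "T' \<in> faces D" "face_sides D T' \<beta>' \<alpha> \<alpha>"
      using T T' by (auto simp: self_folded_def)
    have le: "(\<Sum>T \<in> faces D. side_count D T \<alpha>) \<le> 2"
      using sum_side_count[OF D] side_in_edges[OF D sides(1,2)] by blast
    have "T' = T"
    proof (rule ccontr)
      assume "T' \<noteq> T"
      then have "(\<Sum>T \<in> {T, T'}. side_count D T \<alpha>) \<ge> 4"
        using side_count_eq[OF sides(2)] side_count_eq[OF sides(4)] by simp
      moreover have "(\<Sum>T \<in> {T, T'}. side_count D T \<alpha>) \<le> (\<Sum>T \<in> faces D. side_count D T \<alpha>)"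
        using fin sides by (intro sum_mono2) auto
      ultimately show False
        using le by linarith
    qed
    moreover have "side_count D T \<alpha> \<le> (\<Sum>T \<in> faces D. side_count D T \<alpha>)"
      using fin sides by (intro member_le_sum) auto
    ultimately show ?thesis
      using le sides side_count_eq[OF sides(2), of \<alpha>] unfolding face_sides_iff by auto
  qed
  have "(THE \<beta>. \<exists>T. self_folded D T \<alpha> \<beta>) = \<beta>"
    by (rule the_equality) (use T unique in blast)+
  moreover have "\<exists>T \<beta>. self_folded D T \<alpha> \<beta>"
    using T by blast
  ultimately show ?thesis
    unfolding encircling_def by simp
qed

text \<open>The letters \<open>\<pi>\<close>, \<open>\<pi>'\<close> stand for the encircling maps before and after the flip.  Two
  adjacent sides of the quadrilateral are equal (\<open>rep\<close>) exactly if a triangle is self-folded before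
  or after the flip.  Away from such sides \<open>B' - B\<close> is the wedge of \<open>e1 + e3\<close> with \<open>e0 + e2\<close>, and
  these are the positive and the negative part of the column of \<open>\<kappa>\<close>.\<close>

lemma mutation_of_adjacency:
  fixes C B B' :: "'b \<Rightarrow> 'b \<Rightarrow> int" and \<pi> \<pi>' :: "'b \<Rightarrow> 'b" and e0 e1 e2 e3 k k' :: 'b
  defines "rep \<equiv> \<lambda>a. (e0 = a \<and> e1 = a) \<or> (e2 = a \<and> e3 = a) \<or> (e0 = a \<and> e3 = a) \<or> (e1 = a \<and> e2 = a)"
  assumes B: "\<And>a b. B a b = C a b + cyclic_wedge e0 e1 k a b + cyclic_wedge k e2 e3 a b"
    and B': "\<And>a b. B' a b = C a b + cyclic_wedge e0 k' e3 a b + cyclic_wedge e1 e2 k' a b"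
    and C: "\<And>a b. C b a = - C a b"
    and Ck: "\<And>a. C k a = 0" "\<And>a. C a k = 0" "\<And>a. C k' a = 0" "\<And>a. C a k' = 0"
    and Ce: "\<And>a b. rep a \<Longrightarrow> C a b = 0" "\<And>a b. rep a \<Longrightarrow> C b a = 0"
    and ne: "e0 \<noteq> k" "e1 \<noteq> k" "e2 \<noteq> k" "e3 \<noteq> k" "e0 \<noteq> k'" "e1 \<noteq> k'" "e2 \<noteq> k'" "e3 \<noteq> k'" "k \<noteq> k'"
    and triple: "\<not> (e0 = e1 \<and> e1 = e2)" "\<not> (e0 = e1 \<and> e1 = e3)" "\<not> (e0 = e2 \<and> e2 = e3)" "\<not> (e1 = e2 \<and> e2 = e3)"
    and \<pi>: "\<And>\<alpha>. \<alpha> \<in> E \<Longrightarrow>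
         (\<pi>' \<alpha> = \<pi> \<alpha> \<and> \<pi> \<alpha> \<noteq> k \<and> \<pi> \<alpha> \<noteq> k' \<and> \<not> rep (\<pi> \<alpha>)) \<or>
         (\<alpha> = e0 \<and> \<alpha> = e1 \<and> \<pi> \<alpha> = k \<and> \<pi>' \<alpha> = \<alpha>) \<or>
         (\<alpha> = e2 \<and> \<alpha> = e3 \<and> \<pi> \<alpha> = k \<and> \<pi>' \<alpha> = \<alpha>) \<or>
         (\<alpha> = e0 \<and> \<alpha> = e3 \<and> \<pi> \<alpha> = \<alpha> \<and> \<pi>' \<alpha> = k') \<or>
         (\<alpha> = e1 \<and> \<alpha> = e2 \<and> \<pi> \<alpha> = \<alpha> \<and> \<pi>' \<alpha> = k')"
    and \<alpha>: "\<alpha> \<in> E"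
  shows "B' (\<pi>' \<alpha>) k' = - B (\<pi> \<alpha>) k"
    and "\<beta> \<in> E \<Longrightarrow> B' (\<pi>' \<alpha>) (\<pi>' \<beta>) = B (\<pi> \<alpha>) (\<pi> \<beta>) +
       max (B (\<pi> \<alpha>) k) 0 * max (B k (\<pi> \<beta>)) 0 - max (- B (\<pi> \<alpha>) k) 0 * max (- B k (\<pi> \<beta>)) 0"
proof -
  note defs = B B' cyclic_wedge_def wedge_def
  \<comment> \<open>The column of \<open>k\<close> at the edges other than the two diagonals;
    opposite sides of the quadrilateral enter with the same sign.\<close>
  define V where "V a = of_bool (e1 = a) + of_bool (e3 = a) - (of_bool (e0 = a) + of_bool (e2 = a) :: int)" for a
  have Bk: "B a k = V a" "B k a = - V a" "B' a k' = - V a" "B' k' a = V a" if "a \<noteq> k" "a \<noteq> k'" for a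
    using that ne unfolding defs V_def by (auto simp: Ck)
  have skew: "B b a = - B a b" "B' b a = - B' a b" for a b
    using cyclic_wedge_skew[of _ _ _ b a] by (simp_all add: B B' C[of b a])
  have diag: "B a a = 0" "B' a a = 0" for a
    using skew(1)[of a a] skew(2)[of a a] by linarith+
  \<comment> \<open>Adjacent sides have opposite signs, so a repeated side cancels;
    \<open>triple\<close> prevents a third occurrence.\<close>
  have V0: "V a = 0" if "rep a" for a
    using that triple unfolding rep_def V_def by auto
  show "B' (\<pi>' \<alpha>) k' = - B (\<pi> \<alpha>) k"
  proof (cases "\<pi>' \<alpha> = \<pi> \<alpha> \<and> \<pi> \<alpha> \<noteq> k \<and> \<pi> \<alpha> \<noteq> k'")
    case True
    then show ?thesis by (simp add: Bk)
  next
    case False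
    then have "rep \<alpha>" "\<alpha> \<noteq> k" "\<alpha> \<noteq> k'" "\<pi> \<alpha> = k \<and> \<pi>' \<alpha> = \<alpha> \<or> \<pi> \<alpha> = \<alpha> \<and> \<pi>' \<alpha> = k'"
      using \<pi>[OF \<alpha>] ne unfolding rep_def by auto
    then show ?thesis
      using Bk(1,3)[of \<alpha>] V0[of \<alpha>] diag by auto
  qed
  \<comment> \<open>Without repeated adjacent sides the two signs never meet at one edge, so the
    truncations separate them.\<close>
  have Vk: "max (V a) 0 = of_bool (e1 = a) + of_bool (e3 = a)"
    "max (- V a) 0 = of_bool (e0 = a) + of_bool (e2 = a)" if "\<not> rep a" for a
    using that unfolding V_def rep_def by auto
  assume \<beta>: "\<beta> \<in> E"
  show "B' (\<pi>' \<alpha>) (\<pi>' \<beta>) = B (\<pi> \<alpha>) (\<pi> \<beta>) +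
       max (B (\<pi> \<alpha>) k) 0 * max (B k (\<pi> \<beta>)) 0 - max (- B (\<pi> \<alpha>) k) 0 * max (- B k (\<pi> \<beta>)) 0"
  proof (cases "\<not> rep (\<pi> \<alpha>) \<and> \<pi>' \<alpha> = \<pi> \<alpha> \<and> \<pi> \<alpha> \<noteq> k \<and> \<pi> \<alpha> \<noteq> k' \<and>
      \<not> rep (\<pi> \<beta>) \<and> \<pi>' \<beta> = \<pi> \<beta> \<and> \<pi> \<beta> \<noteq> k \<and> \<pi> \<beta> \<noteq> k'")
    case True
    \<comment> \<open>With opaque indicators the difference of the two forms becomes a polynomial
      identity.\<close>
    define I where "I x a = (of_bool (x = a) :: int)" for x a :: 'b
    have wedge_I: "wedge x y a b = I x a * I y b - I x b * I y a" for x y a b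
      by (simp add: wedge_def I_def)
    have I0: "I k (\<pi> \<alpha>) = 0" "I k' (\<pi> \<alpha>) = 0" "I k (\<pi> \<beta>) = 0" "I k' (\<pi> \<beta>) = 0"
      using True unfolding I_def by auto
    have "B' (\<pi>' \<alpha>) (\<pi>' \<beta>) = B' (\<pi> \<alpha>) (\<pi> \<beta>)"
      using True by simp
    then have "B' (\<pi>' \<alpha>) (\<pi>' \<beta>) - B (\<pi> \<alpha>) (\<pi> \<beta>) =
        (I e1 (\<pi> \<alpha>) + I e3 (\<pi> \<alpha>)) * (I e0 (\<pi> \<beta>) + I e2 (\<pi> \<beta>)) -
        (I e0 (\<pi> \<alpha>) + I e2 (\<pi> \<alpha>)) * (I e1 (\<pi> \<beta>) + I e3 (\<pi> \<beta>))"
      unfolding B B' cyclic_wedge_def wedge_I by (simp add: I0 algebra_simps)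
    then show ?thesis
      using True by (simp add: Bk Vk I_def)
  next
    case False
    \<comment> \<open>A degenerate edge is represented by \<open>k\<close> itself or by a repeated
      side, and both have entry 0 in the column of \<open>k\<close>. Hence the correction terms
      vanish as soon as one of the two edges is degenerate.\<close>
    have pi_eq: "B (\<pi> d) k = 0 \<and> B k (\<pi> d) = 0"
      if "d \<in> E" "\<not> (\<not> rep (\<pi> d) \<and> \<pi>' d = \<pi> d \<and> \<pi> d \<noteq> k \<and> \<pi> d \<noteq> k')" for d
    proof -
      have "\<pi> d = k \<or> (rep (\<pi> d) \<and> \<pi> d \<noteq> k \<and> \<pi> d \<noteq> k')"
        using \<pi>[OF that(1)] that(2) ne unfolding rep_def by auto
      then show ?thesis
        using V0[of "\<pi> d"] Bk[of "\<pi> d"] diag[of k] by (elim disjE conjE) simp_all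
    qed
    have zero: "max (B (\<pi> \<alpha>) k) 0 * max (B k (\<pi> \<beta>)) 0 -
        max (- B (\<pi> \<alpha>) k) 0 * max (- B k (\<pi> \<beta>)) 0 = 0"
      using False pi_eq[OF \<alpha>] pi_eq[OF \<beta>] by auto
    have special: "(d = e0 \<and> e1 = e0 \<and> \<pi> d = k \<and> \<pi>' d = d) \<or>
        (d = e2 \<and> e3 = e2 \<and> \<pi> d = k \<and> \<pi>' d = d) \<or>
        (d = e0 \<and> e3 = e0 \<and> \<pi> d = d \<and> \<pi>' d = k') \<or>
        (d = e1 \<and> e2 = e1 \<and> \<pi> d = d \<and> \<pi>' d = k')"
      if d: "d \<in> E" "\<not> (\<not> rep (\<pi> d) \<and> \<pi>' d = \<pi> d \<and> \<pi> d \<noteq> k \<and> \<pi> d \<noteq> k')" for d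
      using \<pi>[OF d(1)] d(2) by metis
    \<comment> \<open>A degenerate edge does not occur outside the quadrilateral, so only the two
      triangles contribute to its row. The row of the encircling diagonal on one side of the flip is
      the row of the edge itself on the other side.\<close>
    have row: "B' (\<pi>' d) b = B (\<pi> d) b"
      if d: "d \<in> E" "\<not> (\<not> rep (\<pi> d) \<and> \<pi>' d = \<pi> d \<and> \<pi> d \<noteq> k \<and> \<pi> d \<noteq> k')"
        and b: "\<not> rep b" "b \<noteq> k" "b \<noteq> k'" for d b
    proof -
      have "rep d"
        using special[OF d] unfolding rep_def by blast
      then have "C d b = 0"
        by (rule Ce)
      then show ?thesis
        using special[OF d] b ne triple unfolding rep_def
        by (elim disjE conjE) (simp_all add: B B' Ck cyclic_wedge_def wedge_def)
    qed
    have "B' (\<pi>' \<alpha>) (\<pi>' \<beta>) = B (\<pi> \<alpha>) (\<pi> \<beta>)"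
    proof -
      let ?gen = "\<lambda>d. \<not> rep (\<pi> d) \<and> \<pi>' d = \<pi> d \<and> \<pi> d \<noteq> k \<and> \<pi> d \<noteq> k'"
      consider "?gen \<beta>" "\<not> ?gen \<alpha>" | "?gen \<alpha>" "\<not> ?gen \<beta>" | "\<not> ?gen \<alpha>" "\<not> ?gen \<beta>"
        using False by blast
      then show ?thesis
      proof cases
        case 1
        then show ?thesis
          using row[OF \<alpha> 1(2), of "\<pi> \<beta>"] by simp
      next
        case 2
        then have eq: "\<pi>' \<alpha> = \<pi> \<alpha>"
          by blast
        have "B' (\<pi>' \<beta>) (\<pi> \<alpha>) = B (\<pi> \<beta>) (\<pi> \<alpha>)"
          using 2 row[OF \<beta> 2(2), of "\<pi> \<alpha>"] by blast
        then show ?thesis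
          unfolding eq skew(1)[of "\<pi> \<beta>" "\<pi> \<alpha>"] skew(2)[of "\<pi>' \<beta>" "\<pi> \<alpha>"] by linarith
      next
        case 3
        \<comment> \<open>Two distinct degenerate edges are both folded before the flip or both
          after it, since the mixed case would make three sides coincide.\<close>
        consider "\<pi> \<alpha> = \<pi> \<beta>" "\<pi>' \<alpha> = \<pi>' \<beta>"
          | "e1 = e0" "e3 = e2" "\<pi> \<alpha> = k" "\<pi> \<beta> = k" "\<pi>' \<alpha> \<in> {e0, e2}" "\<pi>' \<beta> \<in> {e0, e2}"
          | "e3 = e0" "e2 = e1" "\<pi>' \<alpha> = k'" "\<pi>' \<beta> = k'" "\<pi> \<alpha> \<in> {e0, e1}" "\<pi> \<beta> \<in> {e0, e1}"
          using special[OF \<alpha> 3(1)] special[OF \<beta> 3(2)] triple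
          by (elim disjE conjE) (simp_all; fail)+
        then show ?thesis
        proof cases
          case 1
          then show ?thesis
            by (simp add: diag)
        next
          case 2
          then have "rep e0" "rep e2"
            by (auto simp: rep_def)
          moreover have "B' e0 e2 = 0"
            using 2 ne triple Ce(1)[OF \<open>rep e0\<close>] by (simp add: B' cyclic_wedge_def wedge_def)
          ultimately show ?thesis
            using 2 diag skew(2)[of e2 e0] by (elim insertE emptyE) simp_all
        next
          case 3
          then have "rep e0" "rep e1"
            by (auto simp: rep_def)
          moreover have "B e0 e1 = 0"
            using 3 ne triple Ce(1)[OF \<open>rep e0\<close>] by (simp add: B cyclic_wedge_def wedge_def)
          ultimately show ?thesis
            using 3 diag skew(1)[of e1 e0] by (elim insertE emptyE) simp_all
        qed
      qed
    qed
    then show ?thesis using zero by simp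
  qed
qed

section \<open>Incidence data of a flip and mutation of the exchange matrix\<close>

lemma face_sides_rotate:
  assumes "face_sides D T x y z" and "face_sides D T a b c"
  shows "(a, b, c) \<in> {(x, y, z), (y, z, x), (z, x, y)}"
  using assms unfolding face_sides_iff insert_iff empty_iff prod.inject by (elim disjE conjE FalseE) simp_all

lemma self_folded_sides:
  assumes "self_folded D T \<alpha> \<beta>" and "face_sides D T x y z"
  shows "(x = \<beta> \<and> y = \<alpha> \<and> z = \<alpha>) \<or> (x = \<alpha> \<and> y = \<beta> \<and> z = \<alpha>) \<or> (x = \<alpha> \<and> y = \<alpha> \<and> z = \<beta>)"
  using face_sides_rotate[OF assms(2), of \<beta> \<alpha> \<alpha>] assms(1) unfolding self_folded_def by auto

lemma sum_Diff_pair: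
  fixes f :: "'b \<Rightarrow> 'c::comm_monoid_add"
  assumes "finite F" "a \<in> F" "b \<in> F" "a \<noteq> b"
  shows "sum f F = sum f (F - {a, b}) + (f a + f b)"
proof -
  have "sum f F = sum f (F - {a, b}) + sum f {a, b}"
    using assms by (subst sum.subset_diff[of "{a, b}"]) auto
  then show ?thesis
    using assms by simp
qed

lemma encircling_not_self_folded:
  "(\<And>T \<beta>. \<not> self_folded D T \<alpha> \<beta>) \<Longrightarrow> encircling D \<alpha> = \<alpha>"
  unfolding encircling_def by auto

text \<open>Injectivity of the parametrisation on the open square makes the two halves cut out by
  either diagonal distinct; what remains of the flip is a list of sides.\<close>

lemma flip_quadrilateral:
  assumes "flip S A M D \<kappa> \<kappa>' D'"
  obtains T1 T2 T1' T2' e0 e1 e2 e3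
  where "T1 \<noteq> T2" "T1' \<noteq> T2'"
    "T1 \<in> faces D" "face_sides D T1 e0 e1 \<kappa>" "T2 \<in> faces D" "face_sides D T2 \<kappa> e2 e3"
    "T1' \<in> faces D'" "face_sides D' T1' e0 \<kappa>' e3" "T2' \<in> faces D'" "face_sides D' T2' e1 e2 \<kappa>'"
    "faces D - {T1, T2} = faces D' - {T1', T2'}"
    "\<forall>T \<in> faces D - {T1, T2}. \<forall>a b c. face_sides D T a b c \<longleftrightarrow> face_sides D' T a b c"
  using assms unfolding flip_def Let_def
proof (elim conjE exE, goal_cases)
  case (1 Q)
  have inj: "inj_on Q open_unit_square"
    by (rule 1)
  have image_ne: "Q ` U \<noteq> Q ` V"
    if "z \<in> U" "U \<inter> V = {}" "U \<subseteq> open_unit_square" "V \<subseteq> open_unit_square" for z U V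
    using that inj_on_image_Int[OF inj, of U V] by auto
  have "Q ` {z \<in> open_unit_square. Im z < Re z} \<noteq> Q ` {z \<in> open_unit_square. Re z < Im z}"
    by (rule image_ne[of "Complex (1/2) (1/4)"]) (auto simp: open_unit_square_def)
  moreover have "Q ` {z \<in> open_unit_square. Re z + Im z < 1} \<noteq> Q ` {z \<in> open_unit_square. Re z + Im z > 1}"
    by (rule image_ne[of "Complex (1/4) (1/4)"]) (auto simp: open_unit_square_def)
  ultimately show thesis
    by (rule that) (rule 1)+
qed

text \<open>Counting occurrences provides the hypotheses of \<open>mutation_of_adjacency\<close>: a
  diagonal, or a side repeated within the quadrilateral, exhausts its two occurrences there and is
  absent from the unchanged faces, and no side occurs three times.\<close>

theorem exchange_flip:
  assumes flip: "flip S A M D \<kappa> \<kappa>' D'" and \<alpha>: "\<alpha> \<in> edges D - {\<kappa>}"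
  shows "exchange D' \<alpha> \<kappa>' = - exchange D \<alpha> \<kappa>"
    and "\<beta> \<in> edges D - {\<kappa>} \<Longrightarrow> exchange D' \<alpha> \<beta> = exchange D \<alpha> \<beta> +
       max (exchange D \<alpha> \<kappa>) 0 * max (exchange D \<kappa> \<beta>) 0 -
       max (- exchange D \<alpha> \<kappa>) 0 * max (- exchange D \<kappa> \<beta>) 0"
proof -
  have D: "ideal_triangulation S A M D" and D': "ideal_triangulation S A M D'"
    and \<kappa>: "\<kappa> \<in> edges D" "\<kappa>' \<notin> edges D" and edges: "edges D' = insert \<kappa>' (edges D - {\<kappa>})"
    using flip unfolding flip_def interior_edges_def by blast+
  obtain T1 T2 T1' T2' e0 e1 e2 e3 where ne: "T1 \<noteq> T2" "T1' \<noteq> T2'"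
    and T: "T1 \<in> faces D" "face_sides D T1 e0 e1 \<kappa>" "T2 \<in> faces D" "face_sides D T2 \<kappa> e2 e3"
    and T': "T1' \<in> faces D'" "face_sides D' T1' e0 \<kappa>' e3" "T2' \<in> faces D'" "face_sides D' T2' e1 e2 \<kappa>'"
    and rest: "faces D - {T1, T2} = faces D' - {T1', T2'}"
    and sides: "\<forall>T \<in> faces D - {T1, T2}. \<forall>a b c. face_sides D T a b c \<longleftrightarrow> face_sides D' T a b c"
    using flip by (rule flip_quadrilateral)
  define F where "F = faces D - {T1, T2}"
  have F': "F = faces D' - {T1', T2'}"
    using rest by (simp only: F_def)
  have fin: "finite (faces D)" "finite (faces D')" "finite F"
    using finite_faces[OF D] finite_faces[OF D'] by (simp_all only: F_def finite_Diff)
  \<comment> \<open>The numbering of the sides may change by a rotation even in an unchanged face;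
    wedge and count do not see it.\<close>
  have same: "face_wedge D' T = face_wedge D T" "side_count D' T = side_count D T"
    if "T \<in> F" for T
  proof -
    have D_T: "face_sides D T (side D T 0) (side D T 1) (side D T 2)"
      by (simp add: face_sides_iff)
    then have D'_T: "face_sides D' T (side D T 0) (side D T 1) (side D T 2)"
      using sides that unfolding F_def by blast
    show "face_wedge D' T = face_wedge D T" "side_count D' T = side_count D T"
      by (intro ext; simp only: face_wedge_eq[OF D_T] face_wedge_eq[OF D'_T] side_count_eq[OF D_T]
        side_count_eq[OF D'_T])+
  qed
  define C where "C a b = (\<Sum>T \<in> F. face_wedge D T a b)" for a b
  have adj: "adjacency D a b = C a b + cyclic_wedge e0 e1 \<kappa> a b + cyclic_wedge \<kappa> e2 e3 a b" for a b
    unfolding adjacency_def C_def F_def sum_Diff_pair[OF fin(1) T(1) T(3) ne(1)]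
    by (simp add: face_wedge_eq[OF T(2)] face_wedge_eq[OF T(4)])
  have adj': "adjacency D' a b = C a b + cyclic_wedge e0 \<kappa>' e3 a b + cyclic_wedge e1 e2 \<kappa>' a b" for a b
    unfolding adjacency_def sum_Diff_pair[OF fin(2) T'(1) T'(3) ne(2)] F'[symmetric] C_def
    by (simp add: face_wedge_eq[OF T'(2)] face_wedge_eq[OF T'(4)] same cong: sum.cong)
  define n where "n e = (\<Sum>T \<in> F. side_count D T e)" for e
  \<comment> \<open>The diagonal is a side of both triangles, hence the weight 2.\<close>
  have count: "n e + (of_bool (e0 = e) + of_bool (e1 = e) + of_bool (e2 = e) + of_bool (e3 = e)) +
      2 * of_bool (\<kappa> = e) \<le> 2" if "e \<in> edges D" for e
    using sum_side_count[OF D that]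
    unfolding sum_Diff_pair[OF fin(1) T(1) T(3) ne(1)] F_def[symmetric] n_def
    by (simp only: side_count_eq[OF T(2)] side_count_eq[OF T(4)])
  have count': "n e + (of_bool (e0 = e) + of_bool (e1 = e) + of_bool (e2 = e) + of_bool (e3 = e)) +
      2 * of_bool (\<kappa>' = e) \<le> 2" if "e \<in> edges D'" for e
  proof -
    have "n e = (\<Sum>T \<in> F. side_count D' T e)"
      unfolding n_def by (simp add: same cong: sum.cong)
    then show ?thesis
      using sum_side_count[OF D' that]
      unfolding sum_Diff_pair[OF fin(2) T'(1) T'(3) ne(2)] F'[symmetric]
      by (simp only: side_count_eq[OF T'(2)] side_count_eq[OF T'(4)])
  qed
  have edge: "e0 \<in> edges D" "e1 \<in> edges D" "e2 \<in> edges D" "e3 \<in> edges D"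
    using side_in_edges[OF D T(1,2)] side_in_edges[OF D T(3,4)] by auto
  have ne_\<kappa>: "e0 \<noteq> \<kappa>" "e1 \<noteq> \<kappa>" "e2 \<noteq> \<kappa>" "e3 \<noteq> \<kappa>" and n_\<kappa>: "n \<kappa> = 0"
    using count[OF \<kappa>(1)] by auto
  have ne_\<kappa>': "e0 \<noteq> \<kappa>'" "e1 \<noteq> \<kappa>'" "e2 \<noteq> \<kappa>'" "e3 \<noteq> \<kappa>'" "\<kappa> \<noteq> \<kappa>'"
    using edge \<kappa> by auto
  have n_\<kappa>': "n \<kappa>' = 0"
    using count'[of \<kappa>'] edges by auto
  have C0: "C e b = 0" "C b e = 0" if "n e = 0" for e b
  proof -
    have "face_wedge D T e b = 0 \<and> face_wedge D T b e = 0" if "T \<in> F" for T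
    proof -
      have "side_count D T e = 0"
        using \<open>n e = 0\<close> that fin(3) unfolding n_def by simp
      then show ?thesis
        unfolding side_count_sides face_wedge_def cyclic_wedge_def wedge_def by auto
    qed
    then show "C e b = 0" "C b e = 0"
      unfolding C_def by simp_all
  qed
  let ?rep = "\<lambda>a. (e0 = a \<and> e1 = a) \<or> (e2 = a \<and> e3 = a) \<or> (e0 = a \<and> e3 = a) \<or> (e1 = a \<and> e2 = a)"
  have rep: "n a = 0" if "?rep a" for a
    using count[of a] that edge by auto
  have triple: "\<not> (e0 = e1 \<and> e1 = e2)" "\<not> (e0 = e1 \<and> e1 = e3)" "\<not> (e0 = e2 \<and> e2 = e3)"
    "\<not> (e1 = e2 \<and> e2 = e3)"
    using count[OF edge(1)] count[OF edge(2)] by auto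
  have C_skew: "C b a = - C a b" for a b
    unfolding C_def sum_negf[symmetric] by (intro sum.cong refl face_wedge_skew)
  have n_ge: "side_count D T e \<le> n e" if "T \<in> F" for T e
    unfolding n_def using that fin(3) by (intro member_le_sum) auto
  \<comment> \<open>If one of the two triangles is folded along an edge other than the diagonal,
    then the diagonal encircles it and the two other sides coincide.\<close>
  have sf: "T \<in> F \<or> (T = T1 \<and> d = e0 \<and> d = e1) \<or> (T = T2 \<and> d = e2 \<and> d = e3)"
    if "self_folded D T d \<beta>" "d \<noteq> \<kappa>" for T d \<beta>
    using that(1) self_folded_sides[OF that(1), of e0 e1 \<kappa>] self_folded_sides[OF that(1), of \<kappa> e2 e3]
      that(2) T unfolding F_def self_folded_def by auto
  have sf': "T \<in> F \<or> (T = T1' \<and> d = e0 \<and> d = e3) \<or> (T = T2' \<and> d = e1 \<and> d = e2)"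
    if "self_folded D' T d \<beta>" "d \<noteq> \<kappa>'" for T d \<beta>
    using that(1) self_folded_sides[OF that(1), of e0 \<kappa>' e3] self_folded_sides[OF that(1), of e1 e2 \<kappa>']
      that(2) T' unfolding F' self_folded_def by auto
  \<comment> \<open>A self-folded face outside the quadrilateral also exhausts its inner edge, so
    that edge is not a repeated side.\<close>
  have sf_F: "n d = 2" if "self_folded D T d \<beta> \<or> self_folded D' T d \<beta>" "T \<in> F" "d \<in> edges D" for T d \<beta>
  proof -
    have "face_sides D T \<beta> d d"
      using that sides unfolding self_folded_def F_def by blast
    then show ?thesis
      using side_count_eq[of D T \<beta> d d d] n_ge[OF that(2), of d] count[OF that(3)] by simp
  qed
  have \<pi>: "(encircling D' d = encircling D d \<and> encircling D d \<noteq> \<kappa> \<and> encircling D d \<noteq> \<kappa>' \<and>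
            \<not> ?rep (encircling D d)) \<or>
         (d = e0 \<and> d = e1 \<and> encircling D d = \<kappa> \<and> encircling D' d = d) \<or>
         (d = e2 \<and> d = e3 \<and> encircling D d = \<kappa> \<and> encircling D' d = d) \<or>
         (d = e0 \<and> d = e3 \<and> encircling D d = d \<and> encircling D' d = \<kappa>') \<or>
         (d = e1 \<and> d = e2 \<and> encircling D d = d \<and> encircling D' d = \<kappa>')"
    if "d \<in> edges D - {\<kappa>}" for d
  proof -
    have d: "d \<in> edges D" "d \<noteq> \<kappa>" "d \<noteq> \<kappa>'"
      using that \<kappa> by auto
    show ?thesis
    proof (cases "\<exists>T \<beta>. T \<in> F \<and> self_folded D T d \<beta>")
      case True
      then obtain T \<beta> where F: "T \<in> F" "self_folded D T d \<beta>"
        by blast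
      then have fs: "face_sides D T \<beta> d d" and "self_folded D' T d \<beta>"
        using sides unfolding self_folded_def F_def rest by blast+
      then have enc: "encircling D d = \<beta>" "encircling D' d = \<beta>"
        using encircling_self_folded[OF D F(2)] encircling_self_folded[OF D'] by blast+
      \<comment> \<open>The encircling edge occurs in an unchanged face, which excludes the
        diagonals and the repeated sides.\<close>
      have "n \<beta> > 0"
        using side_count_eq[OF fs, of \<beta>] n_ge[OF F(1), of \<beta>] by simp
      then have "\<beta> \<noteq> \<kappa>" "\<beta> \<noteq> \<kappa>'" "\<not> ?rep \<beta>"
        using n_\<kappa> n_\<kappa>' rep[of \<beta>] by (metis less_irrefl)+
      then show ?thesis
        unfolding enc by blast
    next
      case no_sf: False
      show ?thesis
      proof (cases "?rep d")
        case True
        have no_F: "T \<notin> F" if "self_folded D T d \<beta> \<or> self_folded D' T d \<beta>" for T \<beta>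
          using sf_F[OF that _ d(1)] rep[OF True] by force
        have "e0 = d \<Longrightarrow> e1 = d \<Longrightarrow> self_folded D T1 d \<kappa>" "e2 = d \<Longrightarrow> e3 = d \<Longrightarrow> self_folded D T2 d \<kappa>"
          "e0 = d \<Longrightarrow> e3 = d \<Longrightarrow> self_folded D' T1' d \<kappa>'" "e1 = d \<Longrightarrow> e2 = d \<Longrightarrow> self_folded D' T2' d \<kappa>'"
          using T T' by (auto simp: self_folded_def face_sides_iff)
        then have D_sf: "e0 = d \<and> e1 = d \<or> e2 = d \<and> e3 = d \<Longrightarrow> encircling D d = \<kappa>"
          and D'_sf: "e0 = d \<and> e3 = d \<or> e1 = d \<and> e2 = d \<Longrightarrow> encircling D' d = \<kappa>'"
          using encircling_self_folded[OF D] encircling_self_folded[OF D'] by blast+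
        have D_not_sf: "encircling D d = d" if "\<not> (e0 = d \<and> e1 = d)" "\<not> (e2 = d \<and> e3 = d)"
          using sf[of _ d] no_F d(2) that by (intro encircling_not_self_folded) metis
        have D'_not_sf: "encircling D' d = d" if "\<not> (e0 = d \<and> e3 = d)" "\<not> (e1 = d \<and> e2 = d)"
          using sf'[of _ d] no_F d(3) that by (intro encircling_not_self_folded) metis
        show ?thesis
          using True D_sf D'_sf D_not_sf D'_not_sf triple by metis
      next
        case False
        from no_sf have no_sf': "T \<in> F \<Longrightarrow> \<not> self_folded D' T d \<beta>" for T \<beta>
          using sides unfolding self_folded_def F_def by blast
        have "\<not> self_folded D T d \<beta>" for T \<beta>
          using sf[of T d \<beta>] False no_sf d(2) by blast
        moreover have "\<not> self_folded D' T d \<beta>" for T \<beta>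
          using sf'[of T d \<beta>] False no_sf' d(3) by blast
        ultimately have "encircling D d = d" "encircling D' d = d"
          by (simp_all add: encircling_not_self_folded)
        then show ?thesis
          using False d by simp
      qed
    qed
  qed
  \<comment> \<open>A diagonal is never an inner edge: it occurs once in each triangle of its
    quadrilateral and in no other face.\<close>
  have enc_\<kappa>: "encircling D \<kappa> = \<kappa>" "encircling D' \<kappa>' = \<kappa>'"
  proof -
    have "\<not> self_folded D T \<kappa> \<beta>" for T \<beta>
    proof
      assume *: "self_folded D T \<kappa> \<beta>"
      then have "T \<notin> F"
        using sf_F[of T \<kappa> \<beta>] n_\<kappa> \<kappa>(1) by auto
      then have "T = T1 \<or> T = T2"
        using * unfolding F_def self_folded_def by blast
      then show False
        using self_folded_sides[OF *, of e0 e1 \<kappa>] self_folded_sides[OF *, of \<kappa> e2 e3] T(2,4) ne_\<kappa> by blast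
    qed
    then show "encircling D \<kappa> = \<kappa>"
      by (rule encircling_not_self_folded)
    have "\<not> self_folded D' T \<kappa>' \<beta>" for T \<beta>
    proof
      assume *: "self_folded D' T \<kappa>' \<beta>"
      have "T \<notin> F"
      proof
        assume "T \<in> F"
        then have "side_count D T \<kappa>' = 0"
          using n_ge[of T \<kappa>'] n_\<kappa>' by simp
        moreover have "face_sides D T \<beta> \<kappa>' \<kappa>'"
          using * \<open>T \<in> F\<close> sides unfolding F_def self_folded_def by blast
        ultimately show False
          using side_count_eq[of D T \<beta> \<kappa>' \<kappa>' \<kappa>'] by simp
      qed
      then have "T = T1' \<or> T = T2'"
        using * unfolding F' self_folded_def by blast
      then show False
        using self_folded_sides[OF *, of e0 \<kappa>' e3] self_folded_sides[OF *, of e1 e2 \<kappa>'] T'(2,4) ne_\<kappa>' by blast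
    qed
    then show "encircling D' \<kappa>' = \<kappa>'"
      by (rule encircling_not_self_folded)
  qed
  note mutation = mutation_of_adjacency[where C = C and B = "adjacency D" and B' = "adjacency D'" and
      \<pi> = "encircling D" and \<pi>' = "encircling D'" and E = "edges D - {\<kappa>}" and k = \<kappa> and k' = \<kappa>',
      OF adj adj' C_skew C0(1)[OF n_\<kappa>] C0(2)[OF n_\<kappa>] C0(1)[OF n_\<kappa>'] C0(2)[OF n_\<kappa>']
        C0(1)[OF rep] C0(2)[OF rep] ne_\<kappa> ne_\<kappa>' triple \<pi> \<alpha>]
    note ex = exchange_eq_adjacency[OF fin(1)] exchange_eq_adjacency[OF fin(2)] enc_\<kappa>
  show "exchange D' \<alpha> \<kappa>' = - exchange D \<alpha> \<kappa>"
    unfolding ex by (rule mutation(1))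
  show "exchange D' \<alpha> \<beta> = exchange D \<alpha> \<beta> +
       max (exchange D \<alpha> \<kappa>) 0 * max (exchange D \<kappa> \<beta>) 0 -
       max (- exchange D \<alpha> \<kappa>) 0 * max (- exchange D \<kappa> \<beta>) 0" if "\<beta> \<in> edges D - {\<kappa>}"
    unfolding ex by (rule mutation(2)) (assumption | rule that)+
qed

section \<open>Roots of unity and the cyclic dilogarithm\<close>

text \<open>As N is odd, \<open>q\<close> is itself a power of \<open>q^2\<close>, so odd powers of
  \<open>q\<close> stay in the group of the eigenvalues \<open>q ^ (2 * k)\<close>.\<close>

locale root_of_unity =
  fixes N :: nat and q :: complex
  assumes odd_N: "odd N" and q_N: "q ^ N = 1"
    and primitive: "\<And>k. 0 < k \<Longrightarrow> k < N \<Longrightarrow> q ^ (2 * k) \<noteq> 1"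
begin

lemma N_pos: "N > 0"
  using odd_N by (cases N) auto

lemma q_nonzero [simp]: "q \<noteq> 0"
  using q_N N_pos by (auto simp: power_0_left)

lemma q_power_N [simp]: "(q ^ k) ^ N = 1" "q ^ (k * N) = 1"
  by (simp_all add: mult.commute[of k] power_mult q_N flip: power_mult[of q k])


lemma q_powi_N: "(q powi a) ^ N = 1"
proof -
  have "(q powi a) ^ N = (q ^ N) powi a"
    unfolding power_int_of_nat[symmetric] power_int_mult[symmetric] by (simp only: mult.commute)
  then show ?thesis
    by (simp add: q_N)
qed

lemma inj_on_q_power: "inj_on (\<lambda>k. q ^ (2 * k)) {..<N}"
proof -
  have False if "i < j" "j < N" "q ^ (2 * i) = q ^ (2 * j)" for i j
  proof -
    have "q ^ (2 * j) = q ^ (2 * i) * q ^ (2 * (j - i))"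
      using that unfolding power_add[symmetric] by (simp flip: distrib_left)
    then have "q ^ (2 * (j - i)) = 1"
      using that by simp
    then show False
      using primitive[of "j - i"] that by simp
  qed
  then show ?thesis
    by (intro inj_onI) (metis lessThan_iff nat_neq_iff)
qed

lemma roots_eq: "{z. z ^ N = 1} = (\<lambda>k. q ^ (2 * k)) ` {..<N}"
proof -
  have "(\<lambda>k. q ^ (2 * k)) ` {..<N} \<subseteq> {z. z ^ N = 1}"
    by auto
  moreover have "card ((\<lambda>k. q ^ (2 * k)) ` {..<N}) = card {z::complex. z ^ N = 1}"
    using N_pos by (simp add: card_image inj_on_q_power card_roots_unity_eq)
  moreover have "finite {z::complex. z ^ N = 1}"
    using N_pos by (intro finite_roots_unity) simp
  ultimately show ?thesis
    using card_subset_eq by metis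
qed

lemma root_cases:
  assumes "z ^ N = 1"
  obtains k where "k < N" "z = q ^ (2 * k)"
  using assms roots_eq by blast

text \<open>Both sides are monic of degree N in \<open>x\<close> and agree at N distinct
  points.\<close>

lemma prod_diff_roots: "(\<Prod>k<N. x - q ^ (2 * k)) = x ^ N - 1"
proof -
  define p where "p = (\<Prod>k<N. [:- (q ^ (2 * k)), 1:])"
  define r where "r = monom 1 N - (1 :: complex poly)"
  have deg: "degree p = N" "lead_coeff p = 1"
    unfolding p_def lead_coeff_prod by (simp_all add: degree_prod_eq_sum_degree)
  have r: "degree r = N" "lead_coeff r = 1"
  proof -
    have "degree (- 1 + monom (1::complex) N) = N"
      using N_pos by (subst degree_add_eq_right) (simp_all add: degree_monom_eq)
    then show "degree r = N" "lead_coeff r = 1"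
      using N_pos by (simp_all add: r_def)
  qed
  have "p = r"
  proof (rule poly_eqI_degree_lead_coeff[where A = "(\<lambda>k. q ^ (2 * k)) ` {..<N}" and n = N])
    show "card ((\<lambda>k. q ^ (2 * k)) ` {..<N}) \<ge> N"
      by (simp add: card_image inj_on_q_power)
    show "coeff p N = coeff r N"
      using deg r by simp
    fix z assume "z \<in> (\<lambda>k. q ^ (2 * k)) ` {..<N}"
    then show "poly p z = poly r z"
      by (auto simp: p_def r_def poly_prod poly_monom prod_zero_iff)
  qed (use deg r in auto)
  then have "poly p x = poly r x"
    by simp
  then show ?thesis
    by (simp add: p_def r_def poly_prod poly_monom)
qed

text \<open>Substitution of \<open>- b / (a * q)\<close> into the factorisation of
  \<open>x ^ N - 1\<close>; oddness of N turns the signs into those of the Fermat form.\<close>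

lemma prod_linear_forms: "(\<Prod>k<N. b + q ^ (2 * k + 1) * a) = a ^ N + b ^ N"
proof (cases "a = 0")
  case True
  then show ?thesis
    using N_pos by simp
next
  case False
  have scaled: "(\<Prod>k<N. x * (y - q ^ (2 * k))) = x ^ N * (y ^ N - 1)" for x y
    by (simp add: prod.distrib prod_diff_roots)
  have "(\<Prod>k<N. b + q ^ (2 * k + 1) * a) = (\<Prod>k<N. (- a * q) * (- b / (a * q) - q ^ (2 * k)))"
    using False by (intro prod.cong) (simp_all add: field_simps)
  also have "\<dots> = (- a * q) ^ N * ((- b / (a * q)) ^ N - 1)"
    by (rule scaled)
  also have "(- a * q) ^ N = - (a ^ N)"
    using odd_N by (simp add: power_mult_distrib q_N)
  also have "(- b / (a * q)) ^ N = - (b ^ N / a ^ N)"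
    using odd_N by (simp add: power_mult_distrib power_divide q_N)
  also have "- (a ^ N) * (- (b ^ N / a ^ N) - 1) = a ^ N + b ^ N"
    using False by (simp add: field_simps)
  finally show ?thesis .
qed

text \<open>A zero would force \<open>b ^ N = - (a ^ N)\<close>, off the Fermat curve.\<close>

lemma linear_form_nonzero:
  assumes "a ^ N + b ^ N = 1" and "z ^ N = 1"
  shows "b + q * a * z \<noteq> 0"
proof
  assume "b + q * a * z = 0"
  then have "b = - (q * a * z)"
    by (simp add: add_eq_0_iff)
  then have "b ^ N = - (a ^ N)"
    using odd_N assms(2) by (simp add: power_mult_distrib q_N)
  then show False
    using assms(1) by simp
qed

lemma prod_linear_forms_eq_1:
  assumes "a ^ N + b ^ N = 1" and "z ^ N = 1"
  shows "(\<Prod>k<N. b + q ^ (2 * k + 1) * a * z) = 1"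
  using prod_linear_forms[of b "a * z"] assms by (simp add: power_mult_distrib mult.assoc)

text \<open>Replacing \<open>z\<close> by \<open>q^2 * z\<close> moves the j-th linear form to the
  next index. Multiplying by the product of all forms, which is 1, raises each exponent to the new
  index; what is left over is the term at index N, and by \<open>q ^ N = 1\<close> its form is the
  one at index 0.\<close>

lemma dilog_power_shift:
  assumes "a ^ N + b ^ N = 1" and "z ^ N = 1"
  shows "(\<Prod>j<N. (b + q ^ (2 * j + 1) * a * (q\<^sup>2 * z)) ^ j) =
    (b + q * a * z) ^ N * (\<Prod>j<N. (b + q ^ (2 * j + 1) * a * z) ^ j)"
proof -
  define d where "d j = b + q ^ (2 * j + 1) * a * z" for j
  have shift: "b + q ^ (2 * j + 1) * a * (q\<^sup>2 * z) = d (Suc j)" for j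
    by (simp add: d_def power2_eq_square)
  have "(q\<^sup>2 * z) ^ N = 1"
    using assms(2) by (simp add: power_mult_distrib flip: power_mult)
  then have one: "(\<Prod>j<N. d (Suc j)) = 1"
    using prod_linear_forms_eq_1[OF assms(1), of "q\<^sup>2 * z"] by (simp only: shift)
  have "(\<Prod>j<N. d (Suc j) ^ j) = (\<Prod>j<N. d (Suc j) ^ j) * (\<Prod>j<N. d (Suc j))"
    by (simp add: one)
  also have "\<dots> = (\<Prod>j<N. d (Suc j) ^ Suc j)"
    by (simp add: mult.commute flip: prod.distrib)
  also have "\<dots> = (\<Prod>j<Suc N. d j ^ j)"
    unfolding prod.lessThan_Suc_shift by simp
  also have "\<dots> = d N ^ N * (\<Prod>j<N. d j ^ j)"
    by (simp add: mult.commute)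
  also have "d N = b + q * a * z"
    by (simp add: d_def q_N)
  finally show ?thesis
    unfolding shift unfolding d_def .
qed

text \<open>At \<open>(0, 1)\<close> all bases equal 1, where the principal power is continuous; all
  branches therefore start from the value 1.\<close>

lemma tendsto_dilog_series:
  assumes "(p \<longlongrightarrow> (0, 1)) F"
  shows "((\<lambda>t. dilog_series N q (p t) X) \<longlongrightarrow> 1) F"
proof -
  have p: "((\<lambda>t. fst (p t)) \<longlongrightarrow> 0) F" "((\<lambda>t. snd (p t)) \<longlongrightarrow> 1) F"
    using tendsto_fst[OF assms] tendsto_snd[OF assms] by simp_all
  have "((\<lambda>t. dilog_series N q (p t) X) \<longlongrightarrow>
      1 ^ ((N - 1) div 2) * (\<Prod>j<N. (1 + q ^ (2 * j + 1) * (0 / 1) * X) powr of_real (real j / real N))) F"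
    unfolding dilog_series_def exchange_ratio_def
    by (intro tendsto_mult tendsto_power tendsto_prod tendsto_powr_complex tendsto_add tendsto_divide
        tendsto_const p) auto
  then show ?thesis
    by simp
qed

text \<open>Both branches are continued along the same path, so \<open>dilog_power_shift\<close>
  compares their N-th powers at every time, and the common initial value 1 fixes the root of
  unity.\<close>

lemma dilog_branch_shift:
  assumes branch: "dilog_branch N q p \<Psi>" and z: "z ^ N = 1"
  shows "\<Psi> z \<noteq> 0" and "\<Psi> (q\<^sup>2 * z) = (snd p + q * fst p * z) * \<Psi> z"
proof -
  obtain \<gamma> where \<gamma>: "path \<gamma>" "path_image \<gamma> \<subseteq> fermat_bar N" "pathstart \<gamma> = (0, 1)" "pathfinish \<gamma> = p"
    and cont: "\<And>k. k < N \<Longrightarrow> dilog_continuation N q \<gamma> (q ^ (2 * k)) (\<Psi> (q ^ (2 * k)))"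
    using branch unfolding dilog_branch_def by blast
  define a where "a t = fst (\<gamma> t)" for t
  define b where "b t = snd (\<gamma> t)" for t
  have fermat: "a t ^ N + b t ^ N = 1" if "t \<in> {0..1}" for t
  proof -
    have "\<gamma> t \<in> fermat_bar N"
      using \<gamma>(2) that unfolding path_image_def by blast
    then show ?thesis
      using N_pos unfolding a_def b_def fermat_bar_def fermat_def by auto
  qed
  have ab: "continuous_on {0..1} a" "continuous_on {0..1} b"
    using \<gamma>(1) unfolding path_def a_def b_def by (auto intro: continuous_intros)
  have start: "a 0 = 0" "b 0 = 1" and finish: "a 1 = fst p" "b 1 = snd p"
    using \<gamma>(3,4) by (simp_all add: a_def b_def pathstart_def pathfinish_def)
  have "\<exists>h. continuous_on {0..1} h \<and>
      (\<forall>t \<in> {0..1}. h t ^ N = (\<Prod>j<N. (b t + q ^ (2 * j + 1) * a t * w) ^ j)) \<and>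
      h 0 = 1 \<and> h 1 = \<Psi> w" if w: "w ^ N = 1" for w
  proof -
    obtain k where k: "k < N" "w = q ^ (2 * k)"
      using root_cases[OF w] .
    obtain h where h: "continuous_on {0..1} h"
        "\<forall>t \<in> {0..1}. h t ^ N = (\<Prod>j<N. (b t + q ^ (2 * j + 1) * a t * w) ^ j)"
        "\<forall>\<^sub>F t in at_right 0. h t = dilog_series N q (\<gamma> t) w" "h 1 = \<Psi> w"
      using cont[OF k(1)] unfolding dilog_continuation_def a_def b_def k(2) by blast
    \<comment> \<open>The branch is tied to the series only to the right of 0, so its value at 0 is
      found by comparing limits.\<close>
    have "(h \<longlongrightarrow> h 0) (at 0 within {0..1})" "(\<gamma> \<longlongrightarrow> \<gamma> 0) (at 0 within {0..1})"
      using h(1) \<gamma>(1) unfolding continuous_on_def path_def by auto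
    then have lim: "(h \<longlongrightarrow> h 0) (at_right 0)" "(\<gamma> \<longlongrightarrow> (0, 1)) (at_right 0)"
      using \<gamma>(3) by (simp_all add: at_within_Icc_at_right pathstart_def)
    have "(h \<longlongrightarrow> 1) (at_right 0)"
      using tendsto_dilog_series[OF lim(2), of w] tendsto_cong[OF h(3)] by blast
    then have "h 0 = 1"
      using lim(1) tendsto_unique trivial_limit_at_right_real by blast
    then show ?thesis
      using h by blast
  qed
  then have "\<forall>w \<in> {w. w ^ N = 1}. \<exists>h. continuous_on {0..1} h \<and>
      (\<forall>t \<in> {0..1}. h t ^ N = (\<Prod>j<N. (b t + q ^ (2 * j + 1) * a t * w) ^ j)) \<and>
      h 0 = 1 \<and> h 1 = \<Psi> w"
    by blast
  from bchoice[OF this] obtain h where h: "\<And>w. w ^ N = 1 \<Longrightarrow> continuous_on {0..1} (h w)"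
      "\<And>w t. w ^ N = 1 \<Longrightarrow> t \<in> {0..1} \<Longrightarrow>
         h w t ^ N = (\<Prod>j<N. (b t + q ^ (2 * j + 1) * a t * w) ^ j)"
      "\<And>w. w ^ N = 1 \<Longrightarrow> h w 0 = 1" "\<And>w. w ^ N = 1 \<Longrightarrow> h w 1 = \<Psi> w"
    by blast
  define c where "c t = b t + q * a t * z" for t
  have c: "c t \<noteq> 0" if "t \<in> {0..1}" for t
    unfolding c_def using linear_form_nonzero[OF fermat[OF that] z] .
  have h_nonzero: "h z t \<noteq> 0" if "t \<in> {0..1}" for t
  proof -
    have "b t + q ^ (2 * j + 1) * a t * z \<noteq> 0" for j
      using linear_form_nonzero[OF fermat[OF that], of "q ^ (2 * j) * z"] z
      by (simp add: power_mult_distrib mult_ac)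
    then have "h z t ^ N \<noteq> 0"
      unfolding h(2)[OF z that] by (simp add: prod_zero_iff)
    then show ?thesis
      using N_pos by auto
  qed
  have z': "(q\<^sup>2 * z) ^ N = 1"
    using z by (simp add: power_mult_distrib flip: power_mult)
  \<comment> \<open>\<open>u\<close> is continuous with values in the \<open>N\<close>-th roots of unity, hence constant.\<close>
  define u where "u t = h (q\<^sup>2 * z) t / (c t * h z t)" for t
  have "u t ^ N = 1" if "t \<in> {0..1}" for t
  proof -
    have "h (q\<^sup>2 * z) t ^ N = c t ^ N * h z t ^ N"
      unfolding h(2)[OF z that] h(2)[OF z' that] dilog_power_shift[OF fermat[OF that] z] c_def ..
    then show ?thesis
      using c[OF that] h_nonzero[OF that] by (simp add: u_def power_divide power_mult_distrib)
  qed
  then have "u ` {0..1} \<subseteq> {w. w ^ N = 1}"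
    by blast
  then have "finite (u ` {0..1})"
    by (rule finite_subset) (use N_pos in \<open>simp add: finite_roots_unity\<close>)
  moreover have "continuous_on {0..1} u"
    unfolding u_def c_def
    by (intro continuous_intros h ab z z') (use c h_nonzero in \<open>auto simp: c_def\<close>)
  ultimately have "u constant_on {0..1}"
    by (intro continuous_finite_range_constant) auto
  then have "u 1 = u 0"
    unfolding constant_on_def by auto
  also have "u 0 = 1"
    using h(3)[OF z] h(3)[OF z'] by (simp add: u_def c_def start)
  finally show "\<Psi> (q\<^sup>2 * z) = (snd p + q * fst p * z) * \<Psi> z"
    using c[of 1] h_nonzero[of 1] h(4)[OF z] h(4)[OF z'] by (simp add: u_def c_def finish)
  show "\<Psi> z \<noteq> 0"
    using h_nonzero[of 1] h(4)[OF z] by simp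
qed

end

section \<open>Complex algebras\<close>

text \<open>Scalars come from the type \<open>complex\<close>; the last two laws make them
  central.\<close>

locale complex_algebra = ring R for R :: "(complex, 'x) module" (structure) +
  assumes smult_closed [simp]: "x \<in> carrier R \<Longrightarrow> c \<odot> x \<in> carrier R"
    and smult_l_distr: "x \<in> carrier R \<Longrightarrow> (c + d) \<odot> x = c \<odot> x \<oplus> d \<odot> x"
    and smult_r_distr: "x \<in> carrier R \<Longrightarrow> y \<in> carrier R \<Longrightarrow> c \<odot> (x \<oplus> y) = c \<odot> x \<oplus> c \<odot> y"
    and smult_smult: "x \<in> carrier R \<Longrightarrow> c \<odot> (d \<odot> x) = (c * d) \<odot> x"
    and smult_one [simp]: "x \<in> carrier R \<Longrightarrow> 1 \<odot> x = x"
    and smult_mult_l: "x \<in> carrier R \<Longrightarrow> y \<in> carrier R \<Longrightarrow> (c \<odot> x) \<otimes> y = c \<odot> (x \<otimes> y)"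
    and smult_mult_r: "x \<in> carrier R \<Longrightarrow> y \<in> carrier R \<Longrightarrow> x \<otimes> (c \<odot> y) = c \<odot> (x \<otimes> y)"
begin

lemma smult_zero_l [simp]: "x \<in> carrier R \<Longrightarrow> 0 \<odot> x = \<zero>"
  using smult_l_distr[of x 0 0] by (metis add.l_cancel_one' add_0 smult_closed)

lemma smult_zero_r [simp]: "c \<odot> \<zero> = \<zero>"
  using smult_r_distr[of "\<zero>" "\<zero>" c] by (metis add.l_cancel_one' l_zero smult_closed zero_closed)

lemma smult_finsum:
  "f \<in> A \<rightarrow> carrier R \<Longrightarrow> c \<odot> finsum R f A = finsum R (\<lambda>i. c \<odot> f i) A"
proof (induction A rule: infinite_finite_induct)
  case (insert i A)
  then have "finsum R f A \<in> carrier R"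
    by (intro finsum_closed) auto
  then show ?case
    using insert by (simp add: Pi_iff smult_r_distr)
qed simp_all

lemma finsum_smult:
  "x \<in> carrier R \<Longrightarrow> finsum R (\<lambda>i. c i \<odot> x) A = sum c A \<odot> x"
  by (induction A rule: infinite_finite_induct) (simp_all add: smult_l_distr Pi_iff)

lemma smult_nat_pow: "x \<in> carrier R \<Longrightarrow> (c \<odot> x) [^] (n::nat) = c ^ n \<odot> x [^] n"
  by (induction n) (simp_all add: smult_mult_l smult_mult_r smult_smult mult.commute)

lemma smult_inverse:
  "c \<noteq> 0 \<Longrightarrow> x \<in> Units R \<Longrightarrow> c \<odot> x \<in> Units R \<and> inv (c \<odot> x) = inverse c \<odot> inv x"
proof -
  assume c: "c \<noteq> 0" and x: "x \<in> Units R"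
  then have inv: "(c \<odot> x) \<otimes> (inverse c \<odot> inv x) = \<one>" "(inverse c \<odot> inv x) \<otimes> (c \<odot> x) = \<one>"
    by (simp_all add: smult_mult_l smult_mult_r smult_smult Units_closed)
  have closed: "c \<odot> x \<in> carrier R" "inverse c \<odot> inv x \<in> carrier R"
    using x by (simp_all add: Units_closed)
  then have "c \<odot> x \<in> Units R"
    unfolding Units_def using inv by blast
  then show ?thesis
    using inv x inv_char[of "c \<odot> x" "inverse c \<odot> inv x"] by (simp add: Units_closed)
qed

end

section \<open>Homomorphisms of complex algebras\<close>

lemma alg_homD:
  assumes "\<phi> \<in> alg_hom R S"
  shows "\<phi> \<in> ring_hom R S" and "x \<in> carrier R \<Longrightarrow> \<phi> (c \<odot>\<^bsub>R\<^esub> x) = c \<odot>\<^bsub>S\<^esub> \<phi> x"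
  using assms by (auto simp: alg_hom_def)

lemmas alg_hom_simps =
  ring_hom_closed[OF alg_homD(1)] ring_hom_mult[OF alg_homD(1)] ring_hom_add[OF alg_homD(1)]
  ring_hom_one[OF alg_homD(1)] alg_homD(2)

lemma alg_hom_inverse:
  assumes \<phi>: "\<phi> \<in> alg_hom R S" and "complex_algebra R" "complex_algebra S" and x: "x \<in> Units R"
  shows "\<phi> x \<in> Units S" and "\<phi> (inv\<^bsub>R\<^esub> x) = inv\<^bsub>S\<^esub> (\<phi> x)"
proof -
  interpret R: complex_algebra R by fact
  interpret S: complex_algebra S by fact
  have x': "x \<in> carrier R" "inv\<^bsub>R\<^esub> x \<in> carrier R"
    using x by auto
  then have inv: "\<phi> x \<otimes>\<^bsub>S\<^esub> \<phi> (inv\<^bsub>R\<^esub> x) = \<one>\<^bsub>S\<^esub>" "\<phi> (inv\<^bsub>R\<^esub> x) \<otimes>\<^bsub>S\<^esub> \<phi> x = \<one>\<^bsub>S\<^esub>"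
    using x by (simp_all add: alg_hom_simps[OF \<phi>] flip: alg_hom_simps(2)[OF \<phi>])
  then show "\<phi> x \<in> Units S"
    using x' by (auto simp: Units_def alg_hom_simps[OF \<phi>] intro!: bexI[of _ "\<phi> (inv\<^bsub>R\<^esub> x)"])
  then show "\<phi> (inv\<^bsub>R\<^esub> x) = inv\<^bsub>S\<^esub> (\<phi> x)"
    using inv x' by (intro S.inv_char[symmetric]) (simp_all add: alg_hom_simps[OF \<phi>])
qed

lemma alg_hom_nat_pow:
  assumes \<phi>: "\<phi> \<in> alg_hom R S" and "complex_algebra R" "complex_algebra S" and x: "x \<in> carrier R"
  shows "\<phi> (x [^]\<^bsub>R\<^esub> (n::nat)) = \<phi> x [^]\<^bsub>S\<^esub> n"
proof -
  interpret R: complex_algebra R by fact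
  interpret S: complex_algebra S by fact
  show ?thesis
    by (induction n) (use x in \<open>simp_all add: alg_hom_simps[OF \<phi>]\<close>)
qed

lemma alg_hom_comp:
  assumes "\<phi> \<in> alg_hom R S" and "\<psi> \<in> alg_hom S T"
  shows "\<psi> \<circ> \<phi> \<in> alg_hom R T"
  using assms ring_hom_trans[of \<phi> R S \<psi> T] ring_hom_closed[of \<phi> R S]
  by (auto simp: alg_hom_def)

lemma alg_isoI:
  assumes "\<phi> \<in> alg_hom R S" and "\<psi> \<in> alg_hom S R"
    and "\<And>x. x \<in> carrier R \<Longrightarrow> \<psi> (\<phi> x) = x" and "\<And>y. y \<in> carrier S \<Longrightarrow> \<phi> (\<psi> y) = y"
  shows "\<phi> \<in> alg_iso R S"
proof -
  have "\<phi> ` carrier R \<subseteq> carrier S" "\<psi> ` carrier S \<subseteq> carrier R"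
    using alg_hom_simps(1)[OF assms(1)] alg_hom_simps(1)[OF assms(2)] by blast+
  then have "bij_betw \<phi> (carrier R) (carrier S)"
    using assms(3,4) by (intro bij_betw_byWitness[where f' = \<psi>]) blast+
  then show ?thesis
    using assms(1) by (simp add: alg_iso_def)
qed

lemma alg_iso_comp:
  assumes "\<phi> \<in> alg_iso R S" and "\<psi> \<in> alg_iso S T"
  shows "\<psi> \<circ> \<phi> \<in> alg_iso R T"
  using assms alg_hom_comp[of \<phi> R S \<psi> T] bij_betw_trans[of \<phi> "carrier R" "carrier S" \<psi> "carrier T"]
  by (simp add: alg_iso_def)

lemma alg_iso_hom: "\<phi> \<in> alg_iso R S \<Longrightarrow> \<phi> \<in> alg_hom R S"
  by (simp add: alg_iso_def)

section \<open>The universal property of the cyclic quantum torus\<close>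

lemma ring_free_algebra: "ring (free_algebra E)"
proof (rule ringI)
  show "abelian_group (free_algebra E)"
  proof (rule abelian_groupI)
    fix f assume "f \<in> carrier (free_algebra E)"
    then show "\<exists>g \<in> carrier (free_algebra E). g \<oplus>\<^bsub>free_algebra E\<^esub> f = \<zero>\<^bsub>free_algebra E\<^esub>"
      by (intro bexI[of _ "- f"]) (auto simp: free_algebra_def in_keys_iff)
  qed (auto simp: free_algebra_def add_ac dest!: subsetD[OF keys_add])
  show "monoid (free_algebra E)"
    by (rule monoidI)
       (force simp: free_algebra_def mult.assoc zero_word_def plus_word_def dest!: subsetD[OF keys_mult])+
qed (auto simp: free_algebra_def algebra_simps)

lemma free_algebra_simps [simp]:
  "mult (free_algebra E) = (*)" "add (free_algebra E) = (+)"
  "one (free_algebra E) = 1" "zero (free_algebra E) = 0"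
  by (simp_all add: free_algebra_def)

lemma single_in_free_algebra: "set (letters w) \<subseteq> E \<times> UNIV \<Longrightarrow> Poly_Mapping.single w c \<in> carrier (free_algebra E)"
  by (auto simp: free_algebra_def)

lemma free_gen_closed: "\<alpha> \<in> E \<Longrightarrow> free_gen \<alpha> b \<in> carrier (free_algebra E)"
  unfolding free_gen_def by (rule single_in_free_algebra) auto

lemma free_scalar_closed: "free_scalar c \<in> carrier (free_algebra E)"
  unfolding free_scalar_def by (rule single_in_free_algebra) (simp add: zero_word_def)

text \<open>An element is the finite sum of its monomials, so additive statements reduce to scalar
  multiples of single words.\<close>

lemma free_algebra_induct [consumes 1, case_names single add]:
  assumes f: "f \<in> carrier (free_algebra E)"
    and single: "\<And>w c. set (letters w) \<subseteq> E \<times> UNIV \<Longrightarrow> P (Poly_Mapping.single w c)"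
    and add: "\<And>f g. f \<in> carrier (free_algebra E) \<Longrightarrow> g \<in> carrier (free_algebra E) \<Longrightarrow>
      P f \<Longrightarrow> P g \<Longrightarrow> P (f + g)"
  shows "P f"
proof -
  interpret F: ring "free_algebra E"
    by (rule ring_free_algebra)
  have eq: "f = (\<Sum>w \<in> Poly_Mapping.keys f. Poly_Mapping.single w (Poly_Mapping.lookup f w))"
    by (rule poly_mapping_eqI) (auto simp: lookup_sum lookup_single when_def in_keys_iff)
  have "(\<Sum>w \<in> A. Poly_Mapping.single w (Poly_Mapping.lookup f w)) \<in> carrier (free_algebra E) \<and>
      P (\<Sum>w \<in> A. Poly_Mapping.single w (Poly_Mapping.lookup f w))" if "finite A" "A \<subseteq> Poly_Mapping.keys f" for A
    using that
  proof (induction A rule: finite_induct)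
    case empty
    \<comment> \<open>The empty sum is a monomial with coefficient 0.\<close>
    show ?case
      using single[of 0 0] F.zero_closed by (simp add: zero_word_def)
  next
    case (insert w A)
    have w: "set (letters w) \<subseteq> E \<times> UNIV"
      using insert.prems f unfolding free_algebra_def by fastforce
    have IH: "(\<Sum>w \<in> A. Poly_Mapping.single w (Poly_Mapping.lookup f w)) \<in> carrier (free_algebra E)"
        "P (\<Sum>w \<in> A. Poly_Mapping.single w (Poly_Mapping.lookup f w))"
      using insert.IH insert.prems by simp_all
    show ?case
      unfolding sum.insert[OF insert.hyps]
      using add[OF single_in_free_algebra[OF w] IH(1) single[OF w] IH(2)]
        F.a_closed[OF single_in_free_algebra[OF w] IH(1)] by simp
  qed
  then show ?thesis
    using eq by (metis finite_keys order_refl)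
qed

text \<open>The map is defined on chosen representatives; two of them differ by an element of the
  ideal, which is sent to zero.\<close>

lemma quotient_hom_exists:
  assumes "ideal I F" and "ring S" and h: "h \<in> ring_hom F S"
    and ker: "\<And>x. x \<in> I \<Longrightarrow> h x = \<zero>\<^bsub>S\<^esub>"
  shows "\<exists>k \<in> ring_hom (F Quot I) S. \<forall>x \<in> carrier F. k (I +>\<^bsub>F\<^esub> x) = h x"
proof -
  interpret I: ideal I F by fact
  interpret S: ring S by fact
  define k where "k X = h (SOME x. x \<in> carrier F \<and> X = I +>\<^bsub>F\<^esub> x)" for X
  have k: "k (I +>\<^bsub>F\<^esub> x) = h x" if x: "x \<in> carrier F" for x
  proof -
    define y where "y = (SOME y. y \<in> carrier F \<and> I +>\<^bsub>F\<^esub> x = I +>\<^bsub>F\<^esub> y)"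
    have y: "y \<in> carrier F" "I +>\<^bsub>F\<^esub> x = I +>\<^bsub>F\<^esub> y"
      using someI[of "\<lambda>y. y \<in> carrier F \<and> I +>\<^bsub>F\<^esub> x = I +>\<^bsub>F\<^esub> y" x] x unfolding y_def by auto
    have "x \<in> I +>\<^bsub>F\<^esub> y"
      using I.a_rcos_self[OF x] y(2) by simp
    then obtain i where i: "i \<in> I" "x = i \<oplus>\<^bsub>F\<^esub> y"
      by (auto simp: a_r_coset_def r_coset_def)
    then have "h x = h i \<oplus>\<^bsub>S\<^esub> h y"
      using y(1) I.a_Hcarr ring_hom_add[OF h] by blast
    then show ?thesis
      using ker[OF i(1)] ring_hom_closed[OF h y(1)] by (simp add: k_def y_def[symmetric])
  qed
  have rep: "\<exists>x \<in> carrier F. X = I +>\<^bsub>F\<^esub> x" if "X \<in> carrier (F Quot I)" for X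
    using that by (auto simp: FactRing_simps)
  have "k \<in> ring_hom (F Quot I) S"
  proof (rule ring_hom_memI)
    fix X assume "X \<in> carrier (F Quot I)"
    then show "k X \<in> carrier S"
      using rep k ring_hom_closed[OF h] by metis
    fix Y assume "Y \<in> carrier (F Quot I)"
    then obtain x y where xy: "x \<in> carrier F" "X = I +>\<^bsub>F\<^esub> x" "y \<in> carrier F" "Y = I +>\<^bsub>F\<^esub> y"
      using rep \<open>X \<in> carrier (F Quot I)\<close> by metis
    show "k (X \<otimes>\<^bsub>F Quot I\<^esub> Y) = k X \<otimes>\<^bsub>S\<^esub> k Y"
      using ring_hom_mult[OF I.rcos_ring_hom xy(1,3)] k xy ring_hom_mult[OF h xy(1,3)]
      by (metis I.m_closed)
    show "k (X \<oplus>\<^bsub>F Quot I\<^esub> Y) = k X \<oplus>\<^bsub>S\<^esub> k Y"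
      using ring_hom_add[OF I.rcos_ring_hom xy(1,3)] k xy ring_hom_add[OF h xy(1,3)]
      by (metis I.a_closed)
  next
    show "k \<one>\<^bsub>F Quot I\<^esub> = \<one>\<^bsub>S\<^esub>"
      using ring_hom_one[OF I.rcos_ring_hom] k[OF I.one_closed] ring_hom_one[OF h] by simp
  qed
  then show ?thesis
    using k by blast
qed

context complex_algebra
begin

definition eval_word :: "('g \<Rightarrow> 'x) \<Rightarrow> 'g word \<Rightarrow> 'x" where
  "eval_word g w = foldr (\<lambda>l a. g l \<otimes> a) (letters w) \<one>"

definition eval_free :: "('g \<Rightarrow> 'x) \<Rightarrow> ('g word \<Rightarrow>\<^sub>0 complex) \<Rightarrow> 'x" where
  "eval_free g f = (\<Oplus>w \<in> Poly_Mapping.keys f. Poly_Mapping.lookup f w \<odot> eval_word g w)"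

context
  fixes g :: "'e \<times> bool \<Rightarrow> 'x" and E :: "'e set"
  assumes g: "\<And>l. l \<in> E \<times> UNIV \<Longrightarrow> g l \<in> carrier R"
begin

lemma eval_word_closed: "set (letters w) \<subseteq> E \<times> UNIV \<Longrightarrow> eval_word g w \<in> carrier R"
proof -
  have "set ls \<subseteq> E \<times> UNIV \<Longrightarrow> foldr (\<lambda>l a. g l \<otimes> a) ls \<one> \<in> carrier R" for ls
    by (induction ls) (auto intro: g)
  then show "set (letters w) \<subseteq> E \<times> UNIV \<Longrightarrow> eval_word g w \<in> carrier R"
    unfolding eval_word_def .
qed

lemma eval_word_add:
  assumes "set (letters v) \<subseteq> E \<times> UNIV" and "set (letters w) \<subseteq> E \<times> UNIV"
  shows "eval_word g (v + w) = eval_word g v \<otimes> eval_word g w"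
proof -
  obtain ls where v: "v = Word ls"
    by (cases v)
  have "set ls \<subseteq> E \<times> UNIV \<Longrightarrow> eval_word g (Word ls + w) = eval_word g (Word ls) \<otimes> eval_word g w"
  proof (induction ls)
    case Nil
    then show ?case
      using eval_word_closed[OF assms(2)] by (simp add: eval_word_def plus_word_def)
  next
    case (Cons l ls)
    have "eval_word g (Word (l # ls) + w) = g l \<otimes> eval_word g (Word ls + w)"
      by (simp add: eval_word_def plus_word_def)
    also have "\<dots> = g l \<otimes> (eval_word g (Word ls) \<otimes> eval_word g w)"
      using Cons by simp
    also have "\<dots> = (g l \<otimes> eval_word g (Word ls)) \<otimes> eval_word g w"
      using Cons.prems g[of l] eval_word_closed[of "Word ls"] eval_word_closed[OF assms(2)]
      by (simp add: m_assoc)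
    finally show ?case
      by (simp add: eval_word_def)
  qed
  then show ?thesis
    using assms(1) v by simp
qed

text \<open>Cancellation can make the support of a sum smaller than the union of the supports; a
  common finite superset permits termwise addition.\<close>

lemma eval_free_superset:
  assumes "finite A" and "Poly_Mapping.keys f \<subseteq> A" and "A \<subseteq> {w. set (letters w) \<subseteq> E \<times> UNIV}"
  shows "eval_free g f = (\<Oplus>w \<in> A. Poly_Mapping.lookup f w \<odot> eval_word g w)"
  unfolding eval_free_def using assms eval_word_closed
  by (intro add.finprod_mono_neutral_cong_left) (auto simp: in_keys_iff Pi_iff)

lemma eval_free_closed: "f \<in> carrier (free_algebra E) \<Longrightarrow> eval_free g f \<in> carrier R"
  unfolding eval_free_def
  by (intro finsum_closed) (auto simp: free_algebra_def intro!: smult_closed eval_word_closed)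

lemma eval_free_single:
  assumes "set (letters w) \<subseteq> E \<times> UNIV"
  shows "eval_free g (Poly_Mapping.single w c) = c \<odot> eval_word g w"
  using assms eval_word_closed[OF assms] by (subst eval_free_superset[of "{w}"]) auto

lemma eval_free_add:
  assumes "f \<in> carrier (free_algebra E)" and "h \<in> carrier (free_algebra E)"
  shows "eval_free g (f + h) = eval_free g f \<oplus> eval_free g h"
proof -
  define A where "A = Poly_Mapping.keys f \<union> Poly_Mapping.keys h"
  have A: "finite A" "Poly_Mapping.keys f \<subseteq> A" "Poly_Mapping.keys h \<subseteq> A" "Poly_Mapping.keys (f + h) \<subseteq> A"
      "A \<subseteq> {w. set (letters w) \<subseteq> E \<times> UNIV}"
    using assms keys_add[of f h] by (auto simp: A_def free_algebra_def)
  have word: "eval_word g w \<in> carrier R" if "w \<in> A" for w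
    using A(5) that by (intro eval_word_closed) auto
  have "eval_free g (f + h) =
      (\<Oplus>w \<in> A. Poly_Mapping.lookup f w \<odot> eval_word g w \<oplus> Poly_Mapping.lookup h w \<odot> eval_word g w)"
    unfolding eval_free_superset[OF A(1,4,5)]
    by (intro finsum_cong') (auto simp: lookup_add smult_l_distr word)
  also have "\<dots> = eval_free g f \<oplus> eval_free g h"
    unfolding eval_free_superset[OF A(1,2,5)] eval_free_superset[OF A(1,3,5)]
    by (intro finsum_addf) (auto simp: word)
  finally show ?thesis .
qed

text \<open>Additivity in each factor reduces the claim to monomials, where it is concatenation of
  words together with centrality of scalars.\<close>

lemma eval_free_mult:
  assumes "f \<in> carrier (free_algebra E)" and "h \<in> carrier (free_algebra E)"
  shows "eval_free g (f * h) = eval_free g f \<otimes> eval_free g h"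
proof -
  interpret F: ring "free_algebra E"
    by (rule ring_free_algebra)
  note closed = F.m_closed[simplified] F.a_closed[simplified] single_in_free_algebra
  have single_mult: "eval_free g (Poly_Mapping.single v c * h) = eval_free g (Poly_Mapping.single v c) \<otimes> eval_free g h"
    if v: "set (letters v) \<subseteq> E \<times> UNIV" for v c
    using assms(2)
  proof (induction h rule: free_algebra_induct)
    case (single w d)
    then have "set (letters (v + w)) \<subseteq> E \<times> UNIV"
      using v by (simp add: plus_word_def)
    then show ?case
      using v single eval_word_closed[OF v] eval_word_closed[OF single]
      by (simp add: mult_single eval_free_single eval_word_add smult_mult_l smult_mult_r smult_smult mult.commute)
  next
    case (add f h)
    then show ?case
      using v by (simp add: distrib_left eval_free_add closed eval_free_closed r_distr)
  qed
  show ?thesis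
    using assms(1)
  proof (induction f rule: free_algebra_induct)
    case (single w c)
    then show ?case
      by (rule single_mult)
  next
    case (add f f')
    then show ?case
      using assms(2) by (simp add: distrib_right eval_free_add closed eval_free_closed l_distr)
  qed
qed

lemma eval_free_hom: "eval_free g \<in> ring_hom (free_algebra E) R"
proof (rule ring_hom_memI)
  have "eval_free g (Poly_Mapping.single 0 1) = \<one>"
    by (subst eval_free_single) (simp_all add: zero_word_def eval_word_def)
  then show "eval_free g \<one>\<^bsub>free_algebra E\<^esub> = \<one>"
    by simp
qed (simp_all add: eval_free_closed eval_free_mult eval_free_add)

lemma eval_free_gen: "\<alpha> \<in> E \<Longrightarrow> eval_free g (free_gen \<alpha> b) = g (\<alpha>, b)"
  unfolding free_gen_def using g[of "(\<alpha>, b)"] by (subst eval_free_single) (auto simp: eval_word_def)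

lemma eval_free_scalar: "eval_free g (free_scalar c) = c \<odot> \<one>"
  unfolding free_scalar_def by (subst eval_free_single) (simp_all add: eval_word_def zero_word_def)

end

end

text \<open>The relators use the subtraction of the type, the ring structure has its own negative;
  the two agree on the carrier.\<close>

lemma free_algebra_diff:
  assumes "f \<in> carrier (free_algebra E)" and "g \<in> carrier (free_algebra E)"
  shows "f - g \<in> carrier (free_algebra E)"
proof -
  interpret F: ring "free_algebra E"
    by (rule ring_free_algebra)
  have "\<ominus>\<^bsub>free_algebra E\<^esub> g = - g"
    using assms(2) by (intro F.minus_equality) (auto simp: free_algebra_def)
  then show ?thesis
    using F.minus_closed[OF assms] by (simp add: F.minus_eq)
qed

text \<open>Writing \<open>f = (f - g) + g\<close> turns the subtraction of the type into a sum,
  which the homomorphism respects.\<close>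

lemma ring_hom_eq_of_diff:
  assumes h: "h \<in> ring_hom (free_algebra E) S" and "ring S"
    and fg: "f \<in> carrier (free_algebra E)" "g \<in> carrier (free_algebra E)"
  shows "h (f - g) = \<zero>\<^bsub>S\<^esub> \<longleftrightarrow> h f = h g"
proof -
  interpret S: ring S by fact
  have diff: "f - g \<in> carrier (free_algebra E)"
    using fg by (rule free_algebra_diff)
  have sum: "h f = h (f - g) \<oplus>\<^bsub>S\<^esub> h g"
    using ring_hom_add[OF h diff fg(2)] by simp
  then show ?thesis
    unfolding sum using ring_hom_closed[OF h diff] ring_hom_closed[OF h fg(2)]
    by (simp add: S.add.r_cancel_one)
qed

section \<open>The two-stage quotient of the free algebra, with \<open>cls\<close> as composite
  projection\<close>

locale cyclic_torus =
  fixes N :: nat and q :: complex and \<epsilon> :: "'e \<Rightarrow> 'e \<Rightarrow> int" and E :: "'e set" and u :: "'e \<Rightarrow> complex"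
begin

abbreviation "F \<equiv> free_algebra E"
abbreviation "I \<equiv> torus_ideal q \<epsilon> E"
abbreviation "T \<equiv> quantum_torus q \<epsilon> E"
abbreviation "J \<equiv> cyclic_ideal N q \<epsilon> E u"
abbreviation "R \<equiv> cyclic_torus N q \<epsilon> E u"
abbreviation "cls \<equiv> cyclic_class N q \<epsilon> E u"
abbreviation "X \<equiv> \<lambda>\<alpha>. cls (free_gen \<alpha> True)"

sublocale F: ring F
  by (rule ring_free_algebra)

lemma relators_closed: "torus_relators q \<epsilon> E \<subseteq> carrier F"
proof -
  show ?thesis
    unfolding torus_relators_def
    using F.m_closed F.one_closed by (auto intro!: free_algebra_diff simp: free_gen_closed free_scalar_closed)
qed

sublocale I: ideal I F
  unfolding torus_ideal_def by (rule F.genideal_ideal[OF relators_closed])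

sublocale T: ring T
  unfolding quantum_torus_def by (rule I.quotient_is_ring)

lemma torus_class_hom: "torus_class q \<epsilon> E \<in> ring_hom F T"
  using I.rcos_ring_hom unfolding torus_class_def quantum_torus_def by simp

abbreviation "cyclic_relators \<equiv> {torus_class q \<epsilon> E (free_gen \<alpha> True) [^]\<^bsub>T\<^esub> N \<ominus>\<^bsub>T\<^esub>
               torus_class q \<epsilon> E (free_scalar (u \<alpha> ^ N)) | \<alpha>. \<alpha> \<in> E}"

lemma cyclic_relators_closed: "cyclic_relators \<subseteq> carrier T"
  using ring_hom_closed[OF torus_class_hom free_gen_closed] ring_hom_closed[OF torus_class_hom free_scalar_closed]
  by (auto intro!: T.minus_closed T.nat_pow_closed)

sublocale J: ideal J T
  unfolding cyclic_ideal_def Let_def by (rule T.genideal_ideal[OF cyclic_relators_closed])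

lemma cyclic_torus_simps:
  "carrier R = carrier (T Quot J)" "mult R = mult (T Quot J)" "one R = one (T Quot J)"
  "zero R = zero (T Quot J)" "add R = add (T Quot J)"
  "c \<odot>\<^bsub>R\<^esub> x = cls (free_scalar c) \<otimes>\<^bsub>R\<^esub> x"
  by (simp_all add: cyclic_torus_def Let_def)

text \<open>\<open>R\<close> has the operations of \<open>T Quot J\<close> in a record extended by
  scalars, so the axioms are copied operation by operation.\<close>

lemma ring_R: "ring R"
proof -
  interpret Q: ring "T Quot J"
    by (rule J.quotient_is_ring)
  show ?thesis
  proof (rule ringI)
    show "abelian_group R"
      by (rule abelian_groupI)
         (auto simp: cyclic_torus_simps(1-5) Q.a_ac intro!: bexI[of _ "\<ominus>\<^bsub>T Quot J\<^esub> _"] Q.l_neg)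
    show "monoid R"
      by (rule monoidI) (auto simp: cyclic_torus_simps(1-5) Q.m_assoc)
  qed (auto simp: cyclic_torus_simps(1-5) Q.l_distr Q.r_distr)
qed

lemma cls_hom: "cls \<in> ring_hom F R"
proof -
  have "cls = (+>\<^bsub>T\<^esub>) J \<circ> torus_class q \<epsilon> E"
    by (simp add: fun_eq_iff cyclic_class_def)
  then have "cls \<in> ring_hom F (T Quot J)"
    using ring_hom_trans[OF torus_class_hom J.rcos_ring_hom] by simp
  then show ?thesis
    unfolding ring_hom_def by (simp add: cyclic_torus_simps)
qed

lemma cls_surj:
  assumes "x \<in> carrier R"
  obtains f where "f \<in> carrier F" "x = cls f"
proof -
  obtain t where t: "t \<in> carrier T" "x = J +>\<^bsub>T\<^esub> t"
    using assms unfolding cyclic_torus_simps FactRing_simps by auto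
  obtain f where "f \<in> carrier F" "t = torus_class q \<epsilon> E f"
    using t(1) unfolding quantum_torus_def FactRing_simps torus_class_def by auto
  then show thesis
    using that t(2) by (simp add: cyclic_class_def)
qed

sublocale R: ring R
  by (rule ring_R)

lemma free_scalar_ring:
  "free_scalar (c + d) = free_scalar c + free_scalar d" "free_scalar (c * d) = free_scalar c * free_scalar d"
  "free_scalar 1 = 1"
  by (simp_all add: free_scalar_def single_add mult_single)

lemma free_scalar_central: "f * free_scalar c = free_scalar c * f"
proof -
  \<comment> \<open>Over all letters the carrier is the whole type, so the induction on monomials
    applies to any element.\<close>
  have "f \<in> carrier (free_algebra UNIV)"
    by (simp add: free_algebra_def)
  then show ?thesis
    by (induction f rule: free_algebra_induct)
       (simp_all add: free_scalar_def mult_single mult.commute distrib_left distrib_right)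
qed

sublocale R: complex_algebra R
proof
  note hom = ring_hom_mult[OF cls_hom, symmetric, simplified] ring_hom_add[OF cls_hom, symmetric, simplified]
    ring_hom_one[OF cls_hom, symmetric, simplified]
  note [simp] = free_scalar_closed
  have S: "cls (free_scalar c) \<in> carrier R" for c
    by (rule ring_hom_closed[OF cls_hom]) simp
  \<comment> \<open>Centrality is lifted from the free algebra, where a scalar is a multiple of the
    empty word.\<close>
  have comm: "x \<otimes>\<^bsub>R\<^esub> cls (free_scalar c) = cls (free_scalar c) \<otimes>\<^bsub>R\<^esub> x" if "x \<in> carrier R" for x c
    using that by (elim cls_surj) (simp add: hom free_scalar_central)
  fix x y c d assume x: "x \<in> carrier R"
  show "c \<odot>\<^bsub>R\<^esub> x \<in> carrier R"
    using S x by (simp add: cyclic_torus_simps(6))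
  show "(c + d) \<odot>\<^bsub>R\<^esub> x = c \<odot>\<^bsub>R\<^esub> x \<oplus>\<^bsub>R\<^esub> d \<odot>\<^bsub>R\<^esub> x"
    using S x by (simp add: cyclic_torus_simps(6) free_scalar_ring hom(2)[symmetric] R.l_distr)
  show "c \<odot>\<^bsub>R\<^esub> (d \<odot>\<^bsub>R\<^esub> x) = (c * d) \<odot>\<^bsub>R\<^esub> x"
    using S x by (simp add: cyclic_torus_simps(6) free_scalar_ring hom(1)[symmetric] R.m_assoc)
  show "1 \<odot>\<^bsub>R\<^esub> x = x"
    using x by (simp add: cyclic_torus_simps(6) free_scalar_ring hom(3)[symmetric])
  assume y: "y \<in> carrier R"
  show "c \<odot>\<^bsub>R\<^esub> (x \<oplus>\<^bsub>R\<^esub> y) = c \<odot>\<^bsub>R\<^esub> x \<oplus>\<^bsub>R\<^esub> c \<odot>\<^bsub>R\<^esub> y"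
    using S x y by (simp add: cyclic_torus_simps(6) R.r_distr)
  show "(c \<odot>\<^bsub>R\<^esub> x) \<otimes>\<^bsub>R\<^esub> y = c \<odot>\<^bsub>R\<^esub> (x \<otimes>\<^bsub>R\<^esub> y)"
    using S x y by (simp add: cyclic_torus_simps(6) R.m_assoc)
  show "x \<otimes>\<^bsub>R\<^esub> (c \<odot>\<^bsub>R\<^esub> y) = c \<odot>\<^bsub>R\<^esub> (x \<otimes>\<^bsub>R\<^esub> y)"
    using S x y by (simp add: cyclic_torus_simps(6) comm flip: R.m_assoc)
qed

lemma cls_scalar: "cls (free_scalar c) = c \<odot>\<^bsub>R\<^esub> \<one>\<^bsub>R\<^esub>"
  by (simp add: cyclic_torus_simps(6) ring_hom_closed[OF cls_hom] free_scalar_closed)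

lemma torus_class_eq: "f - g \<in> torus_relators q \<epsilon> E \<Longrightarrow> f \<in> carrier F \<Longrightarrow> g \<in> carrier F \<Longrightarrow> cls f = cls g"
proof -
  assume rel: "f - g \<in> torus_relators q \<epsilon> E" and fg: "f \<in> carrier F" "g \<in> carrier F"
  have "f - g \<in> I"
    using rel F.genideal_self[OF relators_closed] unfolding torus_ideal_def by blast
  then have "torus_class q \<epsilon> E (f - g) = \<zero>\<^bsub>T\<^esub>"
    using I.a_rcos_const unfolding torus_class_def quantum_torus_def FactRing_def by simp
  then have "torus_class q \<epsilon> E f = torus_class q \<epsilon> E g"
    using ring_hom_eq_of_diff[OF torus_class_hom T.ring_axioms fg] by simp
  then show "cls f = cls g"
    by (simp add: cyclic_class_def)
qed

text \<open>The relators contain the products in both orders, so the letter with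
  \<open>False\<close> is a two-sided inverse.\<close>

lemma X_inverse:
  assumes "\<alpha> \<in> E"
  shows "X \<alpha> \<in> Units R" and "inv\<^bsub>R\<^esub> X \<alpha> = cls (free_gen \<alpha> False)"
proof -
  have eq: "cls (free_gen \<alpha> b) \<otimes>\<^bsub>R\<^esub> cls (free_gen \<alpha> (\<not> b)) = \<one>\<^bsub>R\<^esub>" for b
  proof -
    have "cls (free_gen \<alpha> b * free_gen \<alpha> (\<not> b)) = cls 1"
      using assms F.m_closed[OF free_gen_closed free_gen_closed] F.one_closed
      by (intro torus_class_eq) (auto simp: torus_relators_def)
    then show ?thesis
      using ring_hom_mult[OF cls_hom, of "free_gen \<alpha> b" "free_gen \<alpha> (\<not> b)"] ring_hom_one[OF cls_hom] assms
      by (simp add: free_gen_closed)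
  qed
  have closed: "cls (free_gen \<alpha> b) \<in> carrier R" for b
    using assms by (intro ring_hom_closed[OF cls_hom] free_gen_closed)
  show "X \<alpha> \<in> Units R"
    unfolding Units_def using eq[of True] eq[of False] closed by auto
  then show "inv\<^bsub>R\<^esub> X \<alpha> = cls (free_gen \<alpha> False)"
    using eq[of True] eq[of False] closed by (intro R.inv_char) auto
qed

lemma X_commute:
  assumes "\<alpha> \<in> E" "\<beta> \<in> E"
  shows "X \<alpha> \<otimes>\<^bsub>R\<^esub> X \<beta> = q powi (2 * \<epsilon> \<alpha> \<beta>) \<odot>\<^bsub>R\<^esub> (X \<beta> \<otimes>\<^bsub>R\<^esub> X \<alpha>)"
proof -
  have closed: "f * g \<in> carrier F" if "f \<in> carrier F" "g \<in> carrier F" for f g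
    using F.m_closed[OF that] by simp
  have "cls (free_gen \<alpha> True * free_gen \<beta> True) =
      cls (free_scalar (q powi (2 * \<epsilon> \<alpha> \<beta>)) * (free_gen \<beta> True * free_gen \<alpha> True))"
    using assms by (intro torus_class_eq) (auto simp: torus_relators_def intro!: closed free_gen_closed free_scalar_closed)
  then show ?thesis
    using assms ring_hom_mult[OF cls_hom] by (simp add: closed free_gen_closed free_scalar_closed cyclic_torus_simps(6))
qed

lemma X_power:
  assumes "\<alpha> \<in> E"
  shows "X \<alpha> [^]\<^bsub>R\<^esub> N = u \<alpha> ^ N \<odot>\<^bsub>R\<^esub> \<one>\<^bsub>R\<^esub>"
proof -
  define x where "x = torus_class q \<epsilon> E (free_gen \<alpha> True) [^]\<^bsub>T\<^esub> N"
  define y where "y = torus_class q \<epsilon> E (free_scalar (u \<alpha> ^ N))"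
  have xy: "x \<in> carrier T" "y \<in> carrier T"
    using assms ring_hom_closed[OF torus_class_hom] by (simp_all add: x_def y_def free_gen_closed free_scalar_closed)
  have "x \<ominus>\<^bsub>T\<^esub> y \<in> J"
    using assms T.genideal_self[OF cyclic_relators_closed] unfolding cyclic_ideal_def Let_def x_def y_def by blast
  then have zero: "J +>\<^bsub>T\<^esub> (x \<ominus>\<^bsub>T\<^esub> y) = \<zero>\<^bsub>T Quot J\<^esub>"
    using J.a_rcos_const by (simp add: FactRing_def)
  interpret Q: ring "T Quot J"
    by (rule J.quotient_is_ring)
  have "x = (x \<ominus>\<^bsub>T\<^esub> y) \<oplus>\<^bsub>T\<^esub> y"
    using xy by (simp add: T.minus_eq T.a_assoc T.l_neg)
  then have "J +>\<^bsub>T\<^esub> x = (J +>\<^bsub>T\<^esub> (x \<ominus>\<^bsub>T\<^esub> y)) \<oplus>\<^bsub>T Quot J\<^esub> (J +>\<^bsub>T\<^esub> y)"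
    using ring_hom_add[OF J.rcos_ring_hom T.minus_closed[OF xy] xy(2)] by simp
  then have "J +>\<^bsub>T\<^esub> x = J +>\<^bsub>T\<^esub> y"
    using ring_hom_closed[OF J.rcos_ring_hom xy(2)] by (simp add: zero)
  moreover have "J +>\<^bsub>T\<^esub> (t [^]\<^bsub>T\<^esub> n) = (J +>\<^bsub>T\<^esub> t) [^]\<^bsub>R\<^esub> n" if "t \<in> carrier T" for t and n :: nat
  proof (induction n)
    case 0
    then show ?case
      using ring_hom_one[OF J.rcos_ring_hom] by (simp add: cyclic_torus_simps)
  next
    case (Suc n)
    then show ?case
      using ring_hom_mult[OF J.rcos_ring_hom, of "t [^]\<^bsub>T\<^esub> n" t] that by (simp add: cyclic_torus_simps)
  qed
  ultimately have "X \<alpha> [^]\<^bsub>R\<^esub> N = cls (free_scalar (u \<alpha> ^ N))"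
    using assms ring_hom_closed[OF torus_class_hom]
    by (simp add: x_def y_def cyclic_class_def free_gen_closed)
  then show ?thesis
    by (simp add: cls_scalar)
qed

text \<open>The values at inverse letters are forced because algebra maps preserve inverses; words
  and their linear combinations follow.\<close>

lemma alg_hom_eqI:
  assumes S: "complex_algebra S" and \<phi>: "\<phi> \<in> alg_hom R S" and \<psi>: "\<psi> \<in> alg_hom R S"
    and eq: "\<And>\<alpha>. \<alpha> \<in> E \<Longrightarrow> \<phi> (X \<alpha>) = \<psi> (X \<alpha>)" and x: "x \<in> carrier R"
  shows "\<phi> x = \<psi> x"
proof -
  interpret S: complex_algebra S by fact
  have gen: "\<phi> (cls (free_gen \<alpha> b)) = \<psi> (cls (free_gen \<alpha> b))" if "\<alpha> \<in> E" for \<alpha> b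
  proof (cases b)
    case True
    then show ?thesis
      using eq[OF that] by simp
  next
    case False
    show ?thesis
      using alg_hom_inverse(2)[OF \<phi> R.complex_algebra_axioms S X_inverse(1)[OF that]]
        alg_hom_inverse(2)[OF \<psi> R.complex_algebra_axioms S X_inverse(1)[OF that]] False
      unfolding X_inverse(2)[OF that] eq[OF that] by simp
  qed
  have closed: "cls f \<in> carrier R" if "f \<in> carrier F" for f
    using that ring_hom_closed[OF cls_hom] by blast
  have word: "\<phi> (cls (Poly_Mapping.single (Word ls) c)) = \<psi> (cls (Poly_Mapping.single (Word ls) c))"
    if "set ls \<subseteq> E \<times> UNIV" for ls c
    using that
  proof (induction ls)
    case Nil
    have "cls (Poly_Mapping.single (Word []) c) = c \<odot>\<^bsub>R\<^esub> \<one>\<^bsub>R\<^esub>"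
      using cls_scalar[of c] by (simp add: free_scalar_def zero_word_def)
    then show ?case
      by (simp add: alg_hom_simps[OF \<phi>] alg_hom_simps[OF \<psi>])
  next
    case (Cons l ls)
    obtain \<alpha> b where l: "l = (\<alpha>, b)" "\<alpha> \<in> E"
      using Cons.prems by (cases l) auto
    have carr: "free_gen \<alpha> b \<in> carrier F" "Poly_Mapping.single (Word ls) c \<in> carrier F"
      using l Cons.prems by (auto intro!: free_gen_closed single_in_free_algebra[of "Word ls"])
    have "Poly_Mapping.single (Word (l # ls)) c = free_gen \<alpha> b * Poly_Mapping.single (Word ls) c"
      by (simp add: free_gen_def mult_single plus_word_def l)
    then have "cls (Poly_Mapping.single (Word (l # ls)) c) =
        cls (free_gen \<alpha> b) \<otimes>\<^bsub>R\<^esub> cls (Poly_Mapping.single (Word ls) c)"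
      using ring_hom_mult[OF cls_hom carr] by simp
    then show ?case
      using Cons gen[OF l(2)] closed[OF carr(1)] closed[OF carr(2)]
      by (simp add: alg_hom_simps[OF \<phi>] alg_hom_simps[OF \<psi>])
  qed
  obtain f where f: "f \<in> carrier F" "x = cls f"
    using x by (rule cls_surj)
  from f(1) have "\<phi> (cls f) = \<psi> (cls f)"
  proof (induction f rule: free_algebra_induct)
    case (single w c)
    then show ?case
      using word[of "letters w" c] by simp
  next
    case (add f g)
    then show ?case
      using ring_hom_add[OF cls_hom add.hyps(1,2)] closed
      by (simp add: alg_hom_simps[OF \<phi>] alg_hom_simps[OF \<psi>])
  qed
  then show ?thesis
    using f(2) by simp
qed

text \<open>Evaluation of words descends through both quotients, since the relators of each stage
  lie in the kernel, which is an ideal. The images are units so that inverse letters have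
  values.\<close>

lemma alg_hom_exists:
  assumes S: "complex_algebra S" and units: "\<And>\<alpha>. \<alpha> \<in> E \<Longrightarrow> x \<alpha> \<in> Units S"
    and commute: "\<And>\<alpha> \<beta>. \<alpha> \<in> E \<Longrightarrow> \<beta> \<in> E \<Longrightarrow>
      x \<alpha> \<otimes>\<^bsub>S\<^esub> x \<beta> = q powi (2 * \<epsilon> \<alpha> \<beta>) \<odot>\<^bsub>S\<^esub> (x \<beta> \<otimes>\<^bsub>S\<^esub> x \<alpha>)"
    and power: "\<And>\<alpha>. \<alpha> \<in> E \<Longrightarrow> x \<alpha> [^]\<^bsub>S\<^esub> N = u \<alpha> ^ N \<odot>\<^bsub>S\<^esub> \<one>\<^bsub>S\<^esub>"
  shows "\<exists>\<phi> \<in> alg_hom R S. \<forall>\<alpha> \<in> E. \<phi> (X \<alpha>) = x \<alpha>"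
proof -
  interpret S: complex_algebra S by fact
  define g where "g = (\<lambda>(\<alpha>, b). if b then x \<alpha> else inv\<^bsub>S\<^esub> (x \<alpha>))"
  have g: "g l \<in> carrier S" if "l \<in> E \<times> UNIV" for l
    using that units by (auto simp: g_def intro: S.Units_closed)
  define h where "h = S.eval_free g"
  have h: "h \<in> ring_hom F S"
    unfolding h_def using g by (rule S.eval_free_hom)
  have h_gen: "h (free_gen \<alpha> b) = g (\<alpha>, b)" if "\<alpha> \<in> E" for \<alpha> b
    unfolding h_def using g that by (rule S.eval_free_gen)
  have h_scalar: "h (free_scalar c) = c \<odot>\<^bsub>S\<^esub> \<one>\<^bsub>S\<^esub>" for c
    unfolding h_def using g by (rule S.eval_free_scalar)
  interpret h: ring_hom_ring F S h
    using h by (intro ring_hom_ringI2) (auto intro: F.ring_axioms S.ring_axioms)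
  have closed: "f * g \<in> carrier F" if "f \<in> carrier F" "g \<in> carrier F" for f g
    using F.m_closed[OF that] by simp
  have "torus_relators q \<epsilon> E \<subseteq> a_kernel F S h"
  proof
    fix r assume r: "r \<in> torus_relators q \<epsilon> E"
    have "h r = \<zero>\<^bsub>S\<^esub>"
      using r unfolding torus_relators_def
    proof (elim UnE CollectE exE conjE)
      fix \<alpha> b assume \<alpha>: "\<alpha> \<in> E" "r = free_gen \<alpha> b * free_gen \<alpha> (\<not> b) - 1"
      have "h (free_gen \<alpha> b * free_gen \<alpha> (\<not> b)) = h 1"
        using ring_hom_mult[OF h, of "free_gen \<alpha> b" "free_gen \<alpha> (\<not> b)"] ring_hom_one[OF h] units[OF \<alpha>(1)] \<alpha>(1)
        by (simp add: free_gen_closed h_gen g_def)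
      then show "h r = \<zero>\<^bsub>S\<^esub>"
        using \<alpha> F.one_closed by (simp add: ring_hom_eq_of_diff[OF h S.ring_axioms] closed free_gen_closed)
    next
      fix \<alpha> \<beta> assume \<alpha>\<beta>: "\<alpha> \<in> E" "\<beta> \<in> E" "r = free_gen \<alpha> True * free_gen \<beta> True -
          free_scalar (q powi (2 * \<epsilon> \<alpha> \<beta>)) * (free_gen \<beta> True * free_gen \<alpha> True)"
      have carr: "x \<alpha> \<in> carrier S" "x \<beta> \<in> carrier S"
        using \<alpha>\<beta> units by (auto intro: S.Units_closed)
      have "h (free_gen \<alpha> True * free_gen \<beta> True) =
          h (free_scalar (q powi (2 * \<epsilon> \<alpha> \<beta>)) * (free_gen \<beta> True * free_gen \<alpha> True))"
        using ring_hom_mult[OF h] \<alpha>\<beta> carr commute[OF \<alpha>\<beta>(1,2)]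
        by (simp add: closed free_gen_closed free_scalar_closed h_gen h_scalar g_def S.smult_mult_l)
      then show "h r = \<zero>\<^bsub>S\<^esub>"
        using \<alpha>\<beta> by (simp add: ring_hom_eq_of_diff[OF h S.ring_axioms] closed free_gen_closed free_scalar_closed)
    qed
    then show "r \<in> a_kernel F S h"
      using r relators_closed unfolding a_kernel_def' by blast
  qed
  then have "I \<subseteq> a_kernel F S h"
    unfolding torus_ideal_def by (intro F.genideal_minimal h.kernel_is_ideal)
  then have "h r = \<zero>\<^bsub>S\<^esub>" if "r \<in> I" for r
    using that unfolding a_kernel_def' by blast
  from quotient_hom_exists[OF I.ideal_axioms S.ring_axioms h this]
  obtain k where k: "k \<in> ring_hom T S" "\<And>f. f \<in> carrier F \<Longrightarrow> k (torus_class q \<epsilon> E f) = h f"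
    unfolding quantum_torus_def torus_class_def by blast
  interpret k: ring_hom_ring T S k
    using k(1) by (intro ring_hom_ringI2) (auto intro: T.ring_axioms S.ring_axioms)
  have "cyclic_relators \<subseteq> a_kernel T S k"
  proof
    fix r assume "r \<in> cyclic_relators"
    then obtain \<alpha> where \<alpha>: "\<alpha> \<in> E" and r: "r = torus_class q \<epsilon> E (free_gen \<alpha> True) [^]\<^bsub>T\<^esub> N \<ominus>\<^bsub>T\<^esub>
        torus_class q \<epsilon> E (free_scalar (u \<alpha> ^ N))"
      by blast
    have tc: "torus_class q \<epsilon> E f \<in> carrier T" if "f \<in> carrier F" for f
      using that ring_hom_closed[OF torus_class_hom] by blast
    have "k r = x \<alpha> [^]\<^bsub>S\<^esub> N \<ominus>\<^bsub>S\<^esub> u \<alpha> ^ N \<odot>\<^bsub>S\<^esub> \<one>\<^bsub>S\<^esub>"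
      using \<alpha> by (simp add: r a_minus_def tc free_gen_closed free_scalar_closed k.hom_nat_pow k(2) h_gen h_scalar g_def)
    then have "k r = \<zero>\<^bsub>S\<^esub>"
      by (simp add: power[OF \<alpha>] S.minus_eq S.r_neg)
    then show "r \<in> a_kernel T S k"
      using \<open>r \<in> cyclic_relators\<close> cyclic_relators_closed unfolding a_kernel_def' by blast
  qed
  then have "J \<subseteq> a_kernel T S k"
    unfolding cyclic_ideal_def Let_def by (intro T.genideal_minimal k.kernel_is_ideal)
  then have "k r = \<zero>\<^bsub>S\<^esub>" if "r \<in> J" for r
    using that unfolding a_kernel_def' by blast
  from quotient_hom_exists[OF J.ideal_axioms S.ring_axioms k(1) this]
  obtain \<phi> where \<phi>: "\<phi> \<in> ring_hom (T Quot J) S" "\<And>f. f \<in> carrier T \<Longrightarrow> \<phi> (J +>\<^bsub>T\<^esub> f) = k f"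
    by blast
  have \<phi>_cls: "\<phi> (cls f) = h f" if "f \<in> carrier F" for f
    using that \<phi>(2) k(2) ring_hom_closed[OF torus_class_hom] by (simp add: cyclic_class_def)
  have \<phi>_hom: "\<phi> \<in> ring_hom R S"
    using \<phi>(1) unfolding ring_hom_def by (simp add: cyclic_torus_simps)
  have "\<phi> (c \<odot>\<^bsub>R\<^esub> y) = c \<odot>\<^bsub>S\<^esub> \<phi> y" if "y \<in> carrier R" for c y
    using that ring_hom_mult[OF \<phi>_hom, of "cls (free_scalar c)" y] ring_hom_closed[OF \<phi>_hom, of y]
      ring_hom_closed[OF cls_hom, of "free_scalar c"]
    by (simp add: cyclic_torus_simps(6) \<phi>_cls free_scalar_closed h_scalar S.smult_mult_l)
  then have "\<phi> \<in> alg_hom R S"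
    using \<phi>_hom by (simp add: alg_hom_def)
  moreover have "\<phi> (X \<alpha>) = x \<alpha>" if "\<alpha> \<in> E" for \<alpha>
    using that by (simp add: \<phi>_cls free_gen_closed h_gen g_def)
  ultimately show ?thesis
    by blast
qed

end

section \<open>Functional calculus\<close>

lemma (in abelian_monoid) finsum_swap:
  assumes "finite A" "finite B" and "\<And>i j. i \<in> A \<Longrightarrow> j \<in> B \<Longrightarrow> f i j \<in> carrier G"
  shows "(\<Oplus>i \<in> A. \<Oplus>j \<in> B. f i j) = (\<Oplus>j \<in> B. \<Oplus>i \<in> A. f i j)"
  using assms(1,3)
proof (induction A rule: finite_induct)
  case (insert a A)
  have closed: "(\<Oplus>i \<in> A. f i j) \<in> carrier G" if "j \<in> B" for j
    using insert.prems that by (intro finsum_closed) auto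
  have "(\<Oplus>i \<in> insert a A. \<Oplus>j \<in> B. f i j) = (\<Oplus>j \<in> B. f a j) \<oplus> (\<Oplus>i \<in> A. \<Oplus>j \<in> B. f i j)"
    using insert by (intro finsum_insert) (auto intro!: finsum_closed)
  also have "\<dots> = (\<Oplus>j \<in> B. f a j) \<oplus> (\<Oplus>j \<in> B. \<Oplus>i \<in> A. f i j)"
    using insert by simp
  also have "\<dots> = (\<Oplus>j \<in> B. f a j \<oplus> (\<Oplus>i \<in> A. f i j))"
    using insert.prems closed by (intro finsum_addf[symmetric]) auto
  also have "\<dots> = (\<Oplus>j \<in> B. \<Oplus>i \<in> insert a A. f i j)"
    using insert by (intro finsum_cong') (auto intro!: finsum_insert[symmetric] finsum_closed)
  finally show ?case .
qed simp

lemma (in abelian_monoid) finsum_lessThan_shift: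
  assumes "\<And>j. f j \<in> carrier G"
  shows "(\<Oplus>j \<in> {..<n}. f (Suc j)) \<oplus> f 0 = (\<Oplus>j \<in> {..<Suc n}. f (j::nat))"
proof (induction n)
  case (Suc n)
  have closed: "(\<Oplus>j \<in> {..<n}. f (Suc j)) \<in> carrier G" "(\<Oplus>j \<in> {..<Suc n}. f j) \<in> carrier G"
    using assms by (auto intro!: finsum_closed)
  have "(\<Oplus>j \<in> {..<Suc n}. f (Suc j)) \<oplus> f 0 = f (Suc n) \<oplus> (\<Oplus>j \<in> {..<n}. f (Suc j)) \<oplus> f 0"
    unfolding lessThan_Suc[of n] using assms by (subst finsum_insert) auto
  also have "\<dots> = f (Suc n) \<oplus> (\<Oplus>j \<in> {..<Suc n}. f j)"
    using assms closed Suc by (simp add: a_assoc)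
  also have "\<dots> = (\<Oplus>j \<in> {..<Suc (Suc n)}. f j)"
    unfolding lessThan_Suc[of "Suc n"] using assms by (intro finsum_insert[symmetric]) auto
  finally show ?case .
qed (use assms in \<open>simp add: lessThan_Suc\<close>)

context root_of_unity
begin

lemma sum_root_powers:
  fixes r :: complex
  assumes "r ^ N = 1"
  shows "(\<Sum>j<N. r ^ j) = (if r = 1 then of_nat N else 0)"
  using assms by (cases "r = 1") (simp_all add: geometric_sum)

end

section \<open>Spectral decomposition with respect to an element whose N-th power is 1\<close>

locale cyclic_calculus = complex_algebra R + root_of_unity N q
  for R :: "(complex, 'x) module" (structure) and N :: nat and q :: complex
begin

context
  fixes x :: 'x
  assumes x_closed [simp]: "x \<in> carrier R" and x_power: "x [^] N = \<one>"
begin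

private abbreviation "e \<equiv> eigenprojector R N q x"
private abbreviation "fc f \<equiv> functional_calculus R N q f x"

lemma eigenprojector_closed [simp]: "e k \<in> carrier R"
  unfolding eigenprojector_def by (intro finsum_closed) auto

lemma calculus_closed [simp]: "fc f \<in> carrier R"
  unfolding functional_calculus_def by (intro finsum_closed) auto

lemma x_Units: "x \<in> Units R"
proof -
  have "x [^] N = x [^] (N - 1) \<otimes> x" "x [^] N = x \<otimes> x [^] (N - 1)"
    using N_pos by (metis Suc_pred' nat_pow_Suc, metis Suc_pred' nat_pow_Suc2 x_closed)
  then show ?thesis
    unfolding Units_def using x_power by (auto intro!: bexI[of _ "x [^] (N - 1)"])
qed

lemma eigen_nat_pow:
  assumes v: "v \<in> carrier R" and eigen: "x \<otimes> v = r \<odot> v"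
  shows "x [^] (j::nat) \<otimes> v = r ^ j \<odot> v"
  by (induction j) (use v in \<open>simp_all add: m_assoc eigen smult_mult_r smult_smult mult.commute\<close>)

text \<open>Orthogonality of characters: on an eigenvector the projector acts as the average of the
  powers of \<open>r / q ^ (2 * k)\<close>, a geometric sum.\<close>

lemma eigenprojector_eigen:
  assumes v: "v \<in> carrier R" and eigen: "x \<otimes> v = r \<odot> v" and r: "r ^ N = 1"
  shows "e k \<otimes> v = (if r = q ^ (2 * k) then v else \<zero>)"
proof -
  have "e k \<otimes> v = (\<Oplus>j \<in> {..<N}. ((q powi (- 2 * int k * int j) / of_nat N) \<odot> x [^] j) \<otimes> v)"
    unfolding eigenprojector_def using v by (intro finsum_ldistr) auto
  also have "\<dots> = (\<Oplus>j \<in> {..<N}. (q powi (- 2 * int k * int j) / of_nat N * r ^ j) \<odot> v)"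
    using v by (intro finsum_cong') (auto simp: smult_mult_l smult_smult eigen_nat_pow[OF v eigen])
  also have "\<dots> = (\<Sum>j<N. q powi (- 2 * int k * int j) / of_nat N * r ^ j) \<odot> v"
    using v by (rule finsum_smult)
  also have "(\<Sum>j<N. q powi (- 2 * int k * int j) / of_nat N * r ^ j) =
      (\<Sum>j<N. (r / q ^ (2 * k)) ^ j) / of_nat N"
  proof -
    have "q powi (- 2 * int k * int j) = inverse (q ^ (2 * k)) ^ j" for j
    proof -
      have "q powi (- 2 * int k * int j) = (q powi (- int (2 * k))) powi int j"
        unfolding power_int_mult[symmetric] by simp
      then show ?thesis
        by (simp only: power_int_minus power_int_of_nat)
    qed
    then show ?thesis
      unfolding sum_divide_distrib by (intro sum.cong) (simp_all add: power_divide field_simps)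
  qed
  also have "\<dots> = (if r = q ^ (2 * k) then 1 else 0)"
    using N_pos r by (subst sum_root_powers) (auto simp: power_divide)
  finally show ?thesis
    using v by simp
qed

text \<open>Multiplication by \<open>x\<close> shifts the summation index by one, up to the
  eigenvalue. The summand has period N, so the shifted sum over a full period is the old
  one.\<close>

lemma eigen_eigenprojector: "x \<otimes> e k = q ^ (2 * k) \<odot> e k"
proof -
  define G where "G j = (q powi (- 2 * int k * int j) / of_nat N) \<odot> x [^] j" for j :: nat
  have G: "G j \<in> carrier R" for j
    by (simp add: G_def)
  have "q powi (- 2 * int k * int N) = (q powi (- 2 * int k)) ^ N"
    by (simp only: power_int_mult power_int_of_nat)
  then have G_N: "G N = G 0"
    using q_powi_N[of "- 2 * int k"] by (simp add: G_def x_power)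
  have shift: "x \<otimes> G j = q ^ (2 * k) \<odot> G (Suc j)" for j
  proof -
    have "q powi (- 2 * int k * int j) = q ^ (2 * k) * q powi (- 2 * int k * int (Suc j))"
      unfolding power_int_of_nat[symmetric] by (subst power_int_add[symmetric]) (simp_all add: algebra_simps)
    then show ?thesis
      using nat_pow_Suc2[of x j] by (simp add: G_def smult_mult_r smult_smult)
  qed
  have closed: "(\<Oplus>j \<in> {..<N}. G (Suc j)) \<in> carrier R" "(\<Oplus>j \<in> {..<N}. G j) \<in> carrier R"
    using G by (auto intro!: finsum_closed)
  have "(\<Oplus>j \<in> {..<N}. G (Suc j)) \<oplus> G 0 = G N \<oplus> (\<Oplus>j \<in> {..<N}. G j)"
    unfolding finsum_lessThan_shift[of G, OF G] lessThan_Suc[of N] using G by (intro finsum_insert) auto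
  then have cyclic: "(\<Oplus>j \<in> {..<N}. G (Suc j)) = (\<Oplus>j \<in> {..<N}. G j)"
    using G closed by (simp add: G_N a_comm[of "G 0"])
  have "x \<otimes> e k = (\<Oplus>j \<in> {..<N}. x \<otimes> G j)"
    unfolding eigenprojector_def G_def[symmetric] using G by (intro finsum_rdistr) auto
  also have "\<dots> = q ^ (2 * k) \<odot> (\<Oplus>j \<in> {..<N}. G (Suc j))"
    using G unfolding shift by (intro smult_finsum[symmetric]) auto
  finally show ?thesis
    unfolding cyclic unfolding eigenprojector_def G_def .
qed

text \<open>After interchanging the sums, the sum over \<open>k\<close> kills every power of
  \<open>x\<close> except \<open>j = 0\<close>; this is where primitivity of \<open>q^2\<close>
  enters.\<close>

lemma finsum_eigenprojector: "(\<Oplus>k \<in> {..<N}. e k) = \<one>"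
proof -
  define c where "c k j = q powi (- 2 * int k * int j) / of_nat N" for k j :: nat
  have sum: "(\<Sum>k<N. c k j) = (if j = 0 then 1 else 0)" if "j < N" for j
  proof -
    have "c k j = inverse (q ^ (2 * j)) ^ k / of_nat N" for k
    proof -
      have "q powi (- 2 * int k * int j) = (q powi (- int (2 * j))) powi int k"
        unfolding power_int_mult[symmetric] by (simp add: mult_ac)
      then show ?thesis
        unfolding c_def by (simp only: power_int_minus power_int_of_nat)
    qed
    then have "(\<Sum>k<N. c k j) = (\<Sum>k<N. inverse (q ^ (2 * j)) ^ k) / of_nat N"
      by (simp add: sum_divide_distrib)
    also have "\<dots> = (if j = 0 then 1 else 0)"
      using N_pos primitive[of j] that by (subst sum_root_powers) (auto simp: power_inverse inverse_eq_1_iff)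
    finally show ?thesis .
  qed
  have "(\<Oplus>k \<in> {..<N}. e k) = (\<Oplus>j \<in> {..<N}. \<Oplus>k \<in> {..<N}. c k j \<odot> x [^] j)"
    unfolding eigenprojector_def c_def by (rule finsum_swap) auto
  also have "\<dots> = (\<Oplus>j \<in> {..<N}. if 0 = j then \<one> else \<zero>)"
    by (intro finsum_cong') (auto simp: finsum_smult sum)
  also have "\<dots> = \<one>"
    using N_pos by (subst finsum_singleton) auto
  finally show ?thesis .
qed

text \<open>Every identity below is checked on the eigenvectors \<open>e k\<close>.\<close>

lemma eqI_eigenprojector:
  assumes "u \<in> carrier R" "w \<in> carrier R" and "\<And>k. k < N \<Longrightarrow> u \<otimes> e k = w \<otimes> e k"
  shows "u = w"
proof -
  have resolution: "v = (\<Oplus>k \<in> {..<N}. v \<otimes> e k)" if "v \<in> carrier R" for v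
    using that finsum_rdistr[of "{..<N}" v e] by (simp add: finsum_eigenprojector)
  have "(\<Oplus>k \<in> {..<N}. u \<otimes> e k) = (\<Oplus>k \<in> {..<N}. w \<otimes> e k)"
    using assms by (intro finsum_cong') auto
  then show ?thesis
    using resolution[OF assms(1)] resolution[OF assms(2)] by simp
qed

lemma calculus_eigen:
  assumes v: "v \<in> carrier R" and eigen: "x \<otimes> v = r \<odot> v" and r: "r ^ N = 1"
  shows "fc f \<otimes> v = f r \<odot> v"
proof -
  obtain m where m: "m < N" "r = q ^ (2 * m)"
    using root_cases[OF r] .
  have "fc f \<otimes> v = (\<Oplus>k \<in> {..<N}. (f (q ^ (2 * k)) \<odot> e k) \<otimes> v)"
    unfolding functional_calculus_def using v by (intro finsum_ldistr) auto
  also have "\<dots> = (\<Oplus>k \<in> {..<N}. if m = k then f r \<odot> v else \<zero>)"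
  proof (intro finsum_cong')
    fix k assume "k \<in> {..<N}"
    then have "q ^ (2 * m) = q ^ (2 * k) \<longleftrightarrow> m = k"
      using inj_on_q_power m(1) by (auto dest!: inj_onD)
    then show "(f (q ^ (2 * k)) \<odot> e k) \<otimes> v = (if m = k then f r \<odot> v else \<zero>)"
      using v m(2) by (simp add: smult_mult_l eigenprojector_eigen[OF v eigen r])
  qed (use v in auto)
  also have "\<dots> = f r \<odot> v"
    using v m(1) by (subst finsum_singleton) auto
  finally show ?thesis .
qed

lemma calculus_eigenprojector: "fc f \<otimes> e k = f (q ^ (2 * k)) \<odot> e k"
  by (intro calculus_eigen eigenprojector_closed eigen_eigenprojector) simp

section \<open>Functions of \<open>x\<close> as a commutative algebra\<close>

lemma calculus_eqI:
  assumes "u \<in> carrier R" and "\<And>k. u \<otimes> e k = f (q ^ (2 * k)) \<odot> e k"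
  shows "u = fc f"
  by (rule eqI_eigenprojector) (use assms in \<open>simp_all add: calculus_eigenprojector\<close>)

lemma calculus_cong:
  assumes "\<And>z. z ^ N = 1 \<Longrightarrow> f z = g z"
  shows "fc f = fc g"
  by (intro calculus_eqI) (simp_all add: calculus_eigenprojector assms)

lemma calculus_mult: "fc f \<otimes> fc g = fc (\<lambda>z. f z * g z)"
  by (intro calculus_eqI)
     (simp_all add: m_assoc calculus_eigenprojector smult_mult_r smult_smult mult.commute)

lemma calculus_affine: "a \<odot> \<one> \<oplus> b \<odot> fc f = fc (\<lambda>z. a + b * f z)"
  by (intro calculus_eqI)
     (simp_all add: l_distr calculus_eigenprojector smult_mult_l smult_smult smult_l_distr)

lemma calculus_smult: "b \<odot> fc f = fc (\<lambda>z. b * f z)"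
  by (intro calculus_eqI) (simp_all add: calculus_eigenprojector smult_mult_l smult_smult)

lemma calculus_one: "fc (\<lambda>z. 1) = \<one>"
  by (intro calculus_eqI[symmetric]) simp_all

lemma calculus_id: "fc (\<lambda>z. z) = x"
  by (intro calculus_eqI[symmetric]) (simp_all add: eigen_eigenprojector)

lemma calculus_Units:
  assumes "\<And>z. z ^ N = 1 \<Longrightarrow> f z \<noteq> 0"
  shows "fc f \<in> Units R" and "inv (fc f) = fc (\<lambda>z. inverse (f z))"
proof -
  have inv: "fc f \<otimes> fc (\<lambda>z. inverse (f z)) = \<one>" "fc (\<lambda>z. inverse (f z)) \<otimes> fc f = \<one>"
    unfolding calculus_mult calculus_one[symmetric]
    using assms by (auto intro!: calculus_cong)
  then show "fc f \<in> Units R"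
    unfolding Units_def by (auto intro!: bexI[of _ "fc (\<lambda>z. inverse (f z))"])
  then show "inv (fc f) = fc (\<lambda>z. inverse (f z))"
    using inv by (intro inv_char) auto
qed

lemma calculus_nat_pow: "fc f [^] (n::nat) = fc (\<lambda>z. f z ^ n)"
  by (induction n) (simp_all add: calculus_one calculus_mult mult.commute)

text \<open>Left multiplication by \<open>y\<close> sends an eigenvector of \<open>x\<close> with
  eigenvalue \<open>z\<close> to one with eigenvalue \<open>q powi (2 * a) * z\<close>.\<close>

lemma calculus_commute:
  assumes y: "y \<in> carrier R" and xy: "x \<otimes> y = q powi (2 * a) \<odot> (y \<otimes> x)"
  shows "fc f \<otimes> y = y \<otimes> fc (\<lambda>z. f (q powi (2 * a) * z))"
proof (rule eqI_eigenprojector)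
  fix k
  have "x \<otimes> (y \<otimes> e k) = (q powi (2 * a) * q ^ (2 * k)) \<odot> (y \<otimes> e k)"
    using y by (simp add: xy smult_mult_l smult_mult_r smult_smult eigen_eigenprojector m_assoc flip: m_assoc[of x])
  then have "fc f \<otimes> (y \<otimes> e k) = f (q powi (2 * a) * q ^ (2 * k)) \<odot> (y \<otimes> e k)"
    using y by (intro calculus_eigen) (simp_all add: power_mult_distrib q_powi_N)
  then show "fc f \<otimes> y \<otimes> e k = y \<otimes> fc (\<lambda>z. f (q powi (2 * a) * z)) \<otimes> e k"
    using y by (simp add: m_assoc calculus_eigenprojector smult_mult_r)
qed (use y in auto)

lemma Ad_functional_calculus:
  assumes f: "\<And>z. z ^ N = 1 \<Longrightarrow> f z \<noteq> 0"
    and y: "y \<in> carrier R" and xy: "x \<otimes> y = q powi (2 * a) \<odot> (y \<otimes> x)"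
  shows "Ad R (fc f) y = y \<otimes> fc (\<lambda>z. f (q powi (2 * a) * z) / f z)"
  unfolding Ad_def calculus_commute[OF y xy]
  using y f by (simp add: calculus_Units m_assoc calculus_mult divide_inverse)

lemma inv_power: "inv x [^] N = \<one>"
proof -
  have "inv x [^] N \<otimes> x [^] N = \<one>"
    using x_Units by (simp add: pow_mult_distrib[symmetric])
  then show ?thesis
    using x_Units by (simp add: x_power)
qed

end

text \<open>The projectors of \<open>x\<close> also consist of eigenvectors of \<open>inv x\<close>,
  with inverse eigenvalues. This brings the dilogarithm at the inverse variable, which occurs for
  the negative sign, into the calculus of \<open>x\<close>.\<close>

lemma calculus_inverse:
  assumes "x \<in> carrier R" and "x [^] N = \<one>"
  shows "functional_calculus R N q f (inv x) = functional_calculus R N q (\<lambda>z. f (inverse z)) x"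
proof (rule calculus_eqI[OF assms])
  have inv: "inv x \<in> carrier R" "inv x [^] N = \<one>"
    using x_Units[OF assms] inv_power[OF assms] by simp_all
  then show "functional_calculus R N q f (inv x) \<in> carrier R"
    by (rule calculus_closed)
  fix k
  let ?e = "eigenprojector R N q x k"
  have e: "?e \<in> carrier R"
    using assms by (rule eigenprojector_closed)
  have "?e = inv x \<otimes> (x \<otimes> ?e)"
    using e x_Units[OF assms] assms(1) by (simp flip: m_assoc)
  also have "\<dots> = q ^ (2 * k) \<odot> (inv x \<otimes> ?e)"
    using e inv(1) by (simp add: eigen_eigenprojector[OF assms] smult_mult_r)
  finally have "inverse (q ^ (2 * k)) \<odot> ?e = inverse (q ^ (2 * k)) \<odot> (q ^ (2 * k) \<odot> (inv x \<otimes> ?e))"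
    by simp
  then have "inv x \<otimes> ?e = inverse (q ^ (2 * k)) \<odot> ?e"
    using e inv(1) by (simp add: smult_smult)
  then show "functional_calculus R N q f (inv x) \<otimes> ?e = f (inverse (q ^ (2 * k))) \<odot> ?e"
    using e by (intro calculus_eigen inv) (simp_all add: power_inverse)
qed

end

section \<open>Mutation factors\<close>

context root_of_unity
begin

text \<open>As N is odd, \<open>(N + 1) div 2\<close> inverts 2 modulo N, so \<open>q powi a\<close>
  is a power of \<open>q powi (2 * a)\<close>. Hence the scalar of a Weyl bracket is determined by
  the commutation factor.\<close>

lemma q_powi_double_cancel: "q powi (2 * a) = q powi (2 * b) \<Longrightarrow> q powi a = q powi b"
proof -
  have half: "q powi a = (q powi (2 * a)) ^ ((N + 1) div 2)" for a
  proof -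
    have "2 * ((N + 1) div 2) = N + 1"
      using odd_N by presburger
    then have "2 * int ((N + 1) div 2) = int N + 1"
      by linarith
    then have "2 * a * int ((N + 1) div 2) = a * int N + a"
      by (metis distrib_left mult.assoc mult.commute mult.right_neutral)
    then have "(q powi (2 * a)) ^ ((N + 1) div 2) = (q powi a) ^ N * q powi a"
      unfolding power_int_of_nat[symmetric] power_int_mult[symmetric] by (simp add: power_int_add)
    then show ?thesis
      by (simp add: q_powi_N)
  qed
  assume "q powi (2 * a) = q powi (2 * b)"
  then show ?thesis
    using half[of a] half[of b] by simp
qed

text \<open>The mutation rule multiplies the rescaled variable of \<open>\<alpha>\<close> by this function of that of \<open>\<kappa>\<close>,
  for \<open>n = \<epsilon>\<^sub>\<alpha>\<^sub>\<kappa>\<close>.\<close>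

definition mutation_factor :: "complex \<Rightarrow> complex \<Rightarrow> int \<Rightarrow> complex \<Rightarrow> complex" where
  "mutation_factor a b n z =
     (if n < 0 then \<Prod>j=1..nat (- n). b + q powi (2 * int j - 1) * a * z
      else \<Prod>j=1..nat n. inverse (a + q powi (2 * int j - 1) * b * inverse z))"

text \<open>The surplus power of \<open>q\<close> is absorbed into \<open>z\<close>, which stays an
  N-th root of unity.\<close>

lemma factor_nonzero:
  assumes "a ^ N + b ^ N = 1" and "z ^ N = 1"
  shows "b + q powi k * a * z \<noteq> 0"
proof -
  have "q * q powi (k - 1) = q powi k"
    using power_int_add[of q 1 "k - 1"] by simp
  then have "b + q powi k * a * z = b + q * a * (q powi (k - 1) * z)"
    by (metis mult.assoc mult.commute)
  moreover have "b + q * a * (q powi (k - 1) * z) \<noteq> 0"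
    by (intro linear_form_nonzero assms) (simp add: power_mult_distrib q_powi_N assms(2))
  ultimately show ?thesis
    by metis
qed

text \<open>For \<open>n < 0\<close> the monomial factor is 1 and the recursion is iterated
  forwards. For \<open>n \<ge> 0\<close> it runs backwards, and the i-th step divides by
  \<open>q powi (1 - 2 * i) * z\<close> times the i-th factor of the mutation rule; the monomial
  factor cancels exactly these prefactors.\<close>

lemma mutation_factor_pos:
  fixes f :: "complex \<Rightarrow> complex"
  assumes ab: "a ^ N + b ^ N = 1" and f: "\<And>z. z ^ N = 1 \<Longrightarrow> f z \<noteq> 0"
    and step: "\<And>z. z ^ N = 1 \<Longrightarrow> f (q\<^sup>2 * z) = (b + q * a * z) * f z"
    and z: "z ^ N = 1"
  shows "f (q powi (2 * - n) * z) / f z * (q powi (- (n * max n 0)) * z ^ nat (max n 0)) = mutation_factor a b n z"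
proof (cases "n < 0")
  case True
  have "f (q ^ (2 * k) * z) = (\<Prod>j=1..k. b + q powi (2 * int j - 1) * a * z) * f z" for k
  proof (induction k)
    case (Suc k)
    have "f (q\<^sup>2 * (q ^ (2 * k) * z)) = (b + q * a * (q ^ (2 * k) * z)) * f (q ^ (2 * k) * z)"
      by (rule step) (simp add: power_mult_distrib z)
    moreover have "q powi (2 * int (Suc k) - 1) = q * q ^ (2 * k)"
      using power_int_of_nat[of q "2 * k + 1"] by (simp add: algebra_simps)
    ultimately show ?case
      using Suc by (simp add: power2_eq_square mult_ac)
  qed simp
  moreover define k where "k = nat (- n)"
  then have n: "n = - int k" and "k > 0"
    using True by simp_all
  ultimately show ?thesis
    using f[OF z] power_int_of_nat[of q "2 * k"] by (simp add: mutation_factor_def n)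
next
  case False
  have "f (q powi (- 2 * int k) * z) * (q powi (- (int k * int k)) * z ^ k) =
      (\<Prod>j=1..k. inverse (a + q powi (2 * int j - 1) * b * inverse z)) * f z" for k
  proof (induction k)
    case (Suc k)
    let ?G = "a + q powi (2 * int (Suc k) - 1) * b * inverse z"
    define w where "w = q powi (- 2 * int (Suc k)) * z"
    have w: "w ^ N = 1" "q\<^sup>2 * w = q powi (- 2 * int k) * z"
      using power_int_add[of q 2 "- 2 * int (Suc k)"]
      by (simp_all add: w_def power_mult_distrib q_powi_N z algebra_simps)
    have z0: "z \<noteq> 0"
      using z N_pos by (auto simp: power_0_left)
    have "q * a * w = q powi (1 - 2 * int (Suc k)) * a * z"
      using power_int_add[of q 1 "- 2 * int (Suc k)"] by (simp add: w_def algebra_simps)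
    moreover have "q powi (1 - 2 * int (Suc k)) * q powi (2 * int (Suc k) - 1) = 1"
      by (simp flip: power_int_add)
    ultimately have "b + q * a * w =
        q powi (1 - 2 * int (Suc k)) * z * ?G"
      using z0 by (simp add: field_simps)
    then have "f (q\<^sup>2 * w) = q powi (1 - 2 * int (Suc k)) * z * ?G * f w"
      using step[OF w(1)] by simp
    moreover have "?G \<noteq> 0"
      using factor_nonzero[of b a "inverse z"] ab z by (simp add: add.commute power_inverse)
    ultimately have fw: "q powi (1 - 2 * int (Suc k)) * z * f w = inverse ?G * f (q\<^sup>2 * w)"
      by (simp add: field_simps)
    \<comment> \<open>The exponents \<open>1 - 2 * i\<close> add up to minus a square, the Weyl
      scalar of the monomial.\<close>
    have "q powi (- (int (Suc k) * int (Suc k))) = q powi (1 - 2 * int (Suc k)) * q powi (- (int k * int k))"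
      by (simp add: algebra_simps flip: power_int_add)
    then have "f w * (q powi (- (int (Suc k) * int (Suc k))) * z ^ Suc k) =
        (q powi (1 - 2 * int (Suc k)) * z * f w) * (q powi (- (int k * int k)) * z ^ k)"
      by simp
    also have "\<dots> = inverse ?G *
        (f (q powi (- 2 * int k) * z) * (q powi (- (int k * int k)) * z ^ k))"
      unfolding fw w(2) by (simp only: mult_ac)
    finally show ?case
      unfolding Suc w_def by (simp add: mult_ac)
  qed simp
  from this[of "nat n"] show ?thesis
    using False f[OF z] by (simp add: mutation_factor_def field_simps)
qed

text \<open>Intended for \<open>f z = 1 / \<Psi> (1 / z)\<close> with swapped parameters, whose
  recursion carries the additional factor \<open>1 / (q * z)\<close>. Backward steps now yield the
  factors of the mutation rule directly, while forward steps leave the factors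
  \<open>1 / (q * q ^ (2 * i) * z)\<close>, whose product is cancelled by
  \<open>q ^ (k * k) * z ^ k\<close>.\<close>

lemma mutation_factor_neg:
  fixes f :: "complex \<Rightarrow> complex"
  assumes ab: "a ^ N + b ^ N = 1" and f: "\<And>z. z ^ N = 1 \<Longrightarrow> f z \<noteq> 0"
    and step: "\<And>z. z ^ N = 1 \<Longrightarrow> f (q\<^sup>2 * z) = inverse (q * z) * (b + q * a * z) * f z"
    and z: "z ^ N = 1"
  shows "f (q powi (2 * - n) * z) / f z * (q powi (- (n * max (- n) 0)) * z ^ nat (max (- n) 0)) = mutation_factor a b n z"
proof (cases "n < 0")
  case True
  have z0: "z \<noteq> 0"
    using z N_pos by (auto simp: power_0_left)
  have step': "f (q\<^sup>2 * w) * (q * w) = (b + q * a * w) * f w" if "w ^ N = 1" for w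
  proof -
    have "w \<noteq> 0"
      using that N_pos by (auto simp: power_0_left)
    then show ?thesis
      using step[OF that] by (simp add: field_simps)
  qed
  have "f (q ^ (2 * k) * z) * (q ^ (k * k) * z ^ k) = (\<Prod>j=1..k. b + q powi (2 * int j - 1) * a * z) * f z" for k
  proof (induction k)
    case (Suc k)
    have "f (q\<^sup>2 * (q ^ (2 * k) * z)) * (q * (q ^ (2 * k) * z)) = (b + q * a * (q ^ (2 * k) * z)) * f (q ^ (2 * k) * z)"
      by (rule step') (simp add: power_mult_distrib z)
    moreover have "q powi (2 * int (Suc k) - 1) = q * q ^ (2 * k)"
      using power_int_of_nat[of q "2 * k + 1"] by (simp add: algebra_simps)
    moreover have "Suc k * Suc k = 1 + (2 * k + k * k)"
      by simp
    then have "q ^ (Suc k * Suc k) = q * (q ^ (2 * k) * q ^ (k * k))"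
      by (simp only: power_add power_one_right)
    moreover have "q ^ (2 * Suc k) * z = q\<^sup>2 * (q ^ (2 * k) * z)"
      by (simp add: power2_eq_square mult_ac)
    ultimately have "f (q ^ (2 * Suc k) * z) * (q * (q ^ (2 * k) * z)) =
        (b + q powi (2 * int (Suc k) - 1) * a * z) * f (q ^ (2 * k) * z)"
      by (simp only: mult_ac)
    then have shift: "f (q ^ (2 * Suc k) * z) * (q * (q ^ (2 * k) * z)) * (q ^ (k * k) * z ^ k) =
        (b + q powi (2 * int (Suc k) - 1) * a * z) * (f (q ^ (2 * k) * z) * (q ^ (k * k) * z ^ k))"
      by (simp only: mult.assoc)
    have "f (q ^ (2 * Suc k) * z) * (q ^ (Suc k * Suc k) * z ^ Suc k) =
        f (q ^ (2 * Suc k) * z) * (q * (q ^ (2 * k) * z)) * (q ^ (k * k) * z ^ k)"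
      unfolding \<open>q ^ (Suc k * Suc k) = _\<close> power_Suc[of z] by (simp only: mult_ac)
    also note shift
    finally have "f (q ^ (2 * Suc k) * z) * (q ^ (Suc k * Suc k) * z ^ Suc k) =
        (b + q powi (2 * int (Suc k) - 1) * a * z) * (f (q ^ (2 * k) * z) * (q ^ (k * k) * z ^ k))" .
    then show ?case
      unfolding Suc by (simp add: mult_ac)
  qed simp
  moreover define k where "k = nat (- n)"
  then have n: "n = - int k" and "k > 0"
    using True by simp_all
  moreover have "q powi (int k * int k) = q ^ (k * k)" "q powi (2 * int k) = q ^ (2 * k)"
    using power_int_of_nat[of q "k * k"] power_int_of_nat[of q "2 * k"] by simp_all
  ultimately show ?thesis
    using f[OF z] by (simp add: mutation_factor_def n field_simps)
next
  case False
  have "f (q powi (- 2 * int k) * z) =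
      (\<Prod>j=1..k. inverse (a + q powi (2 * int j - 1) * b * inverse z)) * f z" for k
  proof (induction k)
    case (Suc k)
    let ?G = "a + q powi (2 * int (Suc k) - 1) * b * inverse z"
    define w where "w = q powi (- 2 * int (Suc k)) * z"
    have w: "w ^ N = 1" "q\<^sup>2 * w = q powi (- 2 * int k) * z"
      using power_int_add[of q 2 "- 2 * int (Suc k)"]
      by (simp_all add: w_def power_mult_distrib q_powi_N z algebra_simps)
    then have w0: "w \<noteq> 0"
      using N_pos by (auto simp: power_0_left)
    have "q * w = q powi (- (2 * int (Suc k) - 1)) * z"
      using power_int_add[of q 1 "- 2 * int (Suc k)"] by (simp add: w_def algebra_simps)
    then have "inverse (q * w) = q powi (2 * int (Suc k) - 1) * inverse z"
      unfolding power_int_minus by simp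
    then have "inverse (q * w) * (b + q * a * w) = ?G"
      using w0 by (simp add: field_simps)
    then have "f (q\<^sup>2 * w) = ?G * f w"
      using step[OF w(1)] by simp
    moreover have "?G \<noteq> 0"
      using factor_nonzero[of b a "inverse z"] ab z by (simp add: add.commute power_inverse)
    ultimately have "f w = inverse ?G * f (q\<^sup>2 * w)"
      by (simp add: field_simps)
    then show ?case
      unfolding w(2) Suc unfolding w_def by (simp add: mult_ac)
  qed simp
  from this[of "nat n"] show ?thesis
    using False f[OF z] by (simp add: mutation_factor_def)
qed

text \<open>Partial products of the linear forms solve the recursion. The mutation map is thus
  obtained without choosing a path or a branch.\<close>

lemma dilog_function_exists:
  assumes ab: "a ^ N + b ^ N = 1"
  shows "\<exists>f. \<forall>z. z ^ N = 1 \<longrightarrow> f z \<noteq> 0 \<and> f (q\<^sup>2 * z) = (b + q * a * z) * f z"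
proof -
  define P where "P k = (\<Prod>j<k. b + q ^ (2 * j + 1) * a)" for k
  define f where "f z = P (THE k. k < N \<and> z = q ^ (2 * k))" for z
  have f: "f (q ^ (2 * k)) = P k" if "k < N" for k
  proof -
    have "(THE l. l < N \<and> q ^ (2 * k) = q ^ (2 * l)) = k"
      using that inj_on_q_power by (intro the_equality) (auto dest: inj_onD)
    then show ?thesis
      by (simp add: f_def)
  qed
  \<comment> \<open>The recursion on a cyclic group is consistent once a full turn multiplies by
    1.\<close>
  have P_N: "P N = P 0"
    using prod_linear_forms[of b a] ab by (simp add: P_def)
  have "f z \<noteq> 0 \<and> f (q\<^sup>2 * z) = (b + q * a * z) * f z" if z: "z ^ N = 1" for z
  proof -
    obtain k where k: "k < N" "z = q ^ (2 * k)"
      using root_cases[OF z] .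
    have "b + q ^ (2 * j + 1) * a \<noteq> 0" for j
      using linear_form_nonzero[OF ab, of "q ^ (2 * j)"] by (simp add: mult_ac)
    then have "f z \<noteq> 0"
      unfolding k(2) f[OF k(1)] P_def by (simp add: prod_zero_iff)
    moreover have "f (q\<^sup>2 * z) = P (Suc k)"
    proof (cases "Suc k < N")
      case True
      then show ?thesis
        using f[of "Suc k"] by (simp add: k(2) power2_eq_square mult.assoc)
    next
      case False
      then have "Suc k = N"
        using k(1) by simp
      moreover have "q\<^sup>2 * z = q ^ (2 * Suc k)"
        by (simp add: k(2) power2_eq_square mult.assoc)
      ultimately have "q\<^sup>2 * z = q ^ (2 * 0)"
        using q_power_N(2)[of 2] by (simp only: mult_0_right power_0)
      then show ?thesis
        using f[of 0] N_pos P_N \<open>Suc k = N\<close> by simp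
    qed
    moreover have "P (Suc k) = (b + q * a * z) * f z"
      unfolding k(2) f[OF k(1)] P_def by (simp add: mult_ac)
    ultimately show ?thesis
      by simp
  qed
  then show ?thesis
    by blast
qed

end

section \<open>Monomial isomorphisms\<close>

context cyclic_calculus
begin

text \<open>A relation rather than a function of \<open>x\<close> and \<open>y\<close>, because the
  exponent matters only modulo N. As such it is additive in each argument.\<close>

definition qcomm :: "int \<Rightarrow> 'x \<Rightarrow> 'x \<Rightarrow> bool" where
  "qcomm a x y \<longleftrightarrow> x \<otimes> y = q powi (2 * a) \<odot> (y \<otimes> x)"

lemma qcomm_sym:
  assumes "x \<in> carrier R" "y \<in> carrier R" and "qcomm a x y"
  shows "qcomm (- a) y x"
  using assms by (simp add: qcomm_def smult_smult flip: power_int_add)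

lemma qcomm_mult_l:
  assumes closed: "x \<in> carrier R" "y \<in> carrier R" "z \<in> carrier R" and "qcomm a x z" "qcomm b y z"
  shows "qcomm (a + b) (x \<otimes> y) z"
proof -
  have "(x \<otimes> y) \<otimes> z = q powi (2 * b) \<odot> ((x \<otimes> z) \<otimes> y)"
    using closed assms(5)[unfolded qcomm_def] by (simp add: m_assoc smult_mult_r)
  also have "\<dots> = (q powi (2 * b) * q powi (2 * a)) \<odot> (z \<otimes> (x \<otimes> y))"
    using closed assms(4)[unfolded qcomm_def] by (simp add: smult_smult m_assoc smult_mult_l)
  also have "q powi (2 * b) * q powi (2 * a) = q powi (2 * (a + b))"
    by (simp add: algebra_simps flip: power_int_add)
  finally show ?thesis
    by (simp add: qcomm_def)
qed

lemma qcomm_mult_r: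
  assumes closed: "x \<in> carrier R" "y \<in> carrier R" "z \<in> carrier R" and "qcomm a z x" "qcomm b z y"
  shows "qcomm (a + b) z (x \<otimes> y)"
  using qcomm_sym[of "x \<otimes> y" z "- a + - b"] qcomm_mult_l[of x y z "- a" "- b"] assms
    qcomm_sym[of z x a] qcomm_sym[of z y b]
  by (simp add: add.commute)

lemma qcomm_one: "x \<in> carrier R \<Longrightarrow> qcomm 0 \<one> x"
  by (simp add: qcomm_def)

lemma qcomm_self: "x \<in> carrier R \<Longrightarrow> qcomm 0 x x"
  by (simp add: qcomm_def)

lemma qcomm_pow_l:
  assumes "x \<in> carrier R" "y \<in> carrier R" and "qcomm a x y"
  shows "qcomm (int n * a) (x [^] n) y"
proof (induction n)
  case 0
  show ?case
    using assms by (simp add: qcomm_one)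
next
  case (Suc n)
  then show ?case
    using assms qcomm_mult_l[of "x [^] n" x y "int n * a" a] by (simp add: algebra_simps)
qed

lemma qcomm_pow_r:
  assumes "x \<in> carrier R" "y \<in> carrier R" and "qcomm a x y"
  shows "qcomm (int n * a) x (y [^] n)"
  using qcomm_sym[of "y [^] n" x "int n * - a"] qcomm_pow_l[of y x "- a" n] qcomm_sym[of x y a] assms by simp

lemma qcomm_smult:
  assumes "x \<in> carrier R" "y \<in> carrier R" and "qcomm a x y"
  shows "qcomm a (c \<odot> x) y" "qcomm a x (c \<odot> y)"
  using assms by (simp_all add: qcomm_def smult_mult_l smult_mult_r smult_smult mult.commute)

lemma qcomm_inv_l:
  assumes "x \<in> Units R" "y \<in> carrier R" and "qcomm a x y"
  shows "qcomm (- a) (inv x) y"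
proof -
  have x: "x \<in> carrier R" "inv x \<in> carrier R"
    using assms(1) by auto
  have "y \<otimes> inv x = inv x \<otimes> (x \<otimes> y) \<otimes> inv x"
    using assms x by (simp flip: m_assoc)
  also have "\<dots> = q powi (2 * a) \<odot> (inv x \<otimes> y)"
    using assms x by (simp add: qcomm_def smult_mult_l smult_mult_r m_assoc)
  finally show ?thesis
    using assms x by (simp add: qcomm_def smult_smult flip: power_int_add)
qed

text \<open>Sorting the letters takes \<open>n * (n - 1) / 2\<close> moves of a \<open>y\<close>
  past an \<open>x\<close>, each costing \<open>q powi (- 2 * a)\<close>.\<close>

lemma qcomm_mult_nat_pow:
  assumes closed: "x \<in> carrier R" "y \<in> carrier R" and xy: "qcomm a x y"
  shows "(x \<otimes> y) [^] n = q powi (- (a * int n * (int n - 1))) \<odot> (x [^] n \<otimes> y [^] n)"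
proof (induction n)
  case (Suc n)
  let ?c = "q powi (- (a * int n * (int n - 1)))"
  have yx: "y [^] n \<otimes> x = q powi (2 * - (int n * a)) \<odot> (x \<otimes> y [^] n)"
    using qcomm_pow_l[of y x "- a" n] qcomm_sym[of x y a] assms by (simp add: qcomm_def)
  have "(x \<otimes> y) [^] Suc n = ?c \<odot> (x [^] n \<otimes> (y [^] n \<otimes> x) \<otimes> y)"
    using closed by (simp add: Suc smult_mult_l m_assoc)
  also have "\<dots> = (?c * q powi (2 * - (int n * a))) \<odot> (x [^] Suc n \<otimes> y [^] Suc n)"
    using closed by (simp add: yx smult_mult_l smult_mult_r smult_smult m_assoc)
  also have "?c * q powi (2 * - (int n * a)) = q powi (- (a * int (Suc n) * (int (Suc n) - 1)))"
    by (simp add: algebra_simps flip: power_int_add)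
  finally show ?case .
qed (use assms in simp)

text \<open>At \<open>n = N\<close> the sorting exponent is a multiple of N, so the scalar is
  1.\<close>

lemma qcomm_mult_power:
  assumes "x \<in> carrier R" "y \<in> carrier R" and "qcomm a x y"
    and "x [^] N = \<one>" "y [^] N = \<one>"
  shows "(x \<otimes> y) [^] N = \<one>"
proof -
  have "q powi (- (a * int N * (int N - 1))) = (q powi (- (a * (int N - 1)))) ^ N"
    unfolding power_int_of_nat[symmetric] power_int_mult[symmetric] by (simp add: mult_ac)
  then show ?thesis
    using qcomm_mult_nat_pow[OF assms(1-3), of N] assms(4,5) by (simp add: q_powi_N)
qed

text \<open>Cancelling the unit \<open>y \<otimes> x\<close> shows that two admissible exponents
  agree in \<open>q powi (2 * a)\<close>, hence in \<open>q powi a\<close>, so the definite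
  description has a unique solution.\<close>

lemma weyl_bracket_eq:
  assumes x: "x \<in> Units R" and y: "y \<in> Units R" and xy: "qcomm a x y"
  shows "weyl_bracket R q x y = q powi (- a) \<odot> (x \<otimes> y)"
  unfolding weyl_bracket_def
proof (rule the_equality)
  show "\<exists>b. x \<otimes> y = q powi (2 * b) \<odot> (y \<otimes> x) \<and> q powi (- a) \<odot> (x \<otimes> y) = q powi (- b) \<odot> (x \<otimes> y)"
    using xy unfolding qcomm_def by blast
next
  fix z assume "\<exists>b. x \<otimes> y = q powi (2 * b) \<odot> (y \<otimes> x) \<and> z = q powi (- b) \<odot> (x \<otimes> y)"
  then obtain b where b: "x \<otimes> y = q powi (2 * b) \<odot> (y \<otimes> x)" "z = q powi (- b) \<odot> (x \<otimes> y)"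
    by blast
  have w: "y \<otimes> x \<in> Units R" "y \<otimes> x \<in> carrier R" "x \<otimes> y \<in> carrier R"
    using x y by auto
  show "z = q powi (- a) \<odot> (x \<otimes> y)"
  \<comment> \<open>Two different values of the scalar are possible only in the zero ring.\<close>
  proof (cases "q powi (2 * a) = q powi (2 * b)")
    case True
    then have "q powi (2 * - a) = q powi (2 * - b)"
      by (simp add: power_int_minus)
    then have "q powi (- a) = q powi (- b)"
      by (rule q_powi_double_cancel)
    then show ?thesis
      using b(2) by simp
  next
    case False
    have "q powi (2 * a) \<odot> (y \<otimes> x) = q powi (2 * b) \<odot> (y \<otimes> x)"
      using b(1) xy unfolding qcomm_def by simp
    then have "(q powi (2 * a) \<odot> (y \<otimes> x)) \<otimes> inv (y \<otimes> x) = (q powi (2 * b) \<odot> (y \<otimes> x)) \<otimes> inv (y \<otimes> x)"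
      by simp
    then have "q powi (2 * a) \<odot> \<one> = q powi (2 * b) \<odot> \<one>"
      using w by (simp add: smult_mult_l)
    then have "(q powi (2 * a) + - (q powi (2 * b))) \<odot> \<one> = (q powi (2 * b) + - (q powi (2 * b))) \<odot> \<one>"
      by (simp only: smult_l_distr one_closed)
    then have "inverse (q powi (2 * a) - q powi (2 * b)) \<odot> ((q powi (2 * a) - q powi (2 * b)) \<odot> \<one>) = \<zero>"
      by simp
    then have "\<one> = \<zero>"
      using False by (simp add: smult_smult)
    then have "carrier R = {\<zero>}"
      using carrier_one_zero by blast
    moreover have "z \<in> carrier R" "q powi (- a) \<odot> (x \<otimes> y) \<in> carrier R"
      using b(2) w by simp_all
    ultimately show ?thesis
      by auto
  qed
qed

end

text \<open>\<open>X_bar\<close> for arbitrary exchange data, so that the algebra can be developed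
  apart from surfaces.\<close>

definition cyclic_var ::
  "nat \<Rightarrow> complex \<Rightarrow> ('e \<Rightarrow> 'e \<Rightarrow> int) \<Rightarrow> 'e set \<Rightarrow> ('e \<Rightarrow> complex) \<Rightarrow> 'e \<Rightarrow> 'e free_elt set set" where
  "cyclic_var N q \<epsilon> E u \<alpha> =
     inverse (u \<alpha>) \<odot>\<^bsub>cyclic_torus N q \<epsilon> E u\<^esub> cyclic_class N q \<epsilon> E u (free_gen \<alpha> True)"

locale cyclic_seed = cyclic_torus N q \<epsilon> E u + root_of_unity N q
  for N q and \<epsilon> :: "'e \<Rightarrow> 'e \<Rightarrow> int" and E u +
  assumes u_nonzero: "\<alpha> \<in> E \<Longrightarrow> u \<alpha> \<noteq> 0"
    and skew: "\<alpha> \<in> E \<Longrightarrow> \<beta> \<in> E \<Longrightarrow> \<epsilon> \<beta> \<alpha> = - \<epsilon> \<alpha> \<beta>"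
begin

sublocale R: cyclic_calculus R N q
  by unfold_locales

abbreviation "Y \<equiv> cyclic_var N q \<epsilon> E u"

lemma X_closed: "\<alpha> \<in> E \<Longrightarrow> X \<alpha> \<in> carrier R"
  using X_inverse(1) by (rule R.Units_closed)

lemma X_eq_Y: "\<alpha> \<in> E \<Longrightarrow> X \<alpha> = u \<alpha> \<odot>\<^bsub>R\<^esub> Y \<alpha>"
  unfolding cyclic_var_def using u_nonzero X_closed by (simp add: R.smult_smult)

lemma Y_closed [simp]: "\<alpha> \<in> E \<Longrightarrow> Y \<alpha> \<in> carrier R"
  unfolding cyclic_var_def using X_closed by simp

lemma Y_power: "\<alpha> \<in> E \<Longrightarrow> Y \<alpha> [^]\<^bsub>R\<^esub> N = \<one>\<^bsub>R\<^esub>"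
  unfolding cyclic_var_def using u_nonzero
  by (simp add: R.smult_nat_pow X_closed X_power R.smult_smult flip: power_mult_distrib)

lemma Y_Units [simp]: "\<alpha> \<in> E \<Longrightarrow> Y \<alpha> \<in> Units R"
  using R.x_Units Y_closed Y_power by blast

lemma Y_qcomm: "\<alpha> \<in> E \<Longrightarrow> \<beta> \<in> E \<Longrightarrow> R.qcomm (\<epsilon> \<alpha> \<beta>) (Y \<alpha>) (Y \<beta>)"
  unfolding cyclic_var_def
  by (intro R.qcomm_smult R.smult_closed X_closed) (simp_all only: R.qcomm_def X_commute[of \<alpha> \<beta>])

lemma alg_hom_eqI':
  assumes "complex_algebra S" and \<phi>: "\<phi> \<in> alg_hom R S" and \<psi>: "\<psi> \<in> alg_hom R S"
    and "\<And>\<alpha>. \<alpha> \<in> E \<Longrightarrow> \<phi> (Y \<alpha>) = \<psi> (Y \<alpha>)" and "x \<in> carrier R"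
  shows "\<phi> x = \<psi> x"
proof (rule alg_hom_eqI[OF assms(1-3) _ assms(5)])
  fix \<alpha> assume "\<alpha> \<in> E"
  then show "\<phi> (X \<alpha>) = \<psi> (X \<alpha>)"
    unfolding X_eq_Y[OF \<open>\<alpha> \<in> E\<close>] using assms(4) by (simp add: alg_hom_simps[OF \<phi>] alg_hom_simps[OF \<psi>])
qed

text \<open>In the rescaled generators the scalars \<open>u\<close> drop out of the relations. Maps
  between algebras with different exchange ratios are therefore governed by the exchange matrices
  alone.\<close>

lemma alg_hom_exists':
  assumes S: "complex_algebra S" and closed: "\<And>\<alpha>. \<alpha> \<in> E \<Longrightarrow> y \<alpha> \<in> carrier S"
    and commute: "\<And>\<alpha> \<beta>. \<alpha> \<in> E \<Longrightarrow> \<beta> \<in> E \<Longrightarrow>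
      y \<alpha> \<otimes>\<^bsub>S\<^esub> y \<beta> = q powi (2 * \<epsilon> \<alpha> \<beta>) \<odot>\<^bsub>S\<^esub> (y \<beta> \<otimes>\<^bsub>S\<^esub> y \<alpha>)"
    and power: "\<And>\<alpha>. \<alpha> \<in> E \<Longrightarrow> y \<alpha> [^]\<^bsub>S\<^esub> N = \<one>\<^bsub>S\<^esub>"
  shows "\<exists>\<phi> \<in> alg_hom R S. \<forall>\<alpha> \<in> E. \<phi> (Y \<alpha>) = y \<alpha>"
proof -
  interpret S: complex_algebra S by fact
  interpret S: cyclic_calculus S N q by unfold_locales
  have "\<exists>\<phi> \<in> alg_hom R S. \<forall>\<alpha> \<in> E. \<phi> (X \<alpha>) = u \<alpha> \<odot>\<^bsub>S\<^esub> y \<alpha>"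
  proof (rule alg_hom_exists[OF S])
    fix \<alpha> assume \<alpha>: "\<alpha> \<in> E"
    show "u \<alpha> \<odot>\<^bsub>S\<^esub> y \<alpha> \<in> Units S"
      using S.smult_inverse[OF u_nonzero[OF \<alpha>] S.x_Units[OF closed[OF \<alpha>] power[OF \<alpha>]]] by simp
    show "(u \<alpha> \<odot>\<^bsub>S\<^esub> y \<alpha>) [^]\<^bsub>S\<^esub> N = u \<alpha> ^ N \<odot>\<^bsub>S\<^esub> \<one>\<^bsub>S\<^esub>"
      using closed[OF \<alpha>] power[OF \<alpha>] by (simp add: S.smult_nat_pow)
    fix \<beta> assume \<beta>: "\<beta> \<in> E"
    have "S.qcomm (\<epsilon> \<alpha> \<beta>) (u \<alpha> \<odot>\<^bsub>S\<^esub> y \<alpha>) (u \<beta> \<odot>\<^bsub>S\<^esub> y \<beta>)"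
      using \<alpha> \<beta>
      by (intro S.qcomm_smult S.smult_closed closed) (simp_all only: S.qcomm_def commute[of \<alpha> \<beta>])
    then show "(u \<alpha> \<odot>\<^bsub>S\<^esub> y \<alpha>) \<otimes>\<^bsub>S\<^esub> (u \<beta> \<odot>\<^bsub>S\<^esub> y \<beta>) =
        q powi (2 * \<epsilon> \<alpha> \<beta>) \<odot>\<^bsub>S\<^esub> ((u \<beta> \<odot>\<^bsub>S\<^esub> y \<beta>) \<otimes>\<^bsub>S\<^esub> (u \<alpha> \<odot>\<^bsub>S\<^esub> y \<alpha>))"
      by (simp add: S.qcomm_def)
  qed
  then obtain \<phi> where \<phi>: "\<phi> \<in> alg_hom R S" "\<And>\<alpha>. \<alpha> \<in> E \<Longrightarrow> \<phi> (X \<alpha>) = u \<alpha> \<odot>\<^bsub>S\<^esub> y \<alpha>"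
    by blast
  have "\<phi> (Y \<alpha>) = y \<alpha>" if "\<alpha> \<in> E" for \<alpha>
    using that closed[OF that] u_nonzero[OF that] unfolding cyclic_var_def
    by (simp add: alg_hom_simps(5)[OF \<phi>(1)] X_closed \<phi>(2) S.smult_smult)
  then show ?thesis
    using \<phi>(1) by blast
qed

end

text \<open>The Weyl bracket of \<open>y\<close> and \<open>x [^] m\<close> written out, for
  \<open>y\<close> and \<open>x\<close> with commutation exponent \<open>n\<close>.\<close>

definition monomial_image ::
  "(complex, 'x) module \<Rightarrow> complex \<Rightarrow> 'x \<Rightarrow> 'x \<Rightarrow> int \<Rightarrow> nat \<Rightarrow> 'x" where
  "monomial_image R q x y n m = q powi (- (n * int m)) \<odot>\<^bsub>R\<^esub> (y \<otimes>\<^bsub>R\<^esub> (x [^]\<^bsub>R\<^esub> m))"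

section \<open>Monomial maps between two seeds\<close>

context
  fixes N :: nat and q :: complex and \<epsilon> \<epsilon>' :: "'e \<Rightarrow> 'e \<Rightarrow> int" and E E' :: "'e set" and u u' :: "'e \<Rightarrow> complex"
    and \<kappa> \<kappa>' :: 'e and m :: "'e \<Rightarrow> nat"
  assumes A: "cyclic_seed N q \<epsilon> E u" and B: "cyclic_seed N q \<epsilon>' E' u'"
    and \<kappa>: "\<kappa> \<in> E" and \<kappa>': "\<kappa>' \<in> E'" and EE': "E - {\<kappa>} = E' - {\<kappa>'}"
    and eps_\<kappa>: "\<And>\<alpha>. \<alpha> \<in> E - {\<kappa>} \<Longrightarrow> \<epsilon>' \<alpha> \<kappa>' = - \<epsilon> \<alpha> \<kappa>"
begin

interpretation A: cyclic_seed N q \<epsilon> E u by (rule A)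
interpretation B: cyclic_seed N q \<epsilon>' E' u' by (rule B)

text \<open>By additivity of exponents, the right-hand side of \<open>eps\<close> is the commutation
  exponent of the images of the generators; their N-th powers are 1 by
  \<open>qcomm_mult_power\<close> and because the prefactors are roots of unity.\<close>

lemma monomial_hom_exists:
  assumes eps: "\<And>\<alpha> \<beta>. \<alpha> \<in> E - {\<kappa>} \<Longrightarrow> \<beta> \<in> E - {\<kappa>} \<Longrightarrow>
      \<epsilon>' \<alpha> \<beta> = \<epsilon> \<alpha> \<beta> + int (m \<beta>) * \<epsilon> \<alpha> \<kappa> - int (m \<alpha>) * \<epsilon> \<beta> \<kappa>"
  shows "\<exists>\<nu> \<in> alg_hom B.R A.R. \<nu> (B.Y \<kappa>') = inv\<^bsub>A.R\<^esub> (A.Y \<kappa>) \<and>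
    (\<forall>\<alpha> \<in> E - {\<kappa>}. \<nu> (B.Y \<alpha>) = monomial_image A.R q (A.Y \<kappa>) (A.Y \<alpha>) (\<epsilon> \<alpha> \<kappa>) (m \<alpha>))"
proof -
  define M where "M \<alpha> = monomial_image A.R q (A.Y \<kappa>) (A.Y \<alpha>) (\<epsilon> \<alpha> \<kappa>) (m \<alpha>)" for \<alpha>
  define x where "x = A.Y \<kappa>"
  define y where "y \<alpha> = (if \<alpha> = \<kappa>' then inv\<^bsub>A.R\<^esub> x else M \<alpha>)" for \<alpha>
  have x: "x \<in> carrier A.R" "x \<in> Units A.R" "x [^]\<^bsub>A.R\<^esub> N = \<one>\<^bsub>A.R\<^esub>" "inv\<^bsub>A.R\<^esub> x \<in> carrier A.R"
    using \<kappa> by (simp_all add: x_def A.Y_power)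
  have E': "\<alpha> = \<kappa>' \<or> \<alpha> \<in> E - {\<kappa>} \<and> \<alpha> \<in> E \<and> \<alpha> \<noteq> \<kappa>'" if "\<alpha> \<in> E'" for \<alpha>
    using that EE' by blast
  have M: "M \<alpha> \<in> carrier A.R" if "\<alpha> \<in> E" for \<alpha>
    using that x unfolding M_def monomial_image_def x_def[symmetric] by simp
  have M_r: "A.R.qcomm (a + int (m \<alpha>) * b) z (M \<alpha>)"
    if "\<alpha> \<in> E" "z \<in> carrier A.R" "A.R.qcomm a z (A.Y \<alpha>)" "A.R.qcomm b z x" for \<alpha> z a b
    unfolding M_def monomial_image_def x_def[symmetric] using that x
    by (intro A.R.qcomm_smult A.R.qcomm_mult_r A.R.qcomm_pow_r) simp_all
  have Y_M: "A.R.qcomm (\<epsilon> \<alpha> \<beta> + int (m \<beta>) * \<epsilon> \<alpha> \<kappa>) (A.Y \<alpha>) (M \<beta>)" if "\<alpha> \<in> E" "\<beta> \<in> E" for \<alpha> \<beta>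
    using that A.Y_qcomm \<kappa> by (intro M_r) (simp_all add: x_def)
  have M_x: "A.R.qcomm (- \<epsilon> \<alpha> \<kappa>) x (M \<alpha>)" if "\<alpha> \<in> E" for \<alpha>
    using M_r[of \<alpha> x "\<epsilon> \<kappa> \<alpha>" 0] that A.Y_qcomm[OF \<kappa> that] x A.skew[OF that \<kappa>] A.R.qcomm_self[OF x(1)]
    by (simp add: x_def)
  have M_M: "A.R.qcomm (\<epsilon>' \<alpha> \<beta>) (M \<alpha>) (M \<beta>)" if "\<alpha> \<in> E - {\<kappa>}" "\<beta> \<in> E - {\<kappa>}" for \<alpha> \<beta>
  proof -
    have "A.R.qcomm ((\<epsilon> \<alpha> \<beta> + int (m \<beta>) * \<epsilon> \<alpha> \<kappa>) + int (m \<alpha>) * (- \<epsilon> \<beta> \<kappa>)) (M \<alpha>) (M \<beta>)"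
      unfolding M_def[of \<alpha>] monomial_image_def x_def[symmetric]
      using that x M Y_M M_x by (intro A.R.qcomm_smult A.R.qcomm_mult_l A.R.qcomm_pow_l) simp_all
    then show ?thesis
      using eps[OF that] by simp
  qed
  have inv_M: "A.R.qcomm (\<epsilon>' \<kappa>' \<alpha>) (inv\<^bsub>A.R\<^esub> x) (M \<alpha>)" if "\<alpha> \<in> E - {\<kappa>}" for \<alpha>
    using A.R.qcomm_inv_l[OF x(2) M M_x, of \<alpha>] that eps_\<kappa>[OF that] EE' B.skew[of \<alpha> \<kappa>'] \<kappa>' by auto
  have "\<exists>\<nu> \<in> alg_hom B.R A.R. \<forall>\<alpha> \<in> E'. \<nu> (B.Y \<alpha>) = y \<alpha>"
  proof (rule B.alg_hom_exists'[OF A.R.complex_algebra_axioms])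
    fix \<alpha> assume \<alpha>: "\<alpha> \<in> E'"
    show y: "y \<alpha> \<in> carrier A.R"
      using E'[OF \<alpha>] M x by (auto simp: y_def)
    have "M \<alpha> [^]\<^bsub>A.R\<^esub> N = \<one>\<^bsub>A.R\<^esub>" if "\<alpha> \<in> E"
    proof -
      have "(x [^]\<^bsub>A.R\<^esub> m \<alpha>) [^]\<^bsub>A.R\<^esub> N = \<one>\<^bsub>A.R\<^esub>"
        using x by (simp add: A.R.nat_pow_pow mult.commute[of "m \<alpha>"] flip: A.R.nat_pow_pow[of x N])
      then have "(A.Y \<alpha> \<otimes>\<^bsub>A.R\<^esub> (x [^]\<^bsub>A.R\<^esub> m \<alpha>)) [^]\<^bsub>A.R\<^esub> N = \<one>\<^bsub>A.R\<^esub>"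
        unfolding x_def using that \<kappa> A.Y_power
        by (intro A.R.qcomm_mult_power[OF _ _ A.R.qcomm_pow_r[OF _ _ A.Y_qcomm[OF that \<kappa>]]]) simp_all
      then show ?thesis
        unfolding M_def monomial_image_def x_def[symmetric]
        using that x by (simp add: A.R.smult_nat_pow A.q_powi_N)
    qed
    then show "y \<alpha> [^]\<^bsub>A.R\<^esub> N = \<one>\<^bsub>A.R\<^esub>"
      using E'[OF \<alpha>] A.R.inv_power[OF x(1,3)] by (auto simp: y_def)
    fix \<beta> assume \<beta>: "\<beta> \<in> E'"
    have "A.R.qcomm (\<epsilon>' \<alpha> \<beta>) (y \<alpha>) (y \<beta>)"
    proof -
      consider "\<alpha> = \<kappa>'" "\<beta> = \<kappa>'" | "\<alpha> = \<kappa>'" "\<beta> \<in> E - {\<kappa>}" "\<beta> \<noteq> \<kappa>'" | "\<beta> = \<kappa>'" "\<alpha> \<in> E - {\<kappa>}" "\<alpha> \<noteq> \<kappa>'"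
        | "\<alpha> \<in> E - {\<kappa>}" "\<alpha> \<noteq> \<kappa>'" "\<beta> \<in> E - {\<kappa>}" "\<beta> \<noteq> \<kappa>'"
        using E'[OF \<alpha>] E'[OF \<beta>] by blast
      then show ?thesis
      proof cases
        case 1
        then show ?thesis
          using A.R.qcomm_self[OF x(4)] B.skew[OF \<kappa>' \<kappa>'] by (simp add: y_def)
      next
        case 2
        then show ?thesis
          using inv_M by (simp add: y_def)
      next
        case 3
        then show ?thesis
          using A.R.qcomm_sym[OF x(4) _ inv_M[OF 3(2)]] M B.skew[OF \<alpha> \<kappa>'] by (simp add: y_def)
      next
        case 4
        then show ?thesis
          using M_M by (simp add: y_def)
      qed
    qed
    then show "y \<alpha> \<otimes>\<^bsub>A.R\<^esub> y \<beta> = q powi (2 * \<epsilon>' \<alpha> \<beta>) \<odot>\<^bsub>A.R\<^esub> (y \<beta> \<otimes>\<^bsub>A.R\<^esub> y \<alpha>)"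
      by (simp add: A.R.qcomm_def)
  qed
  then obtain \<nu> where \<nu>: "\<nu> \<in> alg_hom B.R A.R" "\<forall>\<alpha> \<in> E'. \<nu> (B.Y \<alpha>) = y \<alpha>"
    by blast
  moreover have "\<nu> (B.Y \<alpha>) = M \<alpha>" if "\<alpha> \<in> E - {\<kappa>}" for \<alpha>
    using \<nu>(2) that EE' by (auto simp: y_def)
  ultimately show ?thesis
    using \<kappa>' unfolding M_def by (intro bexI[of _ \<nu>]) (auto simp: y_def x_def)
qed

text \<open>On a generator the powers of the two mutually inverse variables cancel, and so do the
  Weyl scalars, because \<open>eps_\<kappa>\<close> reverses the sign of the exponent.\<close>

lemma monomial_hom_inverse:
  assumes \<nu>: "\<nu> \<in> alg_hom B.R A.R" "\<nu> (B.Y \<kappa>') = inv\<^bsub>A.R\<^esub> (A.Y \<kappa>)"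
      "\<And>\<alpha>. \<alpha> \<in> E - {\<kappa>} \<Longrightarrow> \<nu> (B.Y \<alpha>) = monomial_image A.R q (A.Y \<kappa>) (A.Y \<alpha>) (\<epsilon> \<alpha> \<kappa>) (m \<alpha>)"
    and \<nu>': "\<nu>' \<in> alg_hom A.R B.R" "\<nu>' (A.Y \<kappa>) = inv\<^bsub>B.R\<^esub> (B.Y \<kappa>')"
      "\<And>\<alpha>. \<alpha> \<in> E - {\<kappa>} \<Longrightarrow> \<nu>' (A.Y \<alpha>) = monomial_image B.R q (B.Y \<kappa>') (B.Y \<alpha>) (\<epsilon>' \<alpha> \<kappa>') (m \<alpha>)"
    and x: "x \<in> carrier B.R"
  shows "\<nu>' (\<nu> x) = x"
proof -
  have A': "complex_algebra A.R" and B': "complex_algebra B.R"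
    by (rule A.R.complex_algebra_axioms B.R.complex_algebra_axioms)+
  have "id \<in> alg_hom B.R B.R"
    by (simp add: alg_hom_def)
  moreover have "(\<nu>' \<circ> \<nu>) (B.Y \<alpha>) = id (B.Y \<alpha>)" if \<alpha>: "\<alpha> \<in> E'" for \<alpha>
  proof (cases "\<alpha> = \<kappa>'")
    case True
    then show ?thesis
      using alg_hom_inverse(2)[OF \<nu>'(1) A' B' A.Y_Units[OF \<kappa>]] \<kappa>' by (simp add: \<nu>(2) \<nu>'(2))
  next
    case False
    then have \<alpha>': "\<alpha> \<in> E - {\<kappa>}" "\<alpha> \<in> E"
      using \<alpha> EE' by auto
    define y where "y = B.Y \<kappa>'"
    have y: "y \<in> carrier B.R" "y \<in> Units B.R" "inv\<^bsub>B.R\<^esub> y \<in> carrier B.R"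
      using \<kappa>' by (simp_all add: y_def)
    have cancel: "y [^]\<^bsub>B.R\<^esub> k \<otimes>\<^bsub>B.R\<^esub> (inv\<^bsub>B.R\<^esub> y) [^]\<^bsub>B.R\<^esub> k = \<one>\<^bsub>B.R\<^esub>" for k :: nat
      using B.R.pow_mult_distrib[of y "inv\<^bsub>B.R\<^esub> y" k] y by simp
    have "\<nu>' (\<nu> (B.Y \<alpha>)) = q powi (- (\<epsilon> \<alpha> \<kappa> * int (m \<alpha>))) \<odot>\<^bsub>B.R\<^esub>
        (\<nu>' (A.Y \<alpha>) \<otimes>\<^bsub>B.R\<^esub> (inv\<^bsub>B.R\<^esub> y) [^]\<^bsub>B.R\<^esub> m \<alpha>)"
      using \<alpha>' \<kappa> by (simp add: \<nu>(3) monomial_image_def alg_hom_simps[OF \<nu>'(1)]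
        alg_hom_nat_pow[OF \<nu>'(1) A' B'] \<nu>'(2) y_def)
    also have "\<dots> = q powi (- (\<epsilon> \<alpha> \<kappa> * int (m \<alpha>))) \<odot>\<^bsub>B.R\<^esub> (q powi (\<epsilon> \<alpha> \<kappa> * int (m \<alpha>)) \<odot>\<^bsub>B.R\<^esub>
        (B.Y \<alpha> \<otimes>\<^bsub>B.R\<^esub> (y [^]\<^bsub>B.R\<^esub> m \<alpha> \<otimes>\<^bsub>B.R\<^esub> (inv\<^bsub>B.R\<^esub> y) [^]\<^bsub>B.R\<^esub> m \<alpha>)))"
      using \<alpha> y by (simp add: \<nu>'(3)[OF \<alpha>'(1)] monomial_image_def eps_\<kappa>[OF \<alpha>'(1)] y_def[symmetric]
        B.R.smult_mult_l B.R.m_assoc)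
    also have "\<dots> = B.Y \<alpha>"
      using \<alpha> by (simp add: cancel B.R.smult_smult flip: power_int_add)
    finally show ?thesis
      by simp
  qed
  ultimately have "(\<nu>' \<circ> \<nu>) x = id x"
    by (intro B.alg_hom_eqI'[OF B' alg_hom_comp[OF \<nu>(1) \<nu>'(1)] _ _ x])
  then show ?thesis
    by simp
qed

end

text \<open>The inverse is the monomial map of the opposite flip with the same exponents.\<close>

lemma monomial_iso_exists:
  assumes A: "cyclic_seed N q \<epsilon> E u" and B: "cyclic_seed N q \<epsilon>' E' u'"
    and \<kappa>: "\<kappa> \<in> E" and \<kappa>': "\<kappa>' \<in> E'" and EE': "E - {\<kappa>} = E' - {\<kappa>'}"
    and eps_\<kappa>: "\<And>\<alpha>. \<alpha> \<in> E - {\<kappa>} \<Longrightarrow> \<epsilon>' \<alpha> \<kappa>' = - \<epsilon> \<alpha> \<kappa>"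
    and eps: "\<And>\<alpha> \<beta>. \<alpha> \<in> E - {\<kappa>} \<Longrightarrow> \<beta> \<in> E - {\<kappa>} \<Longrightarrow>
      \<epsilon>' \<alpha> \<beta> = \<epsilon> \<alpha> \<beta> + int (m \<beta>) * \<epsilon> \<alpha> \<kappa> - int (m \<alpha>) * \<epsilon> \<beta> \<kappa>"
  shows "\<exists>\<nu> \<in> alg_iso (cyclic_torus N q \<epsilon>' E' u') (cyclic_torus N q \<epsilon> E u).
    \<nu> (cyclic_var N q \<epsilon>' E' u' \<kappa>') = inv\<^bsub>cyclic_torus N q \<epsilon> E u\<^esub> (cyclic_var N q \<epsilon> E u \<kappa>) \<and>
    (\<forall>\<alpha> \<in> E - {\<kappa>}. \<nu> (cyclic_var N q \<epsilon>' E' u' \<alpha>) =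
       monomial_image (cyclic_torus N q \<epsilon> E u) q (cyclic_var N q \<epsilon> E u \<kappa>) (cyclic_var N q \<epsilon> E u \<alpha>)
         (\<epsilon> \<alpha> \<kappa>) (m \<alpha>))"
proof -
  let ?R = "cyclic_torus N q \<epsilon> E u" and ?R' = "cyclic_torus N q \<epsilon>' E' u'"
  let ?Y = "cyclic_var N q \<epsilon> E u" and ?Y' = "cyclic_var N q \<epsilon>' E' u'"
  have eps_\<kappa>': "\<epsilon> \<alpha> \<kappa> = - \<epsilon>' \<alpha> \<kappa>'" if "\<alpha> \<in> E' - {\<kappa>'}" for \<alpha>
    using eps_\<kappa>[of \<alpha>] that EE' by simp
  \<comment> \<open>The relation between the matrices keeps its form when the seeds are exchanged,
    since the column of the diagonal changes sign.\<close>
  have eps': "\<epsilon> \<alpha> \<beta> = \<epsilon>' \<alpha> \<beta> + int (m \<beta>) * \<epsilon>' \<alpha> \<kappa>' - int (m \<alpha>) * \<epsilon>' \<beta> \<kappa>'"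
    if "\<alpha> \<in> E' - {\<kappa>'}" "\<beta> \<in> E' - {\<kappa>'}" for \<alpha> \<beta>
    using eps[of \<alpha> \<beta>] eps_\<kappa>[of \<alpha>] eps_\<kappa>[of \<beta>] that EE' by simp
  obtain \<nu> where \<nu>: "\<nu> \<in> alg_hom ?R' ?R"
    "\<nu> (?Y' \<kappa>') = inv\<^bsub>?R\<^esub> (?Y \<kappa>)"
    "\<And>\<alpha>. \<alpha> \<in> E - {\<kappa>} \<Longrightarrow> \<nu> (?Y' \<alpha>) =
       monomial_image ?R q (?Y \<kappa>) (?Y \<alpha>)
         (\<epsilon> \<alpha> \<kappa>) (m \<alpha>)"
    using monomial_hom_exists[where m = m, OF A B \<kappa> \<kappa>' EE' eps_\<kappa> eps] by blast
  obtain \<nu>' where \<nu>': "\<nu>' \<in> alg_hom ?R ?R'"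
    "\<nu>' (?Y \<kappa>) = inv\<^bsub>?R'\<^esub> (?Y' \<kappa>')"
    "\<And>\<alpha>. \<alpha> \<in> E' - {\<kappa>'} \<Longrightarrow> \<nu>' (?Y \<alpha>) =
       monomial_image ?R' q (?Y' \<kappa>') (?Y' \<alpha>)
         (\<epsilon>' \<alpha> \<kappa>') (m \<alpha>)"
    using monomial_hom_exists[where m = m, OF B A \<kappa>' \<kappa> EE'[symmetric] eps_\<kappa>' eps'] by blast
  have "\<nu>' (\<nu> x) = x" if "x \<in> carrier ?R'" for x
    by (rule monomial_hom_inverse[OF A B \<kappa> \<kappa>' EE' eps_\<kappa> \<nu>(1-3) \<nu>'(1,2) \<nu>'(3)[folded EE'] that]; assumption)
  moreover have "\<nu> (\<nu>' x) = x" if "x \<in> carrier ?R" for x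
    by (rule monomial_hom_inverse[OF B A \<kappa>' \<kappa> EE'[symmetric] eps_\<kappa>' \<nu>'(1-3) \<nu>(1,2) \<nu>(3)[unfolded EE'] that]; assumption)
  ultimately have "\<nu> \<in> alg_iso ?R' ?R"
    by (rule alg_isoI[OF \<nu>(1) \<nu>'(1)])
  then show ?thesis
    using \<nu>(2,3) by blast
qed

section \<open>Inner automorphisms and mutation\<close>

context complex_algebra
begin

lemma int_pow_unit:
  "x \<in> carrier R \<Longrightarrow> x [^] (1::int) = x" "x \<in> carrier R \<Longrightarrow> x [^] (- 1::int) = inv x"
  by (simp_all add: int_pow_def2)

lemma nat_pow_Units: "x \<in> Units R \<Longrightarrow> x [^] (n::nat) \<in> Units R"
  by (induction n) simp_all

lemma Ad_closed: "g \<in> Units R \<Longrightarrow> x \<in> carrier R \<Longrightarrow> Ad R g x \<in> carrier R"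
  by (simp add: Ad_def Units_closed)

lemma Ad_Ad_inv:
  assumes g: "g \<in> Units R" and x: "x \<in> carrier R"
  shows "Ad R (inv g) (Ad R g x) = x" "Ad R g (Ad R (inv g) x) = x"
proof -
  have closed: "g \<in> carrier R" "inv g \<in> carrier R"
    using g by auto
  have "inv g \<otimes> (g \<otimes> x \<otimes> inv g) \<otimes> g = (inv g \<otimes> g) \<otimes> x \<otimes> (inv g \<otimes> g)"
    using closed x by (simp only: m_assoc m_closed)
  then show "Ad R (inv g) (Ad R g x) = x"
    using g x by (simp add: Ad_def)
  have "g \<otimes> (inv g \<otimes> x \<otimes> g) \<otimes> inv g = (g \<otimes> inv g) \<otimes> x \<otimes> (g \<otimes> inv g)"
    using closed x by (simp only: m_assoc m_closed)
  then show "Ad R g (Ad R (inv g) x) = x"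
    using g x by (simp add: Ad_def)
qed

lemma Ad_alg_hom:
  assumes g: "g \<in> Units R"
  shows "Ad R g \<in> alg_hom R R"
proof -
  have closed: "g \<in> carrier R" "inv g \<in> carrier R"
    using g by auto
  have mult: "g \<otimes> (x \<otimes> y) \<otimes> inv g = (g \<otimes> x \<otimes> inv g) \<otimes> (g \<otimes> y \<otimes> inv g)"
    if "x \<in> carrier R" "y \<in> carrier R" for x y
  proof -
    have "(g \<otimes> x \<otimes> inv g) \<otimes> (g \<otimes> y \<otimes> inv g) = g \<otimes> x \<otimes> (inv g \<otimes> g) \<otimes> y \<otimes> inv g"
      using closed that by (simp only: m_assoc m_closed)
    then show ?thesis
      using closed g that by (simp add: m_assoc)
  qed
  show ?thesis
    unfolding alg_hom_def ring_hom_def Ad_def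
    using closed g by (auto simp: mult l_distr r_distr smult_mult_l smult_mult_r)
qed

lemma Ad_alg_iso:
  assumes g: "g \<in> Units R"
  shows "Ad R g \<in> alg_iso R R"
  using Ad_Ad_inv[OF g] by (intro alg_isoI[OF Ad_alg_hom[OF g] Ad_alg_hom[OF Units_inv_Units[OF g]]]) auto

lemma inv_into_Ad:
  assumes g: "g \<in> Units R" and x: "x \<in> carrier R"
  shows "inv_into (carrier R) (Ad R g) x = Ad R (inv g) x"
proof -
  have inj: "inj_on (Ad R g) (carrier R)"
    using Ad_Ad_inv(1)[OF g] by (rule inj_on_inverseI)
  have "Ad R (inv g) x \<in> carrier R"
    using g x by (simp add: Ad_closed)
  then show ?thesis
    using inv_into_f_eq[OF inj] Ad_Ad_inv(2)[OF g x] by blast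
qed

text \<open>\<open>inv_into\<close> agrees with conjugation by the inverse on the carrier only, so
  the properties are transferred pointwise instead of by an equation between functions.\<close>

lemma Ad_sign_neg_alg_iso:
  assumes g: "g \<in> Units R"
  shows "Ad_sign R g (- 1) \<in> alg_iso R R"
proof -
  have eq: "Ad_sign R g (- 1) x = Ad R (inv g) x" if "x \<in> carrier R" for x
    using inv_into_Ad[OF g that] by (simp add: Ad_sign_def)
  have iso: "Ad R (inv g) \<in> alg_iso R R"
    using g by (intro Ad_alg_iso) simp
  then have "Ad_sign R g (- 1) \<in> alg_hom R R"
    unfolding alg_iso_def alg_hom_def ring_hom_def using eq by auto
  moreover have "bij_betw (Ad_sign R g (- 1)) (carrier R) (carrier R) \<longleftrightarrow> bij_betw (Ad R (inv g)) (carrier R) (carrier R)"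
    using eq by (rule bij_betw_cong)
  ultimately show ?thesis
    using iso by (simp add: alg_iso_def)
qed

lemma ordered_prod_Suc:
  assumes "\<And>j. j \<in> {1..Suc n} \<Longrightarrow> F j \<in> carrier R"
  shows "ordered_prod R F (Suc n) = ordered_prod R F n \<otimes> F (Suc n)" and "ordered_prod R F n \<in> carrier R"
proof -
  \<comment> \<open>\<open>foldr\<close> exposes the first factor, while the inductions below append
    the last one; replacing the final unit by an arbitrary \<open>c\<close> lets the last factor be
    split off.\<close>
  have *: "foldr (\<lambda>j a. F j \<otimes> a) js c = foldr (\<lambda>j a. F j \<otimes> a) js \<one> \<otimes> c \<and>
      foldr (\<lambda>j a. F j \<otimes> a) js \<one> \<in> carrier R" if "set js \<subseteq> {1..Suc n}" "c \<in> carrier R" for js c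
    using that
  proof (induction js)
    case (Cons j js)
    then have "F j \<in> carrier R"
      using assms by simp
    then show ?case
      using Cons by (simp add: m_assoc)
  qed simp
  have carr: "F (Suc n) \<in> carrier R" and js: "set [1..<Suc n] \<subseteq> {1..Suc n}"
    using assms by auto
  show "ordered_prod R F n \<in> carrier R"
    unfolding ordered_prod_def using *[OF js one_closed] by blast
  have "[1..<Suc (Suc n)] = [1..<Suc n] @ [Suc n]"
    by simp
  then have "ordered_prod R F (Suc n) = foldr (\<lambda>j a. F j \<otimes> a) [1..<Suc n] (F (Suc n))"
    unfolding ordered_prod_def using carr by (simp only: foldr_append foldr.simps comp_apply id_apply r_one)
  then show "ordered_prod R F (Suc n) = ordered_prod R F n \<otimes> F (Suc n)"
    unfolding ordered_prod_def using *[OF js carr] by simp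
qed

end

section \<open>Mutation formulas as functions of one variable\<close>

context cyclic_calculus
begin

text \<open>All factors are functions of the same \<open>x\<close>, so the ordered product is the
  pointwise product.\<close>

lemma ordered_prod_functional_calculus:
  assumes x: "x \<in> carrier R" "x [^] N = \<one>"
    and F: "\<And>j. j \<in> {1..n} \<Longrightarrow> F j = functional_calculus R N q (h j) x"
  shows "ordered_prod R F n = functional_calculus R N q (\<lambda>z. \<Prod>j=1..n. h j z) x"
  using F
proof (induction n)
  case 0
  then show ?case
    using calculus_one[OF x] by (simp add: ordered_prod_def)
next
  case (Suc n)
  have "ordered_prod R F (Suc n) = ordered_prod R F n \<otimes> F (Suc n)"
    using Suc.prems calculus_closed[OF x] by (intro ordered_prod_Suc) auto
  also have "\<dots> = functional_calculus R N q (\<lambda>z. \<Prod>j=1..n. h j z) x \<otimes> functional_calculus R N q (h (Suc n)) x"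
    using Suc by simp
  finally show ?case
    by (simp add: calculus_mult[OF x])
qed

context
  fixes x :: 'x and a b :: complex
  assumes x: "x \<in> carrier R" "x [^] N = \<one>" and ab: "a ^ N + b ^ N = 1" "a \<noteq> 0" "b \<noteq> 0"
begin

private abbreviation "fx f \<equiv> functional_calculus R N q f x"

lemma cluster_factor_eq:
  "cluster_factor R q c d (fx f) j = fx (\<lambda>z. c + q powi (2 * int j - 1) * d * f z)"
  unfolding cluster_factor_def by (rule calculus_affine[OF x])

lemma inv_x_eq: "inv x = fx inverse"
  using calculus_inverse[OF x, of "\<lambda>z. z"] calculus_id[of "inv x"]
    x_Units[OF x] inv_power[OF x] by simp

lemma neg_factor_nonzero: "z ^ N = 1 \<Longrightarrow> b + q powi k * a * z \<noteq> 0"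
  using factor_nonzero[OF ab(1)] .

lemma pos_factor_nonzero: "z ^ N = 1 \<Longrightarrow> a + q powi k * b * inverse z \<noteq> 0"
  using factor_nonzero[of b a "inverse z" k] ab(1) by (simp add: add.commute power_inverse)

lemma ordered_prod_neg:
  "n < 0 \<Longrightarrow> ordered_prod R (cluster_factor R q b a x) (nat \<bar>n\<bar>) = fx (mutation_factor a b n)"
proof -
  assume n: "n < 0"
  have "cluster_factor R q b a x j = fx (\<lambda>z. b + q powi (2 * int j - 1) * a * z)" for j
    using cluster_factor_eq[of b a "\<lambda>z. z" j] by (simp add: calculus_id[OF x])
  then have "ordered_prod R (cluster_factor R q b a x) (nat \<bar>n\<bar>) =
      fx (\<lambda>z. \<Prod>j=1..nat \<bar>n\<bar>. b + q powi (2 * int j - 1) * a * z)"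
    by (intro ordered_prod_functional_calculus x)
  also have "(\<lambda>z. \<Prod>j=1..nat \<bar>n\<bar>. b + q powi (2 * int j - 1) * a * z) = mutation_factor a b n"
    using n by (simp add: mutation_factor_def fun_eq_iff)
  finally show ?thesis .
qed

lemma cluster_factor_pos_Units:
  shows "cluster_factor R q a b (inv x) j \<in> Units R"
    and "inv (cluster_factor R q a b (inv x) j) = fx (\<lambda>z. inverse (a + q powi (2 * int j - 1) * b * inverse z))"
proof -
  have eq: "cluster_factor R q a b (inv x) j = fx (\<lambda>z. a + q powi (2 * int j - 1) * b * inverse z)"
    using cluster_factor_eq[of a b inverse j] by (simp add: inv_x_eq)
  show "cluster_factor R q a b (inv x) j \<in> Units R"
    and "inv (cluster_factor R q a b (inv x) j) = fx (\<lambda>z. inverse (a + q powi (2 * int j - 1) * b * inverse z))"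
    unfolding eq by (rule calculus_Units[OF x], rule pos_factor_nonzero, assumption)+
qed

lemma ordered_prod_pos:
  assumes "0 \<le> n"
  shows "ordered_prod R (\<lambda>j. inv (cluster_factor R q a b (inv x) j)) (nat n) = fx (mutation_factor a b n)"
proof -
  have "ordered_prod R (\<lambda>j. inv (cluster_factor R q a b (inv x) j)) (nat n) =
      fx (\<lambda>z. \<Prod>j=1..nat n. inverse (a + q powi (2 * int j - 1) * b * inverse z))"
    by (intro ordered_prod_functional_calculus x cluster_factor_pos_Units)
  also have "(\<lambda>z. \<Prod>j=1..nat n. inverse (a + q powi (2 * int j - 1) * b * inverse z)) = mutation_factor a b n"
    using assms by (simp add: mutation_factor_def fun_eq_iff)
  finally show ?thesis .
qed

text \<open>Each unscaled factor is a rescaled one divided by \<open>b\<close> if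
  \<open>n < 0\<close> and by \<open>a\<close> if \<open>n > 0\<close>. The scalars pulled out make
  up \<open>b powi n\<close> or \<open>a powi n\<close>, which is the change of the exchange ratio
  under the flip.\<close>

lemma ordered_prod_unscaled:
  assumes F: "F = cluster_factor R q 1 1 (((a / b) \<odot> x) [^] (- sgn n :: int))"
  shows "j \<in> {1..nat \<bar>n\<bar>} \<Longrightarrow> F j \<in> Units R"
    and "ordered_prod R (\<lambda>j. F j [^] (- sgn n)) (nat \<bar>n\<bar>) =
      (if 0 \<le> n then a powi n else b powi n) \<odot> fx (mutation_factor a b n)"
proof -
  consider "n < 0" | "n = 0" | "n > 0"
    by linarith
  then have "(\<forall>j \<in> {1..nat \<bar>n\<bar>}. F j \<in> Units R) \<and>
    ordered_prod R (\<lambda>j. F j [^] (- sgn n)) (nat \<bar>n\<bar>) =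
      (if 0 \<le> n then a powi n else b powi n) \<odot> fx (mutation_factor a b n)"
  proof cases
    case 1
    define h where "h j z = inverse b * (b + q powi (2 * int j - 1) * a * z)" for j :: nat and z
    have "((a / b) \<odot> x) [^] (- sgn n :: int) = fx (\<lambda>z. (a / b) * z)"
      using 1 x calculus_smult[OF x, of "a / b" "\<lambda>z. z"]
      by (simp add: int_pow_unit calculus_id[OF x])
    then have F': "F j = fx (h j)" for j
    proof -
      have "(\<lambda>z. 1 + q powi (2 * int j - 1) * 1 * (a / b * z)) = h j"
        using ab by (simp add: h_def fun_eq_iff field_simps)
      then show ?thesis
        unfolding F \<open>((a / b) \<odot> x) [^] (- sgn n) = _\<close> cluster_factor_eq by simp
    qed
    have units: "F j \<in> Units R" for j
      unfolding F' h_def using neg_factor_nonzero ab by (intro calculus_Units[OF x]) simp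
    have "F j [^] (- sgn n) = fx (h j)" for j
      using 1 F' calculus_closed[OF x] by (simp add: int_pow_unit)
    then have "ordered_prod R (\<lambda>j. F j [^] (- sgn n)) (nat \<bar>n\<bar>) = fx (\<lambda>z. \<Prod>j=1..nat \<bar>n\<bar>. h j z)"
      by (intro ordered_prod_functional_calculus x)
    also have "(\<lambda>z. \<Prod>j=1..nat \<bar>n\<bar>. h j z) = (\<lambda>z. b powi n * mutation_factor a b n z)"
      using 1 by (simp add: h_def prod.distrib mutation_factor_def fun_eq_iff power_int_def power_inverse)
    finally show ?thesis
      using 1 units by (simp add: calculus_smult[OF x])
  next
    case 2
    then show ?thesis
      using calculus_one[OF x]
      by (simp add: ordered_prod_def mutation_factor_def[abs_def])
  next
    case 3
    define h where "h j z = inverse a * (a + q powi (2 * int j - 1) * b * inverse z)" for j :: nat and z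
    have "((a / b) \<odot> x) [^] (- sgn n :: int) = (b / a) \<odot> inv x"
      using 3 x ab smult_inverse[of "a / b" x] x_Units[OF x] by (simp add: int_pow_unit)
    also have "\<dots> = fx (\<lambda>z. (b / a) * inverse z)"
      by (simp add: inv_x_eq calculus_smult[OF x])
    finally have scaled: "((a / b) \<odot> x) [^] (- sgn n :: int) = fx (\<lambda>z. (b / a) * inverse z)" .
    have F': "F j = fx (h j)" for j
    proof -
      have "(\<lambda>z. 1 + q powi (2 * int j - 1) * 1 * (b / a * inverse z)) = h j"
        using ab by (simp add: h_def fun_eq_iff field_simps)
      then show ?thesis
        unfolding F scaled cluster_factor_eq by simp
    qed
    have nonzero: "h j z \<noteq> 0" if "z ^ N = 1" for j z
      using pos_factor_nonzero[OF that] ab by (simp add: h_def)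
    have units: "F j \<in> Units R" for j
      unfolding F' using nonzero by (intro calculus_Units[OF x])
    have "F j [^] (- sgn n) = fx (\<lambda>z. inverse (h j z))" for j
      using 3 F' calculus_closed[OF x] calculus_Units(2)[OF x nonzero]
      by (simp add: int_pow_unit)
    then have "ordered_prod R (\<lambda>j. F j [^] (- sgn n)) (nat \<bar>n\<bar>) = fx (\<lambda>z. \<Prod>j=1..nat \<bar>n\<bar>. inverse (h j z))"
      by (intro ordered_prod_functional_calculus x)
    also have "(\<lambda>z. \<Prod>j=1..nat \<bar>n\<bar>. inverse (h j z)) = (\<lambda>z. a powi n * mutation_factor a b n z)"
      using 3 by (simp add: h_def prod.distrib mutation_factor_def fun_eq_iff power_int_def)
    finally show ?thesis
      using 3 units by (simp add: calculus_smult[OF x])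
  qed
  then show "j \<in> {1..nat \<bar>n\<bar>} \<Longrightarrow> F j \<in> Units R"
    and "ordered_prod R (\<lambda>j. F j [^] (- sgn n)) (nat \<bar>n\<bar>) =
      (if 0 \<le> n then a powi n else b powi n) \<odot> fx (mutation_factor a b n)"
    by blast+
qed

text \<open>The monomial has the same commutation exponent with \<open>x\<close> as
  \<open>y\<close>, since it differs from \<open>y\<close> by a function of \<open>x\<close>.
  Conjugation and Weyl ordering thus both contribute functions of \<open>x\<close>, compared
  pointwise in \<open>scalar\<close>.\<close>

lemma Ad_monomial_image:
  assumes f: "\<And>z. z ^ N = 1 \<Longrightarrow> f z \<noteq> 0"
    and scalar: "\<And>z. z ^ N = 1 \<Longrightarrow>
      f (q powi (2 * - n) * z) / f z * (q powi (- (n * int m)) * z ^ m) = mutation_factor a b n z"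
    and y: "y \<in> carrier R" and yx: "qcomm n y x"
  shows "Ad R (fx f) (monomial_image R q x y n m) = y \<otimes> fx (mutation_factor a b n)"
proof -
  let ?y = "monomial_image R q x y n m"
  have y_eq: "?y = y \<otimes> fx (\<lambda>z. q powi (- (n * int m)) * z ^ m)"
  proof -
    have "x [^] m = fx (\<lambda>z. z ^ m)"
      using calculus_nat_pow[OF x, of "\<lambda>z. z" m] by (simp add: calculus_id[OF x])
    then show ?thesis
      unfolding monomial_image_def calculus_smult[OF x, symmetric]
      using y calculus_closed[OF x] by (simp add: smult_mult_r)
  qed
  have y_closed: "?y \<in> carrier R"
    using x y by (simp add: monomial_image_def)
  have xy: "qcomm (- n) x y"
    by (rule qcomm_sym[OF y x(1) yx])
  have "qcomm (- n + int m * 0) x (y \<otimes> x [^] m)"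
    using x y xy by (intro qcomm_mult_r qcomm_pow_r qcomm_self) simp_all
  then have "qcomm (- n) x ?y"
    unfolding monomial_image_def using x y by (intro qcomm_smult) simp_all
  then have xy': "x \<otimes> ?y = q powi (2 * - n) \<odot> (?y \<otimes> x)"
    by (simp only: qcomm_def)
  have "Ad R (fx f) ?y = ?y \<otimes> fx (\<lambda>z. f (q powi (2 * - n) * z) / f z)"
    by (rule Ad_functional_calculus[OF x f y_closed xy'])
  also have "\<dots> = y \<otimes> fx (\<lambda>z. q powi (- (n * int m)) * z ^ m * (f (q powi (2 * - n) * z) / f z))"
    unfolding y_eq using y calculus_closed[OF x] by (simp add: m_assoc calculus_mult[OF x])
  also have "fx (\<lambda>z. q powi (- (n * int m)) * z ^ m * (f (q powi (2 * - n) * z) / f z)) = fx (mutation_factor a b n)"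
    using scalar by (intro calculus_cong[OF x]) (simp only: mult.commute)
  finally show ?thesis .
qed

lemma Ad_inv_x:
  assumes f: "\<And>z. z ^ N = 1 \<Longrightarrow> f z \<noteq> 0"
  shows "Ad R (fx f) (inv x) = inv x"
proof -
  have "x \<otimes> inv x = q powi (2 * 0) \<odot> (inv x \<otimes> x)"
    using x x_Units[OF x] by simp
  then have "Ad R (fx f) (inv x) = inv x \<otimes> fx (\<lambda>z. f (q powi (2 * 0) * z) / f z)"
    using x_Units[OF x] by (intro Ad_functional_calculus[OF x f]) auto
  also have "fx (\<lambda>z. f (q powi (2 * 0) * z) / f z) = fx (\<lambda>z. 1)"
    using f by (intro calculus_cong[OF x]) simp
  finally show ?thesis
    using x_Units[OF x] by (simp add: calculus_one[OF x])
qed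

end

end

section \<open>Mutation between abstract seeds\<close>

locale cyclic_mutation =
  A: cyclic_seed N q \<epsilon> E u + B: cyclic_seed N q \<epsilon>' E' u'
  for N :: nat and q :: complex and \<epsilon> \<epsilon>' :: "'e \<Rightarrow> 'e \<Rightarrow> int" and E E' :: "'e set" and u u' :: "'e \<Rightarrow> complex" +
  fixes \<kappa> \<kappa>' :: 'e and a b :: complex
  assumes \<kappa>: "\<kappa> \<in> E" and \<kappa>': "\<kappa>' \<in> E'" and EE': "E - {\<kappa>} = E' - {\<kappa>'}"
    and eps_\<kappa>: "\<alpha> \<in> E - {\<kappa>} \<Longrightarrow> \<epsilon>' \<alpha> \<kappa>' = - \<epsilon> \<alpha> \<kappa>"
    and eps: "\<alpha> \<in> E - {\<kappa>} \<Longrightarrow> \<beta> \<in> E - {\<kappa>} \<Longrightarrow> \<epsilon>' \<alpha> \<beta> = \<epsilon> \<alpha> \<beta> +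
       max (\<epsilon> \<alpha> \<kappa>) 0 * max (\<epsilon> \<kappa> \<beta>) 0 - max (- \<epsilon> \<alpha> \<kappa>) 0 * max (- \<epsilon> \<kappa> \<beta>) 0"
    and ab: "a ^ N + b ^ N = 1" "a \<noteq> 0" "b \<noteq> 0"
begin

abbreviation "x \<equiv> A.Y \<kappa>"
abbreviation "fc f \<equiv> functional_calculus A.R N q f x"

text \<open>The rescaled clauses of \<open>cluster_poisson\<close> with the two cases of the product
  merged into one function of \<open>x\<close>; these values determine an algebra map.\<close>

definition mutates :: "('e free_elt set set \<Rightarrow> 'e free_elt set set) \<Rightarrow> bool" where
  "mutates \<phi> \<longleftrightarrow> \<phi> (B.Y \<kappa>') = inv\<^bsub>A.R\<^esub> x \<and>
     (\<forall>\<alpha> \<in> E - {\<kappa>}. \<phi> (B.Y \<alpha>) =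
        A.Y \<alpha> \<otimes>\<^bsub>A.R\<^esub> fc (A.mutation_factor a b (\<epsilon> \<alpha> \<kappa>)))"

definition monomial_values :: "int \<Rightarrow> ('e free_elt set set \<Rightarrow> 'e free_elt set set) \<Rightarrow> bool" where
  "monomial_values s \<nu> \<longleftrightarrow> \<nu> (B.Y \<kappa>') = inv\<^bsub>A.R\<^esub> x \<and>
     (\<forall>\<alpha> \<in> E - {\<kappa>}. \<nu> (B.Y \<alpha>) =
        monomial_image A.R q x (A.Y \<alpha>) (\<epsilon> \<alpha> \<kappa>) (nat (max (s * \<epsilon> \<alpha> \<kappa>) 0)))"

lemma x_root: "x \<in> carrier A.R" "x [^]\<^bsub>A.R\<^esub> N = \<one>\<^bsub>A.R\<^esub>"
  using \<kappa> A.Y_power by simp_all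

text \<open>Expanding each entry as the difference of its positive and negative parts, the products
  of equal parts cancel. The matrix mutation thereby takes the form required of the exponents for
  either sign \<open>s\<close>.\<close>

lemma monomial_exists:
  assumes s: "s \<in> {1, - 1}"
  shows "\<exists>\<nu> \<in> alg_iso B.R A.R. monomial_values s \<nu>"
  unfolding monomial_values_def
proof (rule monomial_iso_exists[OF A.cyclic_seed_axioms B.cyclic_seed_axioms \<kappa> \<kappa>' EE' eps_\<kappa>])
  fix \<alpha> \<beta> assume \<alpha>: "\<alpha> \<in> E - {\<kappa>}" and \<beta>: "\<beta> \<in> E - {\<kappa>}"
  have "\<epsilon> \<kappa> \<beta> = - \<epsilon> \<beta> \<kappa>"
    using A.skew[of \<beta> \<kappa>] \<beta> \<kappa> by simp
  then show "\<epsilon>' \<alpha> \<beta> = \<epsilon> \<alpha> \<beta> + int (nat (max (s * \<epsilon> \<beta> \<kappa>) 0)) * \<epsilon> \<alpha> \<kappa> -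
      int (nat (max (s * \<epsilon> \<alpha> \<kappa>) 0)) * \<epsilon> \<beta> \<kappa>"
    using eps[OF \<alpha> \<beta>] s
    by (cases "\<epsilon> \<alpha> \<kappa> \<ge> 0"; cases "\<epsilon> \<beta> \<kappa> \<ge> 0") (auto simp: max_def algebra_simps)
qed

text \<open>Existence may therefore be shown with one particular solution of the recursion: every
  factorisation with the right values on the generators is the same map.\<close>

lemma mutation_unique:
  assumes \<phi>: "\<phi> \<in> alg_hom B.R A.R" and \<psi>: "\<psi> \<in> alg_hom B.R A.R" and "mutates \<phi>" "mutates \<psi>"
    and y: "y \<in> carrier B.R"
  shows "\<phi> y = \<psi> y"
proof (rule B.alg_hom_eqI'[OF A.R.complex_algebra_axioms \<phi> \<psi> _ y])
  fix \<alpha> assume "\<alpha> \<in> E'"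
  then show "\<phi> (B.Y \<alpha>) = \<psi> (B.Y \<alpha>)"
    using assms(3,4) EE' unfolding mutates_def by (cases "\<alpha> = \<kappa>'") auto
qed

text \<open>The hypothesis \<open>scalar\<close> isolates the comparison of functions on roots of
  unity, the part that differs between the two signs.\<close>

lemma mutates_Ad:
  assumes \<nu>: "monomial_values s \<nu>" and f: "\<And>z. z ^ N = 1 \<Longrightarrow> f z \<noteq> 0"
    and scalar: "\<And>z n. z ^ N = 1 \<Longrightarrow>
      f (q powi (2 * - n) * z) / f z * (q powi (- (n * max (s * n) 0)) * z ^ nat (max (s * n) 0)) =
      A.mutation_factor a b n z"
  shows "mutates (Ad A.R (fc f) \<circ> \<nu>)"
  unfolding mutates_def
proof (intro conjI ballI)
  show "(Ad A.R (fc f) \<circ> \<nu>) (B.Y \<kappa>') = inv\<^bsub>A.R\<^esub> x"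
    using \<nu> A.R.Ad_inv_x[OF x_root ab f] by (simp add: monomial_values_def)
  fix \<alpha> assume \<alpha>: "\<alpha> \<in> E - {\<kappa>}"
  let ?n = "\<epsilon> \<alpha> \<kappa>" and ?m = "nat (max (s * \<epsilon> \<alpha> \<kappa>) 0)"
  have "f (q powi (2 * - ?n) * z) / f z * (q powi (- (?n * int ?m)) * z ^ ?m) = A.mutation_factor a b ?n z"
    if "z ^ N = 1" for z
    using scalar[OF that, of ?n] by simp
  then have "Ad A.R (fc f) (monomial_image A.R q x (A.Y \<alpha>) ?n ?m) =
      A.Y \<alpha> \<otimes>\<^bsub>A.R\<^esub> fc (A.mutation_factor a b ?n)"
    using \<alpha> \<kappa> A.Y_qcomm f by (intro A.R.Ad_monomial_image[OF x_root ab]) auto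
  then show "(Ad A.R (fc f) \<circ> \<nu>) (B.Y \<alpha>) = A.Y \<alpha> \<otimes>\<^bsub>A.R\<^esub> fc (A.mutation_factor a b (\<epsilon> \<alpha> \<kappa>))"
    using \<nu> \<alpha> by (simp add: monomial_values_def)
qed

lemma mutation_exists: "\<exists>\<mu> \<in> alg_iso B.R A.R. mutates \<mu>"
proof -
  obtain f where f: "\<And>z. z ^ N = 1 \<Longrightarrow> f z \<noteq> 0" "\<And>z. z ^ N = 1 \<Longrightarrow> f (q\<^sup>2 * z) = (b + q * a * z) * f z"
    using A.dilog_function_exists[OF ab(1)] by blast
  obtain \<nu> where \<nu>: "\<nu> \<in> alg_iso B.R A.R" "monomial_values 1 \<nu>"
    using monomial_exists[of 1] by blast
  have "f (q powi (2 * - n) * z) / f z * (q powi (- (n * max (1 * n) 0)) * z ^ nat (max (1 * n) 0)) =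
      A.mutation_factor a b n z" if "z ^ N = 1" for z n
    using A.mutation_factor_pos[OF ab(1) f that, of n] by simp
  with \<nu>(2) f(1) have "mutates (Ad A.R (fc f) \<circ> \<nu>)"
    by (rule mutates_Ad)
  moreover have "Ad A.R (fc f) \<circ> \<nu> \<in> alg_iso B.R A.R"
    using A.R.calculus_Units(1)[OF x_root f(1)] by (intro alg_iso_comp[OF \<nu>(1)] A.R.Ad_alg_iso)
  ultimately show ?thesis
    by blast
qed

lemma decomposition_pos:
  assumes \<mu>: "\<mu> \<in> alg_hom B.R A.R" "mutates \<mu>" and \<nu>: "\<nu> \<in> alg_hom B.R A.R" "monomial_values 1 \<nu>"
    and \<Psi>: "\<And>z. z ^ N = 1 \<Longrightarrow> \<Psi> z \<noteq> 0" "\<And>z. z ^ N = 1 \<Longrightarrow> \<Psi> (q\<^sup>2 * z) = (b + q * a * z) * \<Psi> z"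
    and g: "g = functional_calculus A.R N q \<Psi> x"
  shows "g \<in> Units A.R" and "Ad_sign A.R g 1 \<in> alg_iso A.R A.R"
    and "y \<in> carrier B.R \<Longrightarrow> \<mu> y = Ad_sign A.R g 1 (\<nu> y)"
proof -
  show unit: "g \<in> Units A.R"
    unfolding g using A.R.calculus_Units(1)[OF x_root \<Psi>(1)] .
  show "Ad_sign A.R g 1 \<in> alg_iso A.R A.R"
    using A.R.Ad_alg_iso[OF unit] by (simp add: Ad_sign_def)
  have "\<Psi> (q powi (2 * - n) * z) / \<Psi> z * (q powi (- (n * max (1 * n) 0)) * z ^ nat (max (1 * n) 0)) =
      A.mutation_factor a b n z" if "z ^ N = 1" for z n
    using A.mutation_factor_pos[OF ab(1) \<Psi> that, of n] by simp
  with \<nu>(2) \<Psi>(1) have "mutates (Ad A.R (fc \<Psi>) \<circ> \<nu>)"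
    by (rule mutates_Ad)
  then show "\<mu> y = Ad_sign A.R g 1 (\<nu> y)" if "y \<in> carrier B.R"
    using mutation_unique[OF \<mu>(1) alg_hom_comp[OF \<nu>(1) A.R.Ad_alg_hom[OF unit]] \<mu>(2) _ that]
    by (simp add: Ad_sign_def g)
qed

text \<open>Inverting the conjugation replaces \<open>\<Psi> (1 / z)\<close> by its reciprocal
  \<open>f\<close>; the recursion of \<open>\<Psi>\<close> with swapped parameters turns into the
  one that \<open>mutation_factor_neg\<close> expects.\<close>

lemma decomposition_neg:
  assumes \<mu>: "\<mu> \<in> alg_hom B.R A.R" "mutates \<mu>" and \<nu>: "\<nu> \<in> alg_hom B.R A.R" "monomial_values (- 1) \<nu>"
    and \<Psi>: "\<And>z. z ^ N = 1 \<Longrightarrow> \<Psi> z \<noteq> 0" "\<And>z. z ^ N = 1 \<Longrightarrow> \<Psi> (q\<^sup>2 * z) = (a + q * b * z) * \<Psi> z"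
    and g: "g = functional_calculus A.R N q \<Psi> (inv\<^bsub>A.R\<^esub> x)"
  shows "g \<in> Units A.R" and "Ad_sign A.R g (- 1) \<in> alg_iso A.R A.R"
    and "y \<in> carrier B.R \<Longrightarrow> \<mu> y = Ad_sign A.R g (- 1) (\<nu> y)"
proof -
  define f where "f z = inverse (\<Psi> (inverse z))" for z
  have g_eq: "g = fc (\<lambda>z. \<Psi> (inverse z))"
    unfolding g by (rule A.R.calculus_inverse[OF x_root])
  have nonzero: "\<Psi> (inverse z) \<noteq> 0" if "z ^ N = 1" for z
    using that \<Psi>(1)[of "inverse z"] by (simp add: power_inverse)
  show unit: "g \<in> Units A.R"
    unfolding g_eq using nonzero by (rule A.R.calculus_Units(1)[OF x_root])
  have inv_g: "inv\<^bsub>A.R\<^esub> g = fc f"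
    unfolding g_eq f_def[abs_def] using nonzero by (rule A.R.calculus_Units(2)[OF x_root])
  show "Ad_sign A.R g (- 1) \<in> alg_iso A.R A.R"
    by (rule A.R.Ad_sign_neg_alg_iso[OF unit])
  have f_nonzero: "f z \<noteq> 0" if "z ^ N = 1" for z
    using nonzero[OF that] by (simp add: f_def)
  have f_step: "f (q\<^sup>2 * z) = inverse (q * z) * (b + q * a * z) * f z" if z: "z ^ N = 1" for z
  proof -
    \<comment> \<open>The recursion of \<open>\<Psi>\<close> is applied at the point that
      \<open>q^2\<close> carries to \<open>inverse z\<close>.\<close>
    define w where "w = inverse (q\<^sup>2 * z)"
    have z0: "z \<noteq> 0"
      using z A.N_pos by (auto simp: power_0_left)
    have w: "w ^ N = 1"
      using z by (simp add: w_def power_mult_distrib power_inverse flip: power_mult)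
    have "q\<^sup>2 * w = inverse z"
      using z0 by (simp add: w_def)
    moreover have "q * b * w = b * inverse (q * z)"
      using z0 by (simp add: w_def power2_eq_square field_simps)
    ultimately have "\<Psi> (inverse z) = (a + b * inverse (q * z)) * \<Psi> w"
      using \<Psi>(2)[OF w] by simp
    moreover have "a + b * inverse (q * z) = inverse (q * z) * (b + q * a * z)"
      using z0 by (simp add: field_simps)
    ultimately have eq: "\<Psi> (inverse z) = inverse (q * z) * (b + q * a * z) * \<Psi> w"
      by simp
    then have "inverse (q * z) * (b + q * a * z) \<noteq> 0"
      using nonzero[OF z] by auto
    then have "inverse (\<Psi> w) = inverse (q * z) * (b + q * a * z) * inverse (\<Psi> (inverse z))"
      unfolding eq inverse_mult_distrib[of _ "\<Psi> w"] by (metis mult.assoc mult.left_neutral right_inverse)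
    then show ?thesis
      by (simp add: f_def w_def)
  qed
  have scalar: "f (q powi (2 * - n) * z) / f z * (q powi (- (n * max (- 1 * n) 0)) * z ^ nat (max (- 1 * n) 0)) =
      A.mutation_factor a b n z" if "z ^ N = 1" for z n
    using A.mutation_factor_neg[OF ab(1) f_nonzero f_step that, of n] by simp
  have "mutates (Ad A.R (fc f) \<circ> \<nu>)"
    using \<nu>(2) f_nonzero scalar by (rule mutates_Ad)
  then have eq: "\<mu> y = Ad A.R (inv\<^bsub>A.R\<^esub> g) (\<nu> y)" if "y \<in> carrier B.R"
    using mutation_unique[OF \<mu>(1) alg_hom_comp[OF \<nu>(1) A.R.Ad_alg_hom[OF A.R.Units_inv_Units[OF unit]]] \<mu>(2) _ that]
    by (simp add: inv_g)
  show "\<mu> y = Ad_sign A.R g (- 1) (\<nu> y)" if y: "y \<in> carrier B.R"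
    using eq[OF y] A.R.inv_into_Ad[OF unit alg_hom_simps(1)[OF \<nu>(1) y]] by (simp add: Ad_sign_def)
qed


end

section \<open>Cyclic quantum tori of ideal triangulations\<close>

lemma X_algebra_eq: "X_algebra N q D p = cyclic_torus N q (exchange D) (edges D) (\<lambda>\<alpha>. rescaling (p \<alpha>))"
  by (simp add: X_algebra_def)

lemma X_bar_eq: "X_bar N q D p = cyclic_var N q (exchange D) (edges D) (\<lambda>\<alpha>. rescaling (p \<alpha>))"
  by (simp add: fun_eq_iff X_bar_def X_var_def X_algebra_def cyclic_var_def)

lemma fermat_bar_snd_nonzero: "p \<in> fermat_bar N \<Longrightarrow> snd p \<noteq> 0"
  by (auto simp: fermat_bar_def fermat_def)

lemma global_coefficient_fermat_bar:
  assumes "global_coefficient N S A M P" and "ideal_triangulation S A M D" and "\<alpha> \<in> edges D"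
  shows "P D \<alpha> \<in> fermat_bar N"
  using assms unfolding global_coefficient_def fermat_bar_def by (metis insertI2)

text \<open>A boundary coefficient \<open>(0, 1)\<close> has rescaling 1, and every other
  coefficient has a nonzero ratio, so all generators can be rescaled.\<close>

lemma cyclic_seed_triangulation:
  assumes "root_of_unity N q" and P: "global_coefficient N S A M P" and D: "ideal_triangulation S A M D"
  shows "cyclic_seed N q (exchange D) (edges D) (\<lambda>\<alpha>. rescaling (P D \<alpha>))"
proof (intro cyclic_seed.intro cyclic_seed_axioms.intro assms(1))
  fix \<alpha> \<beta> assume "\<alpha> \<in> edges D"
  then show "rescaling (P D \<alpha>) \<noteq> 0"
    using fermat_bar_snd_nonzero[OF global_coefficient_fermat_bar[OF P D]]
    by (simp add: rescaling_def exchange_ratio_def)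
  show "exchange D \<beta> \<alpha> = - exchange D \<alpha> \<beta>"
    by (rule exchange_skew[OF finite_faces[OF D]])
qed

section \<open>The seeds and coefficients of a flip\<close>

locale cyclic_flip = root_of_unity N q for N :: nat and q :: complex +
  fixes S :: "'a topology" and A :: "'a atlas" and M :: "'a set"
    and P :: "'a triangulation \<Rightarrow> 'a set \<Rightarrow> complex \<times> complex"
    and D D' :: "'a triangulation" and \<kappa> \<kappa>' :: "'a set"
  assumes coefficient: "global_coefficient N S A M P" and flip: "flip S A M D \<kappa> \<kappa>' D'"
begin

lemma flip_simps:
  shows "ideal_triangulation S A M D" "ideal_triangulation S A M D'"
    and "\<kappa> \<in> interior_edges A D" "\<kappa> \<in> edges D" "\<kappa>' \<notin> edges D"
    and "edges D' = insert \<kappa>' (edges D - {\<kappa>})"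
  using flip unfolding flip_def interior_edges_def by blast+

lemma P_\<kappa>: "P D \<kappa> \<in> fermat N"
  using coefficient flip_simps(1,3,4) unfolding global_coefficient_def by metis

sublocale cyclic_mutation N q "exchange D" "exchange D'" "edges D" "edges D'"
  "\<lambda>\<alpha>. rescaling (P D \<alpha>)" "\<lambda>\<alpha>. rescaling (P D' \<alpha>)" \<kappa> \<kappa>' "fst (P D \<kappa>)" "snd (P D \<kappa>)"
proof (intro cyclic_mutation.intro cyclic_mutation_axioms.intro
    cyclic_seed_triangulation[OF root_of_unity_axioms coefficient] flip_simps(1,2,4))
  show "\<kappa>' \<in> edges D'" "edges D - {\<kappa>} = edges D' - {\<kappa>'}"
    using flip_simps(5,6) by auto
  show "fst (P D \<kappa>) ^ N + snd (P D \<kappa>) ^ N = 1" "fst (P D \<kappa>) \<noteq> 0" "snd (P D \<kappa>) \<noteq> 0"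
    using P_\<kappa> by (auto simp: fermat_def)
  fix \<alpha> \<beta> assume "\<alpha> \<in> edges D - {\<kappa>}"
  then show "exchange D' \<alpha> \<kappa>' = - exchange D \<alpha> \<kappa>"
    by (rule exchange_flip(1)[OF flip])
  assume "\<beta> \<in> edges D - {\<kappa>}"
  then show "exchange D' \<alpha> \<beta> = exchange D \<alpha> \<beta> +
       max (exchange D \<alpha> \<kappa>) 0 * max (exchange D \<kappa> \<beta>) 0 -
       max (- exchange D \<alpha> \<kappa>) 0 * max (- exchange D \<kappa> \<beta>) 0"
    by (rule exchange_flip(2)[OF flip \<open>\<alpha> \<in> edges D - {\<kappa>}\<close>])
qed

lemma X_algebra_simps:
  "X_algebra N q D (P D) = A.R" "X_algebra N q D' (P D') = B.R"
  "X_bar N q D (P D) = A.Y" "X_bar N q D' (P D') = B.Y"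
  "X_var N q D (P D) = A.X" "X_var N q D' (P D') = B.X"
  by (simp_all add: X_algebra_eq X_bar_eq X_var_def fun_eq_iff)

text \<open>The flip multiplies the ratio by a nonzero number, so \<open>rescaling\<close> is the
  ratio before and after. At ratio 0 it is 1 by convention and would not follow the flip
  rule.\<close>

lemma rescaling_flip:
  assumes \<alpha>: "\<alpha> \<in> edges D - {\<kappa>}" and ratio: "exchange_ratio (P D \<alpha>) \<noteq> 0"
  shows "rescaling (P D' \<alpha>) = rescaling (P D \<alpha>) *
    (let n = exchange D \<alpha> \<kappa> in if 0 \<le> n then fst (P D \<kappa>) powi n else snd (P D \<kappa>) powi n)"
proof -
  have "exchange_ratio (P D' \<alpha>) = exchange_ratio (P D \<alpha>) *
      (let n = exchange D \<alpha> \<kappa> in if 0 \<le> n then fst (P D \<kappa>) powi n else snd (P D \<kappa>) powi n)"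
    using coefficient flip \<alpha> unfolding global_coefficient_def Let_def by blast
  moreover from this have "exchange_ratio (P D' \<alpha>) \<noteq> 0"
    using ratio ab(2,3) by (auto simp: Let_def power_int_not_zero)
  ultimately show ?thesis
    using ratio unfolding rescaling_def exchange_ratio_def by auto
qed

lemma rescaling_\<kappa>:
  "rescaling (P D \<kappa>) = fst (P D \<kappa>) / snd (P D \<kappa>)" "rescaling (P D' \<kappa>') = snd (P D \<kappa>) / fst (P D \<kappa>)"
proof -
  have "fst (P D' \<kappa>') = snd (P D \<kappa>)" "snd (P D' \<kappa>') = fst (P D \<kappa>)"
    using coefficient flip unfolding global_coefficient_def by blast+
  then show "rescaling (P D \<kappa>) = fst (P D \<kappa>) / snd (P D \<kappa>)" "rescaling (P D' \<kappa>') = snd (P D \<kappa>) / fst (P D \<kappa>)"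
    using ab(2,3) by (simp_all add: rescaling_def exchange_ratio_def)
qed

text \<open>The rescaled clauses cover all edges, including those with ratio 0, and so fix the
  values on every generator.\<close>

lemma cluster_poisson_mutates:
  assumes "cluster_poisson N q D (P D) \<kappa> D' (P D') \<kappa>' \<phi>"
  shows "mutates \<phi>"
proof -
  let ?a = "fst (P D \<kappa>)" and ?b = "snd (P D \<kappa>)"
  have \<kappa>_eq: "\<phi> (B.Y \<kappa>') = inv\<^bsub>A.R\<^esub> x"
    using assms unfolding cluster_poisson_def X_algebra_simps Let_def by (elim conjE)
  have "\<forall>\<alpha> \<in> edges D - {\<kappa>}. if exchange D \<alpha> \<kappa> < 0
      then \<phi> (B.Y \<alpha>) = A.Y \<alpha> \<otimes>\<^bsub>A.R\<^esub>
        ordered_prod A.R (cluster_factor A.R q ?b ?a x) (nat \<bar>exchange D \<alpha> \<kappa>\<bar>)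
      else (\<forall>j \<in> {1..nat (exchange D \<alpha> \<kappa>)}. cluster_factor A.R q ?a ?b (inv\<^bsub>A.R\<^esub> x) j \<in> Units A.R) \<and>
        \<phi> (B.Y \<alpha>) = A.Y \<alpha> \<otimes>\<^bsub>A.R\<^esub> ordered_prod A.R
          (\<lambda>j. inv\<^bsub>A.R\<^esub> (cluster_factor A.R q ?a ?b (inv\<^bsub>A.R\<^esub> x) j)) (nat (exchange D \<alpha> \<kappa>))"
    using assms unfolding cluster_poisson_def X_algebra_simps Let_def by (elim conjE)
  then have "\<phi> (B.Y \<alpha>) = A.Y \<alpha> \<otimes>\<^bsub>A.R\<^esub> fc (mutation_factor ?a ?b (exchange D \<alpha> \<kappa>))"
    if "\<alpha> \<in> edges D - {\<kappa>}" for \<alpha>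
    using that A.R.ordered_prod_neg[OF x_root ab, of "exchange D \<alpha> \<kappa>"]
      A.R.ordered_prod_pos[OF x_root ab, of "exchange D \<alpha> \<kappa>"]
    by (cases "exchange D \<alpha> \<kappa> < 0") auto
  then show ?thesis
    using \<kappa>_eq unfolding mutates_def by blast
qed

text \<open>In the unscaled clauses the scalar pulled out of the product is exactly the factor by
  which \<open>rescaling\<close> changes under the flip.\<close>

lemma mutates_cluster_poisson:
  assumes \<phi>: "\<phi> \<in> alg_hom B.R A.R" and mut: "mutates \<phi>"
  shows "cluster_poisson N q D (P D) \<kappa> D' (P D') \<kappa>' \<phi>"
  unfolding cluster_poisson_def X_algebra_simps Let_def
proof (intro conjI ballI impI)
  let ?a = "fst (P D \<kappa>)" and ?b = "snd (P D \<kappa>)"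
  have \<kappa>_eq: "\<phi> (B.Y \<kappa>') = inv\<^bsub>A.R\<^esub> x"
    and \<alpha>_eq: "\<And>\<alpha>. \<alpha> \<in> edges D - {\<kappa>} \<Longrightarrow>
      \<phi> (B.Y \<alpha>) = A.Y \<alpha> \<otimes>\<^bsub>A.R\<^esub> fc (mutation_factor ?a ?b (exchange D \<alpha> \<kappa>))"
    using mut unfolding mutates_def by blast+
  have X_\<kappa>: "A.X \<kappa> = (?a / ?b) \<odot>\<^bsub>A.R\<^esub> x"
    using A.X_eq_Y[OF \<kappa>] by (simp add: rescaling_\<kappa>)
  show "\<phi> (B.Y \<kappa>') = inv\<^bsub>A.R\<^esub> x"
    by (rule \<kappa>_eq)
  show "\<phi> (B.X \<kappa>') = inv\<^bsub>A.R\<^esub> (A.X \<kappa>)"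
  proof -
    have "\<phi> (B.X \<kappa>') = (?b / ?a) \<odot>\<^bsub>A.R\<^esub> inv\<^bsub>A.R\<^esub> x"
      using B.X_eq_Y[OF \<kappa>'] \<kappa>' by (simp add: rescaling_\<kappa> alg_hom_simps(5)[OF \<phi>] \<kappa>_eq)
    then show ?thesis
      using A.R.smult_inverse[of "?a / ?b" x] ab A.Y_Units[OF \<kappa>] by (simp add: X_\<kappa>)
  qed
  fix \<alpha> assume \<alpha>: "\<alpha> \<in> edges D - {\<kappa>}"
  let ?n = "exchange D \<alpha> \<kappa>"
  let ?F = "cluster_factor A.R q 1 1 (A.X \<kappa> [^]\<^bsub>A.R\<^esub> (- sgn ?n))"
  have F: "?F = cluster_factor A.R q 1 1 (((?a / ?b) \<odot>\<^bsub>A.R\<^esub> x) [^]\<^bsub>A.R\<^esub> (- sgn ?n))"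
    by (simp add: X_\<kappa>)
  show "?F j \<in> Units A.R" if "j \<in> {1..nat \<bar>?n\<bar>}" for j
    by (rule A.R.ordered_prod_unscaled(1)[OF x_root ab F that])
  show "\<phi> (B.X \<alpha>) = A.X \<alpha> \<otimes>\<^bsub>A.R\<^esub> ordered_prod A.R (\<lambda>j. ?F j [^]\<^bsub>A.R\<^esub> (- sgn ?n)) (nat \<bar>?n\<bar>)"
    if ratio: "exchange_ratio (P D \<alpha>) \<noteq> 0"
  proof -
    have \<alpha>': "\<alpha> \<in> edges D" "\<alpha> \<in> edges D'"
      using \<alpha> EE' by auto
    have "\<phi> (B.X \<alpha>) = rescaling (P D' \<alpha>) \<odot>\<^bsub>A.R\<^esub>
        (A.Y \<alpha> \<otimes>\<^bsub>A.R\<^esub> fc (mutation_factor ?a ?b ?n))"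
      using B.X_eq_Y[OF \<alpha>'(2)] \<alpha>'(2) by (simp add: alg_hom_simps(5)[OF \<phi>] \<alpha>_eq[OF \<alpha>])
    then show ?thesis
      unfolding A.R.ordered_prod_unscaled(2)[OF x_root ab F] rescaling_flip[OF \<alpha> ratio] Let_def A.X_eq_Y[OF \<alpha>'(1)]
      using \<alpha>'(1) A.R.calculus_closed[OF x_root]
      by (simp add: A.R.smult_mult_l A.R.smult_mult_r A.R.smult_smult mult.commute)
  qed
  show "if ?n < 0
      then \<phi> (B.Y \<alpha>) = A.Y \<alpha> \<otimes>\<^bsub>A.R\<^esub> ordered_prod A.R (cluster_factor A.R q ?b ?a x) (nat \<bar>?n\<bar>)
      else (\<forall>j \<in> {1..nat ?n}. cluster_factor A.R q ?a ?b (inv\<^bsub>A.R\<^esub> x) j \<in> Units A.R) \<and>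
        \<phi> (B.Y \<alpha>) = A.Y \<alpha> \<otimes>\<^bsub>A.R\<^esub> ordered_prod A.R
          (\<lambda>j. inv\<^bsub>A.R\<^esub> (cluster_factor A.R q ?a ?b (inv\<^bsub>A.R\<^esub> x) j)) (nat ?n)"
    using A.R.ordered_prod_neg[OF x_root ab, of ?n] A.R.ordered_prod_pos[OF x_root ab, of ?n]
      A.R.cluster_factor_pos_Units(1)[OF x_root ab] \<alpha>_eq[OF \<alpha>]
    by (cases "?n < 0") simp_all
qed

lemma monomial_values_transformation:
  assumes "monomial_values s \<nu>"
  shows "monomial_transformation N q D (P D) \<kappa> D' (P D') \<kappa>' s \<nu>"
  unfolding monomial_transformation_def X_algebra_simps Let_def
proof (intro conjI ballI)
  show "\<nu> (B.Y \<kappa>') = inv\<^bsub>A.R\<^esub> x"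
    using assms by (simp add: monomial_values_def)
  fix \<alpha> assume \<alpha>: "\<alpha> \<in> edges D - {\<kappa>}"
  let ?n = "exchange D \<alpha> \<kappa>"
  let ?m = "nat (max (s * ?n) 0)"
  \<comment> \<open>The transformation is stated with an integer exponent, the computation uses a
    natural one; truncation at 0 reconciles them.\<close>
  have pow: "x [^]\<^bsub>A.R\<^esub> max (s * ?n) 0 = x [^]\<^bsub>A.R\<^esub> ?m"
    using int_pow_int[of A.R x ?m] by simp
  have \<alpha>': "\<alpha> \<in> edges D"
    using \<alpha> by simp
  have "A.R.qcomm (int ?m * ?n) (A.Y \<alpha>) (x [^]\<^bsub>A.R\<^esub> ?m)"
    by (rule A.R.qcomm_pow_r[OF A.Y_closed[OF \<alpha>'] x_root(1) A.Y_qcomm[OF \<alpha>' \<kappa>]])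
  then have "weyl_bracket A.R q (A.Y \<alpha>) (x [^]\<^bsub>A.R\<^esub> ?m) =
      q powi (- (int ?m * ?n)) \<odot>\<^bsub>A.R\<^esub> (A.Y \<alpha> \<otimes>\<^bsub>A.R\<^esub> x [^]\<^bsub>A.R\<^esub> ?m)"
    by (rule A.R.weyl_bracket_eq[OF A.Y_Units[OF \<alpha>'] A.R.nat_pow_Units[OF A.Y_Units[OF \<kappa>]]])
  then have "weyl_bracket A.R q (A.Y \<alpha>) (x [^]\<^bsub>A.R\<^esub> max (s * ?n) 0) =
      monomial_image A.R q x (A.Y \<alpha>) ?n ?m"
    unfolding pow monomial_image_def by (simp only: mult.commute)
  then show "\<nu> (B.Y \<alpha>) = weyl_bracket A.R q (A.Y \<alpha>) (x [^]\<^bsub>A.R\<^esub> max (s * ?n) 0)"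
    using assms \<alpha> by (simp add: monomial_values_def)
qed

end

text \<open>\<open>q^2 = q2 ^ (N + 1) = q2\<close>, so primitivity of \<open>q2\<close> is the
  condition on \<open>q ^ (2 * k)\<close>.\<close>

lemma root_of_unity_square_root:
  assumes "odd N" and "q2 ^ N = 1" and "\<And>k. 0 < k \<Longrightarrow> k < N \<Longrightarrow> q2 ^ k \<noteq> 1"
    and "q = q2 ^ ((N + 1) div 2)"
  shows "root_of_unity N q"
proof
  have "(N + 1) div 2 * 2 = N + 1"
    using assms(1) by presburger
  then have "q\<^sup>2 = q2"
    unfolding assms(4) power_mult[symmetric] by (simp add: assms(2))
  then show "q ^ (2 * k) \<noteq> 1" if "0 < k" "k < N" for k
    unfolding power_mult using assms(3) that by simp
  show "q ^ N = 1"
    unfolding assms(4) power_mult[symmetric] mult.commute[of _ N] power_mult[of q2 N] assms(2) by simp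
qed (rule assms)

theorem proposition5p7:
  fixes N :: nat and q q2 :: complex
    and S :: "'a topology" and A :: "'a atlas" and M :: "'a set"
    and P :: "'a triangulation \<Rightarrow> 'a set \<Rightarrow> complex \<times> complex"
    and D D' :: "'a triangulation" and \<kappa> \<kappa>' :: "'a set"
  assumes "odd N"
    and "q2 ^ N = 1" and "\<And>k. 0 < k \<Longrightarrow> k < N \<Longrightarrow> q2 ^ k \<noteq> 1"
    and "q = q2 ^ ((N + 1) div 2)"
    and "marked_surface S A M"
    and "global_coefficient N S A M P"
    and "flip S A M D \<kappa> \<kappa>' D'"
  shows
    "let R = X_algebra N q D (P D); R' = X_algebra N q D' (P D') in
     \<exists>\<mu> \<in> alg_iso R' R.
       cluster_poisson N q D (P D) \<kappa> D' (P D') \<kappa>' \<mu> \<and>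
       (\<forall>\<phi> \<in> alg_hom R' R. cluster_poisson N q D (P D) \<kappa> D' (P D') \<kappa>' \<phi> \<longrightarrow>
          (\<forall>x \<in> carrier R'. \<phi> x = \<mu> x)) \<and>
       (\<forall>s \<in> {1, - 1}.
          \<exists>\<nu> \<in> alg_iso R' R.
            monomial_transformation N q D (P D) \<kappa> D' (P D') \<kappa>' s \<nu> \<and>
            (\<forall>\<Psi>. (\<forall>k<N. q ^ (2 * k) \<in> dilog_domain N (coeff_power (P D \<kappa>) s)) \<and>
                  dilog_branch N q (coeff_power (P D \<kappa>) s) \<Psi> \<longrightarrow>
               (let g = functional_calculus R N q \<Psi> (X_bar N q D (P D) \<kappa> [^]\<^bsub>R\<^esub> s) in
                  g \<in> Units R \<and>
                  Ad_sign R g s \<in> alg_iso R R \<and>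
                  (\<forall>x \<in> carrier R'. \<mu> x = Ad_sign R g s (\<nu> x)))))"
proof -
  interpret root_of_unity N q
    using assms(1-4) by (rule root_of_unity_square_root)
  interpret F: cyclic_flip N q S A M P D D' \<kappa> \<kappa>'
    by unfold_locales (rule assms)+
  let ?a = "fst (P D \<kappa>)" and ?b = "snd (P D \<kappa>)"
  \<comment> \<open>The map is fixed before the sign and the branch are chosen, so that one
    \<open>\<mu>\<close> serves all decompositions.\<close>
  obtain \<mu> where \<mu>: "\<mu> \<in> alg_iso F.B.R F.A.R" "F.mutates \<mu>"
    using F.mutation_exists by blast
  note \<mu>_hom = alg_iso_hom[OF \<mu>(1)]
  have unique: "\<forall>\<phi> \<in> alg_hom F.B.R F.A.R. cluster_poisson N q D (P D) \<kappa> D' (P D') \<kappa>' \<phi> \<longrightarrow>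
      (\<forall>x \<in> carrier F.B.R. \<phi> x = \<mu> x)"
    using F.mutation_unique[OF _ \<mu>_hom F.cluster_poisson_mutates \<mu>(2)] by blast
  have decomposition: "\<exists>\<nu> \<in> alg_iso F.B.R F.A.R.
      monomial_transformation N q D (P D) \<kappa> D' (P D') \<kappa>' s \<nu> \<and>
      (\<forall>\<Psi>. (\<forall>k<N. q ^ (2 * k) \<in> dilog_domain N (coeff_power (P D \<kappa>) s)) \<and>
            dilog_branch N q (coeff_power (P D \<kappa>) s) \<Psi> \<longrightarrow>
         (let g = functional_calculus F.A.R N q \<Psi> (F.x [^]\<^bsub>F.A.R\<^esub> s) in
            g \<in> Units F.A.R \<and> Ad_sign F.A.R g s \<in> alg_iso F.A.R F.A.R \<and>
            (\<forall>x \<in> carrier F.B.R. \<mu> x = Ad_sign F.A.R g s (\<nu> x))))"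
    if s: "s \<in> {1, - 1}" for s
  proof -
    obtain \<nu> where \<nu>: "\<nu> \<in> alg_iso F.B.R F.A.R" "F.monomial_values s \<nu>"
      using F.monomial_exists[OF s] by blast
    note \<nu>_hom = alg_iso_hom[OF \<nu>(1)]
    have "let g = functional_calculus F.A.R N q \<Psi> (F.x [^]\<^bsub>F.A.R\<^esub> s) in
        g \<in> Units F.A.R \<and> Ad_sign F.A.R g s \<in> alg_iso F.A.R F.A.R \<and>
        (\<forall>x \<in> carrier F.B.R. \<mu> x = Ad_sign F.A.R g s (\<nu> x))"
      if branch: "dilog_branch N q (coeff_power (P D \<kappa>) s) \<Psi>" for \<Psi>
    proof (cases "s = 1")
      case True
      then have \<Psi>: "\<Psi> z \<noteq> 0" "\<Psi> (q\<^sup>2 * z) = (?b + q * ?a * z) * \<Psi> z" if "z ^ N = 1" for z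
        using dilog_branch_shift[OF branch that] by (simp_all add: coeff_power_def)
      have "F.x [^]\<^bsub>F.A.R\<^esub> s = F.x"
        using True F.x_root(1) by (simp add: F.A.R.int_pow_unit)
      then show ?thesis
        using F.decomposition_pos[OF \<mu>_hom \<mu>(2) \<nu>_hom _ \<Psi> refl] \<nu>(2) True unfolding Let_def by simp
    next
      case False
      then have s': "s = - 1"
        using s by simp
      \<comment> \<open>For the negative sign \<open>coeff_power\<close> swaps the coordinates, so
        \<open>a\<close> and \<open>b\<close> trade places in the recursion, as
        \<open>decomposition_neg\<close> expects.\<close>
      then have \<Psi>: "\<Psi> z \<noteq> 0" "\<Psi> (q\<^sup>2 * z) = (?a + q * ?b * z) * \<Psi> z" if "z ^ N = 1" for z
        using dilog_branch_shift[OF branch that] by (simp_all add: coeff_power_def)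
      have "F.x [^]\<^bsub>F.A.R\<^esub> s = inv\<^bsub>F.A.R\<^esub> F.x"
        using s' F.x_root(1) by (simp add: F.A.R.int_pow_unit)
      then show ?thesis
        using F.decomposition_neg[OF \<mu>_hom \<mu>(2) \<nu>_hom _ \<Psi> refl] \<nu>(2) s' unfolding Let_def by simp
    qed
    then show ?thesis
      using \<nu>(1) F.monomial_values_transformation[OF \<nu>(2)] by blast
  qed
  show ?thesis
    unfolding Let_def F.X_algebra_simps
  proof (rule bexI[OF _ \<mu>(1)], intro conjI)
    show "cluster_poisson N q D (P D) \<kappa> D' (P D') \<kappa>' \<mu>"
      by (rule F.mutates_cluster_poisson[OF \<mu>_hom \<mu>(2)])
  qed (rule unique, rule ballI, rule decomposition[unfolded Let_def])
qed

end
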